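(* Let $\sigma=2$, $\alpha>0$, $\tau>1$, $\mu>0$ and set $$\mu^\star=\frac{\sqrt3}{2}\left(\frac{\pi}{2}+2\arcsin\left(\frac{1}{\sqrt{1+\tau^4}}\right)\right),\qquad \widetilde\mu=\frac{\sqrt3}{2}\left(\frac{3\pi}{2}-2\arcsin\left(\frac{1}{\sqrt{1+\tau^4}}\right)\right).$$ Then: (1) $$\mathcal E_\alpha(\mu)=\begin{cases}-c & \text{if } 0<\mu<\mu^\star,\\ -\infty & \text{if }\mu\ge\mu^\star,\end{cases}$$ with $c>0$ a (finite) constant depending on $\alpha,\tau,\mu$. (2) Ground States of $E_\alpha$ at mass $\mu$ exist if and only if $0<\mu<\mu^\star$. (3) Further positive stationary states of $E_\alpha$ at mass $\mu$ (that is, positive stationary states which are not Ground States) exist if and only if $\frac{\sqrt3}{2}\pi<\mu<\widetilde\mu$.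
   Context: Write $\mathbb R^-=(-\infty,0)$, $\mathbb R^+=(0,+\infty)$. For $\tau>1$ let $$\mathcal D^\tau=\{u\in H^1(\mathbb R^-)\oplus H^1(\mathbb R^+): u(0^+)=\tau u(0^-)\}$$ (complex-valued functions on $\mathbb R\setminus\{0\}$), and for $\mu>0$ let $\mathcal D^\tau_\mu=\{u\in\mathcal D^\tau:\|u\|_{L^2(\mathbb R)}^2=\mu\}$; $\|u\|_{L^2(\mathbb R)}^2$ is the mass of $u$. With $\sigma=2$ the energy is, for $u\in\mathcal D^\tau$, $$E_\alpha(u)=\frac12\left(\|u'\|_{L^2(\mathbb R^-)}^2+\|u'\|_{L^2(\mathbb R^+)}^2\right)-\frac16\|u\|_{L^{6}(\mathbb R)}^{6}-\frac{\alpha}{2}|u(0^-)|^2,$$ and $\mathcal E_\alpha(\mu)=\inf\{E_\alpha(v): v\in\mathcal D^\tau_\mu\}$. A Ground State of $E_\alpha$ at mass $\mu$ is a nonnegative minimizer of $E_\alpha$ on $\mathcal D^\tau_\mu$. A stationary state of $E_\alpha$ at mass $\mu$ is a critical point of $E_\alpha$ constrained to $\mathcal D^\tau_\mu$, i.e. $u\in\mathcal D^\tau_\mu$ such that the differential of $E_\alpha$ at $u$ (with $\mathcal D^\tau$ regarded as a real Hilbert space with the $H^1(\mathbb R^-)\oplus H^1(\mathbb R^+)$ norm) vanishes on every $\eta\in\mathcal D^\tau$ with $\mathrm{Re}\int_{\mathbb R}u\,\overline{\eta}\,dx=0$. *)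

theory Defs
  imports "HOL-Analysis.Analysis"
begin

section \<open>The space $H^1$ of an open interval\<close>

text \<open>
  Elements of $L^2$ are represented by Borel functions; every Lebesgue class has a Borel
  representative.
\<close>

definition L2_on :: "real set \<Rightarrow> (real \<Rightarrow> complex) \<Rightarrow> bool" where
  "L2_on I f \<longleftrightarrow> set_borel_measurable lborel I f \<and> set_integrable lborel I (\<lambda>x. norm (f x) ^ 2)"

definition L2_sq :: "real set \<Rightarrow> (real \<Rightarrow> complex) \<Rightarrow> real" where
  "L2_sq I f = (LBINT x:I. norm (f x) ^ 2)"

definition test_function :: "real set \<Rightarrow> (real \<Rightarrow> real) \<Rightarrow> bool" where
  "test_function I \<phi> \<longleftrightarrow>
     \<phi> C1_differentiable_on UNIV \<and> (\<exists>K. compact K \<and> K \<subseteq> I \<and> (\<forall>x. x \<notin> K \<longrightarrow> \<phi> x = 0))"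

text \<open>
  Following Brezis (Functional Analysis, Sobolev Spaces and PDEs, Section 8.2), weak derivatives
  are tested against $C^1_c(I)$. Real test functions suffice for complex-valued \<open>u\<close>, since the
  identity is linear in the test function.
\<close>

definition has_weak_deriv :: "real set \<Rightarrow> (real \<Rightarrow> complex) \<Rightarrow> (real \<Rightarrow> complex) \<Rightarrow> bool" where
  "has_weak_deriv I u g \<longleftrightarrow>
     (\<forall>\<phi>. test_function I \<phi> \<longrightarrow>
        (LBINT x:I. deriv \<phi> x *\<^sub>R u x) = - (LBINT x:I. \<phi> x *\<^sub>R g x))"

text \<open>
  A class in $H^1(I)$ is represented by its unique representative that is continuous on the open
  set \<open>I\<close>, so pointwise statements (positivity, one-sided limits) are meaningful. Values of the
  function outside \<open>I\<close> play no role.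
\<close>

definition H1 :: "real set \<Rightarrow> (real \<Rightarrow> complex) set" where
  "H1 I = {u. continuous_on I u \<and> L2_on I u \<and> (\<exists>g. L2_on I g \<and> has_weak_deriv I u g)}"

text \<open>Only determined up to null sets, and only used inside integrals over \<open>I\<close>.\<close>

definition weak_deriv :: "real set \<Rightarrow> (real \<Rightarrow> complex) \<Rightarrow> real \<Rightarrow> complex" where
  "weak_deriv I u = (SOME g. L2_on I g \<and> has_weak_deriv I u g)"

section \<open>The constrained energy problem\<close>

abbreviation Rminus :: "real set" where "Rminus \<equiv> {..<0}"
abbreviation Rplus :: "real set" where "Rplus \<equiv> {0<..}"

definition trace_left :: "(real \<Rightarrow> complex) \<Rightarrow> complex" where
  "trace_left u = Lim (at_left 0) u"

definition trace_right :: "(real \<Rightarrow> complex) \<Rightarrow> complex" where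
  "trace_right u = Lim (at_right 0) u"

text \<open>
  Functions on $\mathbb R\setminus\{0\}$ are encoded as functions on \<open>real\<close> with an arbitrary,
  irrelevant value at \<open>0\<close>.
\<close>

definition Dspace :: "real \<Rightarrow> (real \<Rightarrow> complex) set" where
  "Dspace \<tau> = {u. u \<in> H1 Rminus \<and> u \<in> H1 Rplus \<and> trace_right u = of_real \<tau> * trace_left u}"

definition mass :: "(real \<Rightarrow> complex) \<Rightarrow> real" where
  "mass u = L2_sq UNIV u"

definition Dmass :: "real \<Rightarrow> real \<Rightarrow> (real \<Rightarrow> complex) set" where
  "Dmass \<tau> \<mu> = {u \<in> Dspace \<tau>. mass u = \<mu>}"

definition energy :: "real \<Rightarrow> (real \<Rightarrow> complex) \<Rightarrow> real" where
  "energy \<alpha> u =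
     1/2 * (L2_sq Rminus (weak_deriv Rminus u) + L2_sq Rplus (weak_deriv Rplus u))
     - 1/6 * (LBINT x. norm (u x) ^ 6)
     - \<alpha>/2 * norm (trace_left u) ^ 2"

definition energy_inf :: "real \<Rightarrow> real \<Rightarrow> real \<Rightarrow> ereal" where
  "energy_inf \<alpha> \<tau> \<mu> = (INF v\<in>Dmass \<tau> \<mu>. ereal (energy \<alpha> v))"

definition ground_state :: "real \<Rightarrow> real \<Rightarrow> real \<Rightarrow> (real \<Rightarrow> complex) \<Rightarrow> bool" where
  "ground_state \<alpha> \<tau> \<mu> u \<longleftrightarrow>
     u \<in> Dmass \<tau> \<mu> \<and> (\<forall>v\<in>Dmass \<tau> \<mu>. energy \<alpha> u \<le> energy \<alpha> v) \<and>
     (\<forall>x. x \<noteq> 0 \<longrightarrow> Im (u x) = 0 \<and> 0 \<le> Re (u x))"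

definition H1_norm :: "(real \<Rightarrow> complex) \<Rightarrow> real" where
  "H1_norm u = sqrt (L2_sq Rminus u + L2_sq Rminus (weak_deriv Rminus u)
                   + L2_sq Rplus u + L2_sq Rplus (weak_deriv Rplus u))"

text \<open>
  Frechet differentiability on the real normed space \<open>Dspace \<tau>\<close>. It is spelled out because the
  space is a set of functions and not a type, so that \<open>has_derivative\<close> does not apply.
\<close>

definition bounded_real_linear_on_D :: "real \<Rightarrow> ((real \<Rightarrow> complex) \<Rightarrow> real) \<Rightarrow> bool" where
  "bounded_real_linear_on_D \<tau> L \<longleftrightarrow>
     (\<forall>v\<in>Dspace \<tau>. \<forall>w\<in>Dspace \<tau>. L (\<lambda>x. v x + w x) = L v + L w) \<and>
     (\<forall>c. \<forall>v\<in>Dspace \<tau>. L (\<lambda>x. c *\<^sub>R v x) = c * L v) \<and>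
     (\<exists>C. \<forall>v\<in>Dspace \<tau>. \<bar>L v\<bar> \<le> C * H1_norm v)"

definition has_differential_on_D ::
    "real \<Rightarrow> ((real \<Rightarrow> complex) \<Rightarrow> real) \<Rightarrow> ((real \<Rightarrow> complex) \<Rightarrow> real) \<Rightarrow> (real \<Rightarrow> complex) \<Rightarrow> bool"
  where
  "has_differential_on_D \<tau> F L u \<longleftrightarrow>
     bounded_real_linear_on_D \<tau> L \<and>
     (\<forall>\<epsilon>>0. \<exists>\<delta>>0. \<forall>h\<in>Dspace \<tau>. H1_norm h < \<delta> \<longrightarrow>
        \<bar>F (\<lambda>x. u x + h x) - F u - L h\<bar> \<le> \<epsilon> * H1_norm h)"

definition stationary_state :: "real \<Rightarrow> real \<Rightarrow> real \<Rightarrow> (real \<Rightarrow> complex) \<Rightarrow> bool" where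
  "stationary_state \<alpha> \<tau> \<mu> u \<longleftrightarrow>
     u \<in> Dmass \<tau> \<mu> \<and>
     (\<exists>L. has_differential_on_D \<tau> (energy \<alpha>) L u \<and>
        (\<forall>\<eta>\<in>Dspace \<tau>. Re (LBINT x. u x * cnj (\<eta> x)) = 0 \<longrightarrow> L \<eta> = 0))"

definition positive_stationary_state :: "real \<Rightarrow> real \<Rightarrow> real \<Rightarrow> (real \<Rightarrow> complex) \<Rightarrow> bool" where
  "positive_stationary_state \<alpha> \<tau> \<mu> u \<longleftrightarrow>
     stationary_state \<alpha> \<tau> \<mu> u \<and> (\<forall>x. x \<noteq> 0 \<longrightarrow> Im (u x) = 0 \<and> 0 < Re (u x))"

definition mu_star :: "real \<Rightarrow> real" where
  "mu_star \<tau> = sqrt 3 / 2 * (pi / 2 + 2 * arcsin (1 / sqrt (1 + \<tau> ^ 4)))"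

definition mu_tilde :: "real \<Rightarrow> real" where
  "mu_tilde \<tau> = sqrt 3 / 2 * (3 * pi / 2 - 2 * arcsin (1 / sqrt (1 + \<tau> ^ 4)))"

end

theory Submission
  imports Defs
begin

text \<open>
  A function on the line minus the origin is treated as a pair of absolutely continuous functions
  $v$, $w$ on $[0,\infty)$ with $w(0) = \tau v(0)$. Put $\kappa = 2/\sqrt3$, $M = \kappa\mu$ and
  $F(M) = ((1+\tau^4)\cos M + 2\tau^2)/\sin M$.

  For $f$ on the half-line and $s(x) = \int_x^\infty |f|^2$, the sum of $4|f'|^2 - \kappa^2|f|^6$ and
  $(\kappa\cot(\kappa s)|f|^4)'$ is nonnegative, which gives
  $\int 4|f'|^2 - \kappa^2|f|^6 \ge \kappa\cot(\kappa\|f\|^2)\,|f(0)|^4$. Adding both half-lines, the inequality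
  $\cot x + \tau^4\cot(M-x) \ge F(M)$ bounds the energy below by a quadratic polynomial in $|v(0)|^2$,
  whose minimum is $-\alpha^2/(2\kappa F(M))$ as long as $F(M) > 0$, that is for $\mu < \mu^\star$.

  A positive stationary state solves $f'' = k^2 f - f^5$, $f'^2 = k^2f^2 - f^6/3$ on both half-lines. The
  angle $\varphi = \arccos(-f'/(kf))$ satisfies $\varphi' = -\kappa f^2$ and tends to 0 at infinity, so the angles
  $x$, $y$ at the vertex satisfy $x + y = M$, $\sin y = \tau^2\sin x$ and
  $k(\cos x + \tau^2\cos y) = \alpha$. These equations are solvable exactly for $M < \kappa\mu^\star$, where
  the energy equals the lower bound, and for $\pi < M < \kappa\widetilde\mu$, where no ground state exists.
  For $\mu \ge \mu^\star$, multiples of the pairs with $\cos x + \tau^2\cos y = 0$ have energy tending to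
  $-\infty$ as $k \to \infty$.
\<close>

section \<open>Absolutely continuous functions on the closed half-line\<close>

text \<open>The constants come from a calibration. For a half-soliton the angle at x is kappa times
  the mass beyond x, and its cotangent is -sqrt 3 f'/f^3, so the square completed in the half-line
  inequality, that of 2f' + kappa cot(kappa s) f^3, vanishes identically: half-solitons are the
  equality case. The cotangent inequality is an equality exactly when sin y = tau^2 sin x, which is
  the jump condition for two half-solitons of equal frequency, and the quadratic polynomial is
  minimal exactly at the frequency that satisfies the derivative condition at the vertex. All three
  estimates are sharp at one explicit function, so the ground state is constructed and no
  compactness argument enters. The obstacle is regularity. Members of the space only have a weak
  derivative, chosen arbitrarily within its class, so product rule, limits at infinity and
  uniqueness of the derivative are set up for primitives of locally integrable functions.
  \<open>prim f g\<close> includes the value at 0, which turns the trace into an ordinary function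
  value.\<close>

definition prim :: "(real \<Rightarrow> 'a::euclidean_space) \<Rightarrow> (real \<Rightarrow> 'a) \<Rightarrow> bool" where
  "prim f g \<longleftrightarrow> (\<forall>x\<ge>0. set_integrable lborel {0..x} g \<and> f x = f 0 + (LBINT s:{0..x}. g s))"

lemma primI:
  assumes "\<And>x. 0 \<le> x \<Longrightarrow> set_integrable lborel {0..x} g" "\<And>x. 0 \<le> x \<Longrightarrow> f x = f 0 + (LBINT s:{0..x}. g s)"
  shows "prim f g"
  unfolding prim_def using assms by blast

lemma prim_eq: "prim f g \<Longrightarrow> 0 \<le> x \<Longrightarrow> f x = f 0 + (LBINT s:{0..x}. g s)"
  unfolding prim_def by blast

lemma prim_integrable:
  assumes "prim f g" "0 \<le> a" shows "set_integrable lborel {a..b} g"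
proof -
  have "set_integrable lborel {0..max 0 b} g" using assms(1) unfolding prim_def by (meson max.cobounded1)
  then show ?thesis by (rule set_integrable_subset) (use assms(2) in auto)
qed

lemma set_integrable_Ioc_Icc:
  fixes g :: "real \<Rightarrow> 'a::euclidean_space"
  shows "set_integrable lborel {a<..b} g \<longleftrightarrow> set_integrable lborel {a..b} g"
  by (rule set_integrable_discrete_difference[where X = "{a}"]) auto

lemma set_integral_Ioc_Icc:
  fixes g :: "real \<Rightarrow> 'a::euclidean_space"
  shows "(LBINT x:{a<..b}. g x) = (LBINT x:{a..b}. g x)"
  by (rule set_integral_discrete_difference[where X = "{a}"]) auto

lemma set_integrable_Ioi_Ici:
  fixes g :: "real \<Rightarrow> 'a::euclidean_space"
  shows "set_integrable lborel {a<..} g \<longleftrightarrow> set_integrable lborel {a..} g"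
  by (rule set_integrable_discrete_difference[where X = "{a}"]) auto

lemma set_integral_Ioi_Ici:
  fixes g :: "real \<Rightarrow> 'a::euclidean_space"
  shows "(LBINT x:{a<..}. g x) = (LBINT x:{a..}. g x)"
  by (rule set_integral_discrete_difference[where X = "{a}"]) auto

lemma set_integral_Icc_split:
  fixes g :: "real \<Rightarrow> 'a::euclidean_space"
  assumes "a \<le> b" "b \<le> c" "set_integrable lborel {a..c} g"
  shows "(LBINT x:{a..c}. g x) = (LBINT x:{a..b}. g x) + (LBINT x:{b..c}. g x)"
proof -
  have "{a..c} = {a..b} \<union> {b<..c}" using assms by auto
  then have "(LBINT x:{a..c}. g x) = (LBINT x:{a..b}. g x) + (LBINT x:{b<..c}. g x)"
    using assms by (auto intro!: set_integral_Un set_integrable_subset[OF assms(3)])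
  then show ?thesis by (simp add: set_integral_Ioc_Icc)
qed

lemma prim_diff:
  assumes "prim f g" "0 \<le> a" "a \<le> b" shows "f b - f a = (LBINT x:{a..b}. g x)"
proof -
  show ?thesis using set_integral_Icc_split[of 0 a b g] prim_integrable[OF assms(1), of 0 b]
      prim_eq[OF assms(1), of a] prim_eq[OF assms(1), of b] assms(2,3) by simp
qed

lemma prim_continuous:
  assumes "prim f g" shows "continuous_on {0..} f"
proof -
  have "continuous_on {0..b} f" if "b \<ge> 0" for b
  proof -
    have i: "set_integrable lborel {0..b} g" by (rule prim_integrable[OF assms]) simp
    have "continuous_on {0..b} (\<lambda>x. f 0 + integral {0..x} g)"
      by (intro continuous_intros indefinite_integral_continuous_1 set_borel_integral_eq_integral(1)[OF i])
    moreover have "f 0 + integral {0..x} g = f x" if "x \<in> {0..b}" for x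
      using that prim_eq[OF assms, of x] set_borel_integral_eq_integral(2)[OF prim_integrable[OF assms, of 0 x]] by simp
    ultimately show ?thesis by (rule continuous_on_eq)
  qed
  then show ?thesis
    unfolding continuous_on_eq_continuous_within
  proof (intro ballI)
    fix x :: real assume "\<And>b. 0 \<le> b \<Longrightarrow> \<forall>x\<in>{0..b}. continuous (at x within {0..b}) f" "x \<in> {0..}"
    then have "continuous (at x within {0..x+1}) f" by auto
    moreover have "at x within {0..} = at x within {0..x+1}"
      by (rule at_within_nhd[of _ "{..<x+1}"]) auto
    ultimately show "continuous (at x within {0..}) f" by simp
  qed
qed

lemma prim_cong:
  assumes "prim f g" "\<And>x. 0 \<le> x \<Longrightarrow> f x = f' x" shows "prim f' g"
  using prim_integrable[OF assms(1)] prim_eq[OF assms(1)] assms(2) by (intro primI) (metis order_refl)+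

lemma prim_const: "prim (\<lambda>x. c) (\<lambda>x. 0)"
  by (rule primI) (simp_all add: set_integrable_def)

lemma prim_add:
  assumes "prim f g" "prim f' g'" shows "prim (\<lambda>x. f x + f' x) (\<lambda>x. g x + g' x)"
proof (rule primI)
  fix x :: real assume x: "0 \<le> x"
  show "f x + f' x = f 0 + f' 0 + (LBINT s:{0..x}. g s + g' s)"
    using prim_eq[OF assms(1) x] prim_eq[OF assms(2) x] prim_integrable[OF assms(1), of 0 x]
      prim_integrable[OF assms(2), of 0 x] by (simp add: set_integral_add(2))
qed (intro set_integral_add(1) prim_integrable[OF assms(1)] prim_integrable[OF assms(2)]; simp)

lemma prim_bounded_linear:
  assumes "bounded_linear T" "prim f g" shows "prim (\<lambda>x. T (f x)) (\<lambda>x. T (g x))"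
proof (rule primI)
  interpret bounded_linear T by fact
  fix x :: real assume x: "0 \<le> x"
  have i: "set_integrable lborel {0..x} g" by (rule prim_integrable[OF assms(2)]) simp
  have e: "(\<lambda>s. indicat_real {0..x} s *\<^sub>R T (g s)) = (\<lambda>s. T (indicat_real {0..x} s *\<^sub>R g s))"
    by (auto simp: scale)
  show "set_integrable lborel {0..x} (\<lambda>x. T (g x))"
    using integrable_bounded_linear[OF assms(1) i[unfolded set_integrable_def]]
    unfolding set_integrable_def e .
  have "T (LBINT s:{0..x}. g s) = (LBINT s:{0..x}. T (g s))"
    using integral_bounded_linear[OF assms(1) i[unfolded set_integrable_def]]
    unfolding set_lebesgue_integral_def e by simp
  then show "T (f x) = T (f 0) + (LBINT s:{0..x}. T (g s))"
    using prim_eq[OF assms(2) x] add[of "f 0" "LBINT s:{0..x}. g s"] by simp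
qed

lemma prim_Re: "prim f g \<Longrightarrow> prim (\<lambda>x. Re (f x)) (\<lambda>x. Re (g x))"
  and prim_Im: "prim f g \<Longrightarrow> prim (\<lambda>x. Im (f x)) (\<lambda>x. Im (g x))"
  and prim_of_real: "prim h k \<Longrightarrow> prim (\<lambda>x. complex_of_real (h x)) (\<lambda>x. complex_of_real (k x))"
  and prim_scaleR_const: "prim p q \<Longrightarrow> prim (\<lambda>x. c *\<^sub>R p x) (\<lambda>x. c *\<^sub>R q x)"
  by (auto intro: prim_bounded_linear bounded_linear_Re bounded_linear_Im bounded_linear_of_real
      bounded_linear_scaleR_right)

lemma prim_C1:
  assumes "\<And>x. 0 \<le> x \<Longrightarrow> (f has_vector_derivative g x) (at x within {0..})" "continuous_on {0..} g"
  shows "prim f g"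
proof (rule primI)
  fix x :: real assume x: "0 \<le> x"
  have c: "continuous_on {0..x} g" using assms(2) by (rule continuous_on_subset) auto
  show "set_integrable lborel {0..x} g" by (rule borel_integrable_atLeastAtMost'[OF c])
  have "(LBINT s:{0..x}. g s) = f x - f 0"
    unfolding set_lebesgue_integral_def
    by (rule integral_FTC_atLeastAtMost[OF x _ c])
      (auto intro: has_vector_derivative_within_subset[OF assms(1)])
  then show "f x = f 0 + (LBINT s:{0..x}. g s)" by simp
qed

lemma prim_limit_at_top:
  assumes "prim f g" "set_integrable lborel {0<..} g"
  shows "(f \<longlongrightarrow> f 0 + (LBINT x:{0<..}. g x)) at_top"
proof -
  have "((\<lambda>b. LBINT x:{0..b}. g x) \<longlongrightarrow> (LBINT x:{0..}. g x)) at_top"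
    using assms(2) by (intro tendsto_set_lebesgue_integral_at_top) (auto simp: set_integrable_Ioi_Ici)
  then have "((\<lambda>b. f 0 + (LBINT x:{0..b}. g x)) \<longlongrightarrow> f 0 + (LBINT x:{0<..}. g x)) at_top"
    by (auto simp: set_integral_Ioi_Ici intro: tendsto_intros)
  moreover have "eventually (\<lambda>b. f 0 + (LBINT x:{0..b}. g x) = f b) at_top"
    using eventually_ge_at_top[of 0] by eventually_elim (simp add: prim_eq[OF assms(1), symmetric])
  ultimately show ?thesis by (simp add: tendsto_cong)
qed

section \<open>Products and the Leibniz rule\<close>

lemma
  fixes f h :: "real \<Rightarrow> real" and g k :: "real \<Rightarrow> 'a::euclidean_space"
  assumes f: "continuous_on {a..b} f" and g: "set_integrable lborel {a..b} g"
    and k: "continuous_on {a..b} k" and h: "set_integrable lborel {a..b} h"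
  shows set_integrable_continuous_scaleR: "set_integrable lborel {a..b} (\<lambda>x. f x *\<^sub>R g x)"
    and set_integrable_scaleR_continuous: "set_integrable lborel {a..b} (\<lambda>x. h x *\<^sub>R k x)"
proof -
  have gen: "set_integrable lborel {a..b} (\<lambda>x. p x *\<^sub>R q x)"
    if pq: "set_borel_measurable lborel {a..b} p" "set_borel_measurable lborel {a..b} q"
      and "set_integrable lborel {a..b} r" "\<And>x. x \<in> {a..b} \<Longrightarrow> norm (p x *\<^sub>R q x) \<le> norm (r x)"
    for p :: "real \<Rightarrow> real" and q :: "real \<Rightarrow> 'a" and r :: "real \<Rightarrow> real"
  proof (rule set_integrable_bound[OF that(3)])
    have "(\<lambda>x. (indicat_real {a..b} x *\<^sub>R p x) *\<^sub>R (indicat_real {a..b} x *\<^sub>R q x)) \<in> borel_measurable lborel"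
      using pq unfolding set_borel_measurable_def by measurable
    moreover have "(\<lambda>x. (indicat_real {a..b} x *\<^sub>R p x) *\<^sub>R (indicat_real {a..b} x *\<^sub>R q x))
        = (\<lambda>x. indicat_real {a..b} x *\<^sub>R (p x *\<^sub>R q x))" by (auto split: split_indicator)
    ultimately show "set_borel_measurable lborel {a..b} (\<lambda>x. p x *\<^sub>R q x)"
      by (simp add: set_borel_measurable_def)
    show "AE x in lborel. x \<in> {a..b} \<longrightarrow> norm (p x *\<^sub>R q x) \<le> norm (r x)" using that(4) by auto
  qed
  have cm: "set_borel_measurable lborel {a..b} p" if "continuous_on {a..b} p" for p :: "real \<Rightarrow> 'c::euclidean_space"
    using borel_integrable_atLeastAtMost'[OF that] by (auto simp: set_borel_measurable_def set_integrable_def)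
  have im: "set_borel_measurable lborel {a..b} p" if "set_integrable lborel {a..b} p" for p :: "real \<Rightarrow> 'c::euclidean_space"
    using that by (auto simp: set_borel_measurable_def set_integrable_def)
  have bd: "\<exists>C\<ge>0. \<forall>x\<in>{a..b}. norm (p x) \<le> C" if "continuous_on {a..b} p" for p :: "real \<Rightarrow> 'c::euclidean_space"
    using compact_imp_bounded[OF compact_continuous_image[OF that compact_Icc]]
    unfolding bounded_pos by (auto intro: less_imp_le)
  have sn: "set_integrable lborel {a..b} (\<lambda>x. C * norm (p x))" if "set_integrable lborel {a..b} p"
    for p :: "real \<Rightarrow> 'c::euclidean_space" and C :: real
    by (rule set_integrable_mult_right) (rule set_integrable_norm[OF that])
  obtain C where "C \<ge> 0" "\<forall>x\<in>{a..b}. norm (f x) \<le> C" using bd[OF f] by auto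
  then show "set_integrable lborel {a..b} (\<lambda>x. f x *\<^sub>R g x)"
    by (intro gen[OF cm[OF f] im[OF g] sn[OF g, of C]]) (auto intro!: mult_mono)
  obtain C where "C \<ge> 0" "\<forall>x\<in>{a..b}. norm (k x) \<le> C" using bd[OF k] by auto
  then show "set_integrable lborel {a..b} (\<lambda>x. h x *\<^sub>R k x)"
    by (intro gen[OF im[OF h] cm[OF k] sn[OF h, of C]]) (simp add: abs_mult mult.commute[of C] mult_left_mono)
qed

lemma set_integral_scaleR_const:
  fixes f :: "real \<Rightarrow> real" and c :: "'a::euclidean_space"
  assumes "set_integrable lborel A f" shows "(LBINT x:A. f x *\<^sub>R c) = (LBINT x:A. f x) *\<^sub>R c"
  using integral_scaleR_left[of c lborel "\<lambda>x. indicator A x *\<^sub>R f x"] assms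
  by (simp add: set_integrable_def set_lebesgue_integral_def)

text \<open>Neither factor need be differentiable at a given point, so the product rule is obtained
  from Fubini's theorem for f'(x) g'(y) on the triangle 0 <= y <= x <= R.\<close>

lemma prim_scaleR:
  fixes f f' :: "real \<Rightarrow> real" and g g' :: "real \<Rightarrow> 'a::euclidean_space"
  assumes f: "prim f f'" and g: "prim g g'"
  shows "prim (\<lambda>x. f x *\<^sub>R g x) (\<lambda>x. f' x *\<^sub>R g x + f x *\<^sub>R g' x)"
proof (rule primI)
  fix R :: real assume R: "0 \<le> R"
  have if': "set_integrable lborel {0..R} f'" and ig': "set_integrable lborel {0..R} g'"
    using prim_integrable[OF f, of 0 R] prim_integrable[OF g, of 0 R] by auto
  have cf: "continuous_on {0..R} f" and cg: "continuous_on {0..R} g"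
    using prim_continuous[OF f] prim_continuous[OF g] by (auto intro: continuous_on_subset)
  have i1: "set_integrable lborel {0..R} (\<lambda>x. f' x *\<^sub>R g x)"
    and i2: "set_integrable lborel {0..R} (\<lambda>x. f x *\<^sub>R g' x)"
    using set_integrable_continuous_scaleR[OF cf ig' cg if'] set_integrable_scaleR_continuous[OF cf ig' cg if'] by auto
  then show "set_integrable lborel {0..R} (\<lambda>x. f' x *\<^sub>R g x + f x *\<^sub>R g' x)" by auto
  define p where "p = (\<lambda>x. indicat_real {0..R} x *\<^sub>R f' x)"
  define q where "q = (\<lambda>x. indicat_real {0..R} x *\<^sub>R g' x)"
  have p: "integrable lborel p" and q: "integrable lborel q"
    using if' ig' by (auto simp: set_integrable_def p_def q_def)
  have [measurable]: "p \<in> borel_measurable borel" "q \<in> borel_measurable borel" using p q by auto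
  \<comment> \<open>Integrating over y first gives f'(x) (g(x) - g(0)), over x first (f(R) - f(y))
    g'(y); equating the two is integration by parts.\<close>
  define F where "F = (\<lambda>x y. indicat_real {..x} y *\<^sub>R (p x *\<^sub>R q y))"
  have int: "integrable (lborel \<Otimes>\<^sub>M lborel) (case_prod F)"
  proof (rule lborel_pair.Fubini_integrable)
    have e: "indicat_real {..x} y = (if y \<le> x then 1 else 0)" for x y :: real by auto
    show m: "case_prod F \<in> borel_measurable (lborel \<Otimes>\<^sub>M lborel)"
      unfolding F_def e by measurable
    have iq: "integrable lborel (\<lambda>y. indicat_real {..x} y *\<^sub>R q y)" for x
      by (rule integrable_mult_indicator) (use q in auto)
    have FF: "F x y = p x *\<^sub>R (indicat_real {..x} y *\<^sub>R q y)" for x y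
      by (simp add: F_def)
    show "AE x in lborel. integrable lborel (\<lambda>y. case_prod F (x, y))"
      using iq by (auto simp: FF simp del: scaleR_scaleR)
    show "integrable lborel (\<lambda>x. \<integral>y. norm (case_prod F (x, y)) \<partial>lborel)"
    proof (rule Bochner_Integration.integrable_bound)
      show "integrable lborel (\<lambda>x. (\<integral>y. norm (q y) \<partial>lborel) * norm (p x))" using p by auto
      show "(\<lambda>x. \<integral>y. norm (case_prod F (x, y)) \<partial>lborel) \<in> borel_measurable lborel"
        using m by measurable
      show "AE x in lborel. norm (\<integral>y. norm (case_prod F (x, y)) \<partial>lborel) \<le> norm ((\<integral>y. norm (q y) \<partial>lborel) * norm (p x))"
      proof (intro AE_I2)
        fix x
        have "(\<integral>y. norm (F x y) \<partial>lborel) = \<bar>p x\<bar> * (\<integral>y. norm (indicat_real {..x} y *\<^sub>R q y) \<partial>lborel)"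
          by (simp add: FF del: scaleR_scaleR)
        also have "\<dots> \<le> \<bar>p x\<bar> * (\<integral>y. norm (q y) \<partial>lborel)"
          using q integrable_norm[OF iq] by (intro mult_left_mono integral_mono) (auto split: split_indicator simp del: norm_scaleR)
        finally show "norm (\<integral>y. norm (case_prod F (x, y)) \<partial>lborel) \<le> norm ((\<integral>y. norm (q y) \<partial>lborel) * norm (p x))"
          by (simp add: integral_nonneg_AE mult.commute abs_mult)
      qed
    qed
  qed
  have y: "(\<integral>y. F x y \<partial>lborel) = indicat_real {0..R} x *\<^sub>R (f' x *\<^sub>R (g x - g 0))" for x
  proof (cases "x \<in> {0..R}")
    case True
    have "(\<integral>y. F x y \<partial>lborel) = (\<integral>y. f' x *\<^sub>R (indicat_real {0..x} y *\<^sub>R g' y) \<partial>lborel)"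
      using True by (intro Bochner_Integration.integral_cong) (auto simp: F_def p_def q_def split: split_indicator)
    also have "\<dots> = f' x *\<^sub>R (LBINT y:{0..x}. g' y)" by (simp add: set_lebesgue_integral_def del: scaleR_scaleR)
    finally show ?thesis using True prim_diff[OF g, of 0 x] by auto
  qed (auto simp: F_def p_def)
  have x: "(\<integral>x. F x y \<partial>lborel) = indicat_real {0..R} y *\<^sub>R ((f R - f y) *\<^sub>R g' y)" for y
  proof (cases "y \<in> {0..R}")
    case True
    have "(\<integral>x. F x y \<partial>lborel) = (\<integral>x. (indicat_real {y..R} x *\<^sub>R f' x) *\<^sub>R g' y \<partial>lborel)"
      using True by (intro Bochner_Integration.integral_cong) (auto simp: F_def p_def q_def split: split_indicator)
    also have "\<dots> = (LBINT x:{y..R}. f' x) *\<^sub>R g' y"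
      unfolding set_lebesgue_integral_def using prim_integrable[OF f, of y R] True
      by (intro integral_scaleR_left) (auto simp: set_integrable_def)
    finally show ?thesis using True prim_diff[OF f, of y R] by auto
  qed (auto simp: F_def q_def)
  have "(LBINT y:{0..R}. (f R - f y) *\<^sub>R g' y) = (LBINT x:{0..R}. f' x *\<^sub>R (g x - g 0))"
    using lborel_pair.Fubini_integral[OF int] by (simp add: x y set_lebesgue_integral_def)
  moreover have "(LBINT y:{0..R}. (f R - f y) *\<^sub>R g' y) = f R *\<^sub>R (LBINT y:{0..R}. g' y) - (LBINT y:{0..R}. f y *\<^sub>R g' y)"
    using i2 ig' by (simp add: scaleR_left_diff_distrib set_integral_diff)
  moreover have "(LBINT x:{0..R}. f' x *\<^sub>R (g x - g 0)) = (LBINT x:{0..R}. f' x *\<^sub>R g x) - (LBINT x:{0..R}. f' x) *\<^sub>R g 0"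
    using i1 if' by (simp add: scaleR_right_diff_distrib set_integral_diff(2) set_integral_scaleR_const)
  ultimately have "f R *\<^sub>R (LBINT y:{0..R}. g' y) - (LBINT y:{0..R}. f y *\<^sub>R g' y)
      = (LBINT x:{0..R}. f' x *\<^sub>R g x) - (LBINT x:{0..R}. f' x) *\<^sub>R g 0"
    by simp
  then have "(LBINT x:{0..R}. f' x *\<^sub>R g x) + (LBINT y:{0..R}. f y *\<^sub>R g' y) =
      f R *\<^sub>R (LBINT y:{0..R}. g' y) + (LBINT x:{0..R}. f' x) *\<^sub>R g 0"
    by (simp only: diff_eq_eq) (simp add: algebra_simps)
  then have "(LBINT x:{0..R}. f' x *\<^sub>R g x) + (LBINT y:{0..R}. f y *\<^sub>R g' y) =
      f R *\<^sub>R (g R - g 0) + (f R - f 0) *\<^sub>R g 0"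
    using prim_diff[OF f, of 0 R] prim_diff[OF g, of 0 R] R by simp
  then have "(LBINT x:{0..R}. f' x *\<^sub>R g x + f x *\<^sub>R g' x) = f R *\<^sub>R (g R - g 0) + (f R - f 0) *\<^sub>R g 0"
    using i1 i2 by (simp add: set_integral_add)
  then show "f R *\<^sub>R g R = f 0 *\<^sub>R g 0 + (LBINT x:{0..R}. f' x *\<^sub>R g x + f x *\<^sub>R g' x)"
    by (simp add: algebra_simps)
qed

text \<open>The positive and the negative part of d are densities of two finite measures that agree
  on all rays (x, oo), hence everywhere; uniqueness of densities makes the two parts equal almost
  everywhere.\<close>

lemma AE_zero_if_tail_integrals_zero:
  fixes d :: "real \<Rightarrow> real"
  assumes "integrable lborel d" "\<And>x. (LBINT t:{x<..}. d t) = 0"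
  shows "AE x in lborel. d x = 0"
proof -
  define p where "p = (\<lambda>x. max 0 (d x))"
  define n where "n = (\<lambda>x. max 0 (- d x))"
  have p: "integrable lborel p" and n: "integrable lborel n" using assms(1) by (auto simp: p_def n_def)
  have [measurable]: "p \<in> borel_measurable borel" "n \<in> borel_measurable borel" using p n by auto
  have e: "emeasure (density lborel (\<lambda>x. ennreal (h x))) {x<..} = ennreal (LBINT t:{x<..}. h t)"
    if "integrable lborel h" "\<And>x. 0 \<le> h x" for h :: "real \<Rightarrow> real" and x
  proof -
    have [measurable]: "h \<in> borel_measurable borel" using that by auto
    have "emeasure (density lborel (\<lambda>x. ennreal (h x))) {x<..} = (\<integral>\<^sup>+ t. ennreal (h t) * indicator {x<..} t \<partial>lborel)"
      by (rule emeasure_density) auto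
    also have "\<dots> = (\<integral>\<^sup>+ t. ennreal (indicat_real {x<..} t *\<^sub>R h t) \<partial>lborel)"
      by (intro nn_integral_cong) (auto split: split_indicator)
    also have "\<dots> = ennreal (LBINT t:{x<..}. h t)"
      unfolding set_lebesgue_integral_def using that
      by (intro nn_integral_eq_integral integrable_mult_indicator) auto
    finally show ?thesis .
  qed
  have ep: "emeasure (density lborel (\<lambda>x. ennreal (p x))) {x<..} = ennreal (LBINT t:{x<..}. p t)" for x
    by (rule e[OF p]) (simp add: p_def)
  have en: "emeasure (density lborel (\<lambda>x. ennreal (n x))) {x<..} = ennreal (LBINT t:{x<..}. n t)" for x
    by (rule e[OF n]) (simp add: n_def)
  have "density lborel (\<lambda>x. ennreal (p x)) = density lborel (\<lambda>x. ennreal (n x))"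
  proof (rule measure_eqI_lessThan)
    fix x
    have "d = (\<lambda>t. p t - n t)" by (auto simp: p_def n_def)
    then have "(LBINT t:{x<..}. p t) - (LBINT t:{x<..}. n t) = 0"
      using assms(2)[of x] p n
      by (subst set_integral_diff(2)[symmetric]) (auto simp: set_integrable_def simp del: real_scaleR_def intro!: integrable_mult_indicator)
    then show "emeasure (density lborel (\<lambda>x. ennreal (p x))) {x<..} = emeasure (density lborel (\<lambda>x. ennreal (n x))) {x<..}"
      by (simp add: ep en)
  qed (auto simp: ep)
  then have "AE x in lborel. ennreal (p x) = ennreal (n x)"
    by (intro sigma_finite_measure.density_unique) (auto simp: sigma_finite_lborel)
  then show ?thesis by eventually_elim (auto simp: p_def n_def max_def split: if_splits)
qed

lemma prim_unique_real:
  fixes f g h :: "real \<Rightarrow> real"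
  assumes "prim f g" "prim f h"
  shows "AE x in lborel. x > 0 \<longrightarrow> g x = h x"
proof -
  have "AE x in lborel. x \<in> {0<..real n} \<longrightarrow> g x = h x" for n
  proof -
    \<comment> \<open>The difference is only locally integrable; cutting it off to (0, n] makes it
      integrable, and the countably many exceptional sets are united at the end.\<close>
    define d where "d = (\<lambda>x. indicat_real {0..real n} x *\<^sub>R (g x - h x))"
    have ii: "set_integrable lborel {0..x} (\<lambda>x. g x - h x)" and
      i0: "(LBINT t:{0..x}. (g t - h t)) = 0" if "0 \<le> x" for x
      using prim_integrable[OF assms(1), of 0 x] prim_integrable[OF assms(2), of 0 x]
        prim_eq[OF assms(1) that] prim_eq[OF assms(2) that] by (auto simp: set_integral_diff)
    have i: "integrable lborel d" using ii[of "real n"] by (simp add: set_integrable_def d_def)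
    have "AE x in lborel. d x = 0"
    proof (rule AE_zero_if_tail_integrals_zero[OF i])
      fix x :: real
      let ?y = "max 0 x"
      show "(LBINT t:{x<..}. d t) = 0"
      proof (cases "?y \<le> real n")
        case True
        have "(LBINT t:{x<..}. d t) = (LBINT t:{?y<..real n}. (g t - h t))"
          unfolding set_lebesgue_integral_def d_def
          by (rule integral_discrete_difference[where X = "{0}"]) (auto split: split_indicator)
        also have "\<dots> = 0"
          using set_integral_Icc_split[of 0 ?y "real n" "\<lambda>t. g t - h t"] True ii i0 by (simp add: set_integral_Ioc_Icc)
        finally show ?thesis .
      next
        case False
        have "(LBINT t:{x<..}. d t) = (LBINT t:{x<..}. 0::real)"
          unfolding set_lebesgue_integral_def d_def using False
          by (intro Bochner_Integration.integral_cong) (auto split: split_indicator)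
        then show ?thesis by simp
      qed
    qed
    then show ?thesis by eventually_elim (auto simp: d_def)
  qed
  then have "AE x in lborel. \<forall>n. x \<in> {0<..real n} \<longrightarrow> g x = h x" by (subst AE_all_countable) blast
  then show ?thesis by eventually_elim (meson greaterThanAtMost_iff real_arch_simple)
qed

lemma prim_unique:
  fixes f g h :: "real \<Rightarrow> complex"
  assumes "prim f g" "prim f h"
  shows "AE x in lborel. x > 0 \<longrightarrow> g x = h x"
  using prim_unique_real[OF prim_Re[OF assms(1)] prim_Re[OF assms(2)]]
    prim_unique_real[OF prim_Im[OF assms(1)] prim_Im[OF assms(2)]]
  by eventually_elim (simp add: complex_eq_iff)

section \<open>Square integrable functions on the half-line\<close>

abbreviation HL :: "real measure" where "HL \<equiv> restrict_space lborel {0<..}"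

definition sqi :: "(real \<Rightarrow> 'a::euclidean_space) \<Rightarrow> bool" where
  "sqi f \<longleftrightarrow> f \<in> borel_measurable HL \<and> integrable HL (\<lambda>x. norm (f x) ^ 2)"

lemma HL_measurable_iff: "set_borel_measurable lborel {0<..} f \<longleftrightarrow> f \<in> borel_measurable HL"
  for f :: "real \<Rightarrow> 'a::euclidean_space"
  unfolding set_borel_measurable_def by (subst borel_measurable_restrict_space_iff) auto

lemma HL_integrable_iff: "set_integrable lborel {0<..} f \<longleftrightarrow> integrable HL f"
  for f :: "real \<Rightarrow> 'a::euclidean_space"
  by (subst set_integrable_eq) auto

lemma HL_integral: "(LBINT x:{0<..}. f x) = (\<integral>x. f x \<partial>HL)"
  for f :: "real \<Rightarrow> 'a::euclidean_space"
  by (simp add: set_lebesgue_integral_def integral_restrict_space)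

lemma HL_AE_iff: "(AE x in HL. P x) \<longleftrightarrow> (AE x in lborel. x > 0 \<longrightarrow> P x)"
  by (subst AE_restrict_space_iff) auto

lemma AE_HL_pos: "AE x in HL. x > 0" by (simp add: HL_AE_iff)

lemma L2_on_Rplus_iff: "L2_on Rplus f \<longleftrightarrow> sqi f"
  by (simp add: L2_on_def sqi_def HL_measurable_iff HL_integrable_iff)

lemma L2_sq_Rplus: "L2_sq Rplus f = (\<integral>x. norm (f x) ^ 2 \<partial>HL)"
  by (simp add: L2_sq_def HL_integral)

lemma sqi_measurable: "sqi f \<Longrightarrow> f \<in> borel_measurable HL"
  and sqi_integrable: "sqi f \<Longrightarrow> integrable HL (\<lambda>x. norm (f x) ^ 2)"
  by (auto simp: sqi_def)

text \<open>Only integrability is needed, so ab <= a^2 + b^2 replaces the Cauchy-Schwarz inequality.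
  The pointwise bound with a constant covers products with further bounded factors, for instance
  |f|^6 <= B^4 |f|^2.\<close>

lemma sqi_mult:
  fixes h :: "real \<Rightarrow> real"
  assumes f: "sqi f" and g: "sqi g" and "h \<in> borel_measurable HL"
    and "\<And>x. x > 0 \<Longrightarrow> \<bar>h x\<bar> \<le> C * (norm (f x) * norm (g x))"
  shows "integrable HL h"
proof (rule Bochner_Integration.integrable_bound)
  show "integrable HL (\<lambda>x. \<bar>C\<bar> * (norm (f x) ^ 2 + norm (g x) ^ 2))"
    using sqi_integrable[OF f] sqi_integrable[OF g] by auto
  show "AE x in HL. norm (h x) \<le> norm (\<bar>C\<bar> * (norm (f x) ^ 2 + norm (g x) ^ 2))"
    using AE_HL_pos
  proof eventually_elim
    case (elim x)
    have "norm (f x) * norm (g x) \<le> norm (f x) ^ 2 + norm (g x) ^ 2"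
      using sum_squares_bound[of "norm (f x)" "norm (g x)"]
        mult_nonneg_nonneg[OF norm_ge_zero[of "f x"] norm_ge_zero[of "g x"]] by linarith
    then have "C * (norm (f x) * norm (g x)) \<le> \<bar>C\<bar> * (norm (f x) ^ 2 + norm (g x) ^ 2)"
      by (intro mult_mono) auto
    then show ?case using assms(4)[OF elim] by (simp add: abs_mult)
  qed
qed fact

lemma sqi_add:
  assumes f: "sqi f" and g: "sqi g" shows "sqi (\<lambda>x. f x + g x)"
proof -
  have [measurable]: "f \<in> borel_measurable HL" "g \<in> borel_measurable HL" using f g by (auto simp: sqi_def)
  have "integrable HL (\<lambda>x. norm (f x + g x) ^ 2)"
  proof (rule Bochner_Integration.integrable_bound)
    show "integrable HL (\<lambda>x. 2 * norm (f x) ^ 2 + 2 * norm (g x) ^ 2)"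
      using sqi_integrable[OF f] sqi_integrable[OF g] by auto
    show "AE x in HL. norm (norm (f x + g x) ^ 2) \<le> norm (2 * norm (f x) ^ 2 + 2 * norm (g x) ^ 2)"
    proof (rule AE_I2)
      fix x
      have "norm (f x + g x) ^ 2 \<le> (norm (f x) + norm (g x)) ^ 2"
        by (intro power_mono norm_triangle_ineq) auto
      also have "\<dots> \<le> 2 * norm (f x) ^ 2 + 2 * norm (g x) ^ 2"
        using sum_squares_bound[of "norm (f x)" "norm (g x)"] by (simp add: power2_sum)
      finally show "norm (norm (f x + g x) ^ 2) \<le> norm (2 * norm (f x) ^ 2 + 2 * norm (g x) ^ 2)" by simp
    qed
  qed measurable
  then show ?thesis by (simp add: sqi_def)
qed

lemma sqi_scaleR: "sqi f \<Longrightarrow> sqi (\<lambda>x. c *\<^sub>R f x)"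
  by (auto simp: sqi_def power_mult_distrib)

lemma sqi_of_real: "sqi (\<lambda>x. complex_of_real (f x)) \<longleftrightarrow> sqi f"
proof -
  have "(\<lambda>x. complex_of_real (f x)) \<in> borel_measurable HL \<longleftrightarrow> f \<in> borel_measurable HL"
    by (auto simp: borel_measurable_complex_iff)
  then show ?thesis by (auto simp: sqi_def)
qed

lemma sqi_Re: assumes "sqi f" shows "sqi (\<lambda>x. Re (f x))"
proof -
  have [measurable]: "f \<in> borel_measurable HL" using assms by (auto simp: sqi_def)
  have "integrable HL (\<lambda>x. norm (Re (f x)) ^ 2)"
    by (rule Bochner_Integration.integrable_bound[OF sqi_integrable[OF assms]])
      (use abs_Re_le_cmod in \<open>auto simp: abs_le_square_iff[symmetric] intro!: AE_I2\<close>)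
  then show ?thesis using assms by (auto simp: sqi_def)
qed

text \<open>Since |g| <= 1 + |g|^2, boundedness of the interval yields integrability of g
  itself.\<close>

lemma sqi_locally_integrable:
  assumes "sqi g" shows "set_integrable lborel {0..x} g"
proof -
  have m: "set_borel_measurable lborel {0<..x} g"
    by (rule set_borel_measurable_subset[of _ "{0<..}"])
      (use assms in \<open>auto simp: sqi_def HL_measurable_iff\<close>)
  have "set_integrable lborel {0<..} (\<lambda>x. norm (g x) ^ 2)"
    using assms by (simp add: sqi_def HL_integrable_iff)
  then have "set_integrable lborel {0<..x} (\<lambda>x. norm (g x) ^ 2)"
    by (rule set_integrable_subset) auto
  then have "set_integrable lborel {0<..x} (\<lambda>x. 1 + norm (g x) ^ 2)"
    using borel_integrable_atLeastAtMost'[OF continuous_on_const, of 0 x "1::real"]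
    by (intro set_integral_add) (auto simp: set_integrable_Ioc_Icc)
  moreover have le_one_plus_sq: "norm z \<le> 1 + (norm z)\<^sup>2" for z :: 'a
    using zero_le_power2[of "norm z - 1"] norm_ge_zero[of z] unfolding power2_diff one_power2 mult_1_right by linarith
  ultimately have "set_integrable lborel {0<..x} g"
    by (intro set_integrable_bound[OF _ m])
      (use le_one_plus_sq in \<open>auto intro!: AE_I2\<close>)
  then show ?thesis by (simp add: set_integrable_Ioc_Icc)
qed

lemma continuous_HL_measurable:
  assumes "continuous_on {0<..} f" shows "f \<in> borel_measurable HL"
  using borel_measurable_continuous_on_restrict[OF assms]
  by (simp add: borel_measurable_restrict_space_iff)

lemma prim_HL_measurable: "prim f g \<Longrightarrow> f \<in> borel_measurable HL"
  by (rule continuous_HL_measurable) (auto intro: continuous_on_subset[OF prim_continuous])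

text \<open>g is the pointwise limit of its restrictions to (0, n], each of which is integrable and
  so measurable.\<close>

lemma prim_measurable:
  assumes "prim f g" shows "g \<in> borel_measurable HL"
proof -
  have "(\<lambda>x. indicat_real {0<..} x *\<^sub>R g x) \<in> borel_measurable lborel"
  proof (rule borel_measurable_LIMSEQ_metric)
    show "(\<lambda>x. indicat_real {0<..real n} x *\<^sub>R g x) \<in> borel_measurable lborel" for n
      using set_integrable_Ioc_Icc[of 0 "real n" g, THEN iffD2, OF prim_integrable[OF assms order_refl]]
      unfolding set_integrable_def by auto
    show "(\<lambda>n. indicat_real {0<..real n} x *\<^sub>R g x) \<longlonglongrightarrow> indicat_real {0<..} x *\<^sub>R g x" for x
    proof (rule tendsto_eventually)
      obtain N where "x \<le> real N" using real_arch_simple by blast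
      then show "\<forall>\<^sub>F n in sequentially. indicat_real {0<..real n} x *\<^sub>R g x = indicat_real {0<..} x *\<^sub>R g x"
        by (intro eventually_sequentiallyI[of N]) (auto split: split_indicator)
    qed
  qed
  then show ?thesis by (simp add: HL_measurable_iff[symmetric] set_borel_measurable_def)
qed

lemma HL_Icc_le:
  fixes h :: "real \<Rightarrow> real"
  assumes "integrable HL h" "\<And>x. x > 0 \<Longrightarrow> 0 \<le> h x" "0 \<le> a"
  shows "(LBINT x:{a..b}. h x) \<le> (\<integral>x. h x \<partial>HL)"
proof -
  have i: "set_integrable lborel {0<..} h" using assms by (simp add: HL_integrable_iff)
  have "(LBINT x:{a..b}. h x) = (LBINT x:{a<..b}. h x)" by (simp add: set_integral_Ioc_Icc)
  also have "\<dots> \<le> (LBINT x:{0<..}. h x)"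
    unfolding set_lebesgue_integral_def
  proof (rule integral_mono)
    show "integrable lborel (\<lambda>x. indicat_real {a<..b} x *\<^sub>R h x)"
      using set_integrable_subset[OF i, of "{a<..b}"] assms(3) unfolding set_integrable_def by fastforce
    show "integrable lborel (\<lambda>x. indicat_real {0<..} x *\<^sub>R h x)" using i by (simp add: set_integrable_def)
    show "indicat_real {a<..b} x *\<^sub>R h x \<le> indicat_real {0<..} x *\<^sub>R h x" for x
      using assms(2)[of x] assms(3) by (auto split: split_indicator)
  qed
  finally show ?thesis by (simp add: HL_integral)
qed

text \<open>A positive limit L would keep h above L/2 from some point a on, and the integral over
  [a, a + T] would grow without bound.\<close>

lemma integrable_limit_zero:
  fixes h :: "real \<Rightarrow> real"
  assumes i: "integrable HL h" and nn: "\<And>x. x > 0 \<Longrightarrow> 0 \<le> h x" and lim: "(h \<longlongrightarrow> L) at_top"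
  shows "L = 0"
proof (rule ccontr)
  assume "L \<noteq> 0"
  moreover have "L \<ge> 0"
    by (rule tendsto_lowerbound[OF lim]) (auto intro: eventually_mono[OF eventually_gt_at_top[of 0]] nn)
  ultimately have L: "L > 0" by simp
  then have "eventually (\<lambda>x. h x > L / 2) at_top" using lim by (intro order_tendstoD) auto
  then obtain N where N: "\<And>x. x \<ge> N \<Longrightarrow> h x > L / 2" by (auto simp: eventually_at_top_linorder)
  define a where "a = max 1 N"
  have "L / 2 * T \<le> (\<integral>x. h x \<partial>HL)" if "T \<ge> 0" for T
  proof -
    have "L / 2 * T = (LBINT x:{a..a+T}. L / 2)" using that by (simp add: set_lebesgue_integral_def)
    also have "\<dots> \<le> (LBINT x:{a..a+T}. h x)"
    proof (rule set_integral_mono)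
      show "set_integrable lborel {a..a+T} h"
        by (rule set_integrable_subset[of _ "{0<..}"]) (use i in \<open>auto simp: HL_integrable_iff a_def\<close>)
      show "set_integrable lborel {a..a+T} (\<lambda>x. L / 2)"
        by (rule borel_integrable_atLeastAtMost'[OF continuous_on_const])
    qed (use N in \<open>auto simp: a_def intro: less_imp_le\<close>)
    also have "\<dots> \<le> (\<integral>x. h x \<partial>HL)" by (rule HL_Icc_le[OF i nn]) (auto simp: a_def)
    finally show ?thesis .
  qed
  \<comment> \<open>This length T makes L/2 * T exceed the integral by at least 1.\<close>
  from this[of "2 / L * (\<bar>\<integral>x. h x \<partial>HL\<bar> + 1)"] L show False by simp
qed

section \<open>Weak derivatives on the half-line\<close>

text \<open>A quadratic spline rising from 0 to 1. It is continuously differentiable, so that differences of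
  two rescaled copies are admissible test functions that approximate the indicator of an interval.\<close>

definition ramp :: "real \<Rightarrow> real" where
  "ramp s = 2 * ((max 0 s)\<^sup>2 - 2 * (max 0 (s - 1/2))\<^sup>2 + (max 0 (s - 1))\<^sup>2)"

definition dramp :: "real \<Rightarrow> real" where
  "dramp s = 4 * (max 0 s - 2 * max 0 (s - 1/2) + max 0 (s - 1))"

lemma DERIV_max_sq: "((\<lambda>s. (max 0 s)\<^sup>2) has_real_derivative 2 * max 0 s) (at s)"
proof -
  consider "s > 0" | "s < 0" | "s = 0" by linarith
  then show ?thesis
  proof cases
    case 1
    have "((\<lambda>s. s\<^sup>2) has_real_derivative 2 * max 0 s) (at s)" using 1 by (auto intro!: derivative_eq_intros)
    then show ?thesis
      by (rule has_field_derivative_transform_within_open[of _ _ _ "{0<..}"]) (use 1 in auto)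
  next
    case 2
    have "((\<lambda>s. 0) has_real_derivative 2 * max 0 s) (at s)" using 2 by (auto intro!: derivative_eq_intros)
    then show ?thesis
      by (rule has_field_derivative_transform_within_open[of _ _ _ "{..<0}"]) (use 2 in auto)
  next
    case 3
    have "((\<lambda>h. (max 0 h)\<^sup>2 / h) \<longlongrightarrow> 0) (at (0::real))"
    proof (rule tendsto_rabs_zero_cancel, rule tendsto_sandwich[of "\<lambda>_. 0" _ _ "\<lambda>h. \<bar>h\<bar>"])
      show "((\<lambda>h::real. \<bar>h\<bar>) \<longlongrightarrow> 0) (at 0)" by (auto intro!: tendsto_eq_intros)
      have "\<bar>(max 0 h)\<^sup>2 / h\<bar> \<le> \<bar>h\<bar>" for h :: real
        by (auto simp: max_def power2_eq_square)
      then show "\<forall>\<^sub>F h in at 0. \<bar>(max 0 h)\<^sup>2 / h\<bar> \<le> \<bar>h::real\<bar>" by auto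
    qed auto
    then show ?thesis using 3 by (simp add: has_field_derivative_iff)
  qed
qed

lemma DERIV_ramp: "(ramp has_real_derivative dramp s) (at s)"
proof -
  have d: "((\<lambda>s. (max 0 (s - c))\<^sup>2) has_real_derivative 2 * max 0 (s - c)) (at s)" for c
  proof -
    have "((\<lambda>s. s - c) has_real_derivative 1) (at s)" by (auto intro!: derivative_eq_intros)
    from DERIV_chain2[where f = "\<lambda>s. (max 0 s)\<^sup>2", OF DERIV_max_sq this] show ?thesis by simp
  qed
  have "((\<lambda>s. 2 * ((max 0 s)\<^sup>2 - 2 * (max 0 (s - 1/2))\<^sup>2 + (max 0 (s - 1))\<^sup>2)) has_real_derivative
      2 * (2 * max 0 s - 2 * (2 * max 0 (s - 1/2)) + 2 * max 0 (s - 1))) (at s)"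
    by (intro DERIV_cmult DERIV_add DERIV_diff d DERIV_max_sq)
  then show ?thesis by (simp add: ramp_def[abs_def] dramp_def algebra_simps)
qed

lemma continuous_dramp: "continuous_on A dramp"
  unfolding dramp_def by (intro continuous_intros)

lemma ramp_0: "s \<le> 0 \<Longrightarrow> ramp s = 0" and ramp_1: "s \<ge> 1 \<Longrightarrow> ramp s = 1"
  and dramp_0: "s \<notin> {0..1} \<Longrightarrow> dramp s = 0" and dramp_le: "\<bar>dramp s\<bar> \<le> 4"
  by (auto simp: ramp_def dramp_def max_def power2_eq_square algebra_simps)

lemma ramp_bounds: "0 \<le> ramp s" "ramp s \<le> 1"
proof -
  consider "s \<le> 0" | "0 < s" "s \<le> 1/2" | "1/2 < s" "s \<le> 1" | "1 < s" by linarith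
  then have "0 \<le> ramp s \<and> ramp s \<le> 1"
  proof cases
    case 2
    then have "ramp s = 2 * s\<^sup>2" by (simp add: ramp_def max_def)
    moreover have "s\<^sup>2 \<le> (1/2)\<^sup>2" using 2 by (intro power_mono) auto
    ultimately show ?thesis by (simp add: power2_eq_square)
  next
    case 3
    then have "ramp s = 1 - 2 * (1 - s)\<^sup>2" by (simp add: ramp_def max_def power2_eq_square algebra_simps)
    moreover have "(1 - s)\<^sup>2 \<le> (1/2)\<^sup>2" using 3 by (intro power_mono) auto
    ultimately show ?thesis by (simp add: power2_eq_square)
  qed (auto simp: ramp_0 ramp_1)
  then show "0 \<le> ramp s" "ramp s \<le> 1" by auto
qed

text \<open>With N = n + 1 the kernels N dramp(N(x - a)) form an approximate identity at a: their
  integral is the total rise 1 of \<open>ramp\<close>. They are supported on [a, a + 1/N], to the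
  right of a, and thus stay inside the half-line.\<close>

lemma approximate_evaluation:
  fixes u :: "real \<Rightarrow> complex"
  assumes cont: "continuous_on {0<..} u" and a: "a > 0"
  shows "(\<lambda>n. LBINT x:Rplus. (real (Suc n) * dramp (real (Suc n) * (x - a))) *\<^sub>R u x) \<longlonglongrightarrow> u a"
proof -
  have m: "(\<lambda>x. indicat_real {0<..} x *\<^sub>R u x) \<in> borel_measurable borel"
    using continuous_HL_measurable[OF cont] by (simp add: HL_measurable_iff[symmetric] set_borel_measurable_def)
  have "bounded (u ` {a..a+1})"
    using a by (intro compact_imp_bounded compact_continuous_image continuous_on_subset[OF cont]) auto
  then obtain C where C: "\<And>x. x \<in> {a..a+1} \<Longrightarrow> norm (u x) \<le> C" "C > 0" unfolding bounded_pos by blast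
  define F where "F = (\<lambda>n t. dramp t *\<^sub>R (indicat_real {0<..} (a + t / real (Suc n)) *\<^sub>R u (a + t / real (Suc n))))"
  have eq: "(LBINT x:Rplus. (real (Suc n) * dramp (real (Suc n) * (x - a))) *\<^sub>R u x) = (\<integral>t. F n t \<partial>lborel)" for n
  proof -
    have "(LBINT x:Rplus. (real (Suc n) * dramp (real (Suc n) * (x - a))) *\<^sub>R u x)
      = \<bar>1 / real (Suc n)\<bar> *\<^sub>R (\<integral>t. indicat_real {0<..} (a + 1 / real (Suc n) * t) *\<^sub>R
          ((real (Suc n) * dramp (real (Suc n) * (a + 1 / real (Suc n) * t - a))) *\<^sub>R u (a + 1 / real (Suc n) * t)) \<partial>lborel)"
      unfolding set_lebesgue_integral_def by (rule lborel_integral_real_affine) simp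
    also have "\<dots> = (\<integral>t. \<bar>1 / real (Suc n)\<bar> *\<^sub>R (indicat_real {0<..} (a + 1 / real (Suc n) * t) *\<^sub>R
          ((real (Suc n) * dramp (real (Suc n) * (a + 1 / real (Suc n) * t - a))) *\<^sub>R u (a + 1 / real (Suc n) * t))) \<partial>lborel)"
      by (rule integral_scaleR_right[symmetric])
    also have "\<dots> = (\<integral>t. F n t \<partial>lborel)"
    proof (rule Bochner_Integration.integral_cong[OF refl])
      fix t
      have "1 / real (Suc n) * t = t / real (Suc n)" "a + t / real (Suc n) - a = t / real (Suc n)"
        "real (Suc n) * (t / real (Suc n)) = t" by (simp_all del: of_nat_Suc)
      moreover have "\<bar>1 / real (Suc n)\<bar> *\<^sub>R (c *\<^sub>R ((real (Suc n) * d) *\<^sub>R z)) = d *\<^sub>R (c *\<^sub>R z)" for c d and z :: complex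
        by (simp add: mult_ac del: of_nat_Suc)
      ultimately show "\<bar>1 / real (Suc n)\<bar> *\<^sub>R (indicat_real {0<..} (a + 1 / real (Suc n) * t) *\<^sub>R
          ((real (Suc n) * dramp (real (Suc n) * (a + 1 / real (Suc n) * t - a))) *\<^sub>R u (a + 1 / real (Suc n) * t))) = F n t"
        unfolding F_def by (simp only:)
    qed
    finally show ?thesis .
  qed
  have "(\<lambda>n. \<integral>t. F n t \<partial>lborel) \<longlonglongrightarrow> (\<integral>t. dramp t *\<^sub>R u a \<partial>lborel)"
  proof (rule integral_dominated_convergence)
    have [measurable]: "dramp \<in> borel_measurable borel"
      by (rule borel_measurable_continuous_onI[OF continuous_dramp])
    show "(\<lambda>t. dramp t *\<^sub>R u a) \<in> borel_measurable lborel" by measurable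
    show "F n \<in> borel_measurable lborel" for n
    proof -
      have "(\<lambda>t. indicat_real {0<..} (a + t / real (Suc n)) *\<^sub>R u (a + t / real (Suc n))) \<in> borel_measurable borel"
        by (rule measurable_compose[OF _ m]) measurable
      then show ?thesis unfolding F_def by measurable
    qed
    \<comment> \<open>The bound 4 on \<open>dramp\<close> and the bound C of u on [a, a + 1]
      dominate all n at once, because t / (n + 1) <= 1 on the support.\<close>
    show "integrable lborel (\<lambda>t::real. indicat_real {0..1} t * (4 * C))"
      using borel_integrable_atLeastAtMost'[OF continuous_on_const, of 0 1 "4 * C"]
      unfolding set_integrable_def by (simp only: real_scaleR_def)
    show "AE t in lborel. (\<lambda>n. F n t) \<longlonglongrightarrow> dramp t *\<^sub>R u a"
    proof (rule AE_I2)
      fix t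
      show "(\<lambda>n. F n t) \<longlonglongrightarrow> dramp t *\<^sub>R u a"
      proof (cases "t \<in> {0..1}")
        case True
        have "(\<lambda>n. a + t / real (Suc n)) \<longlonglongrightarrow> a + 0"
          by (intro tendsto_intros LIMSEQ_Suc[OF lim_const_over_n])
        moreover have "isCont u a" using cont a by (simp add: continuous_on_eq_continuous_at)
        ultimately have "(\<lambda>n. u (a + t / real (Suc n))) \<longlonglongrightarrow> u a"
          using isCont_tendsto_compose[of a u "\<lambda>n. a + t / real (Suc n)" sequentially] by simp
        then have "(\<lambda>n. dramp t *\<^sub>R u (a + t / real (Suc n))) \<longlonglongrightarrow> dramp t *\<^sub>R u a" by (intro tendsto_intros)
        moreover have "F n t = dramp t *\<^sub>R u (a + t / real (Suc n))" for n
          using True a by (simp add: F_def add_pos_nonneg)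
        ultimately show ?thesis by simp
      qed (simp add: F_def dramp_0)
    qed
    show "AE t in lborel. norm (F n t) \<le> indicat_real {0..1} t * (4 * C)" for n
    proof (rule AE_I2)
      fix t
      show "norm (F n t) \<le> indicat_real {0..1} t * (4 * C)"
      proof (cases "t \<in> {0..1}")
        case True
        have "t / real (Suc n) \<le> 1 / 1" using True by (intro frac_le) auto
        then have "norm (u (a + t / real (Suc n))) \<le> C" using True by (intro C) auto
        then have "\<bar>dramp t\<bar> * norm (indicat_real {0<..} (a + t / real (Suc n)) *\<^sub>R u (a + t / real (Suc n))) \<le> 4 * C"
          using C(2) by (intro mult_mono dramp_le) (auto split: split_indicator)
        then show ?thesis using True unfolding F_def norm_scaleR by simp
      qed (simp add: F_def dramp_0)
    qed
  qed
  moreover have "(\<integral>t. dramp t *\<^sub>R u a \<partial>lborel) = u a"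
  proof -
    have d: "dramp t *\<^sub>R u a = (indicat_real {0..1} t *\<^sub>R dramp t) *\<^sub>R u a" for t
      using dramp_0 by (auto split: split_indicator)
    have "(\<integral>t. indicat_real {0..1} t *\<^sub>R dramp t \<partial>lborel) = ramp 1 - ramp 0"
      by (rule integral_FTC_atLeastAtMost)
        (auto intro: continuous_dramp has_field_derivative_at_within[OF DERIV_ramp] simp: has_real_derivative_iff_has_vector_derivative[symmetric])
    moreover have "integrable lborel (\<lambda>t. indicat_real {0..1} t *\<^sub>R dramp t)"
      using borel_integrable_atLeastAtMost'[OF continuous_dramp, of 0 1] by (simp add: set_integrable_def)
    ultimately show ?thesis by (simp only: d integral_scaleR_left) (simp add: ramp_0 ramp_1)
  qed
  ultimately show ?thesis by (simp only: eq)
qed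

section \<open>Weak differentiability and absolute continuity\<close>

lemma test_function_deriv:
  assumes "test_function I \<phi>"
  obtains D where "\<And>x. (\<phi> has_real_derivative D x) (at x)" "continuous_on UNIV D" "deriv \<phi> = D"
proof -
  obtain D where D: "\<And>x. (\<phi> has_vector_derivative D x) (at x)" "continuous_on UNIV D"
    using assms unfolding test_function_def C1_differentiable_on_def by auto
  then have "\<And>x. (\<phi> has_real_derivative D x) (at x)"
    by (simp add: has_real_derivative_iff_has_vector_derivative)
  with D(2) show thesis by (intro that[of D]) (auto intro: DERIV_imp_deriv)
qed

lemma has_weak_deriv_cong:
  assumes "\<And>x. x \<in> I \<Longrightarrow> u x = u' x" "\<And>x. x \<in> I \<Longrightarrow> g x = g' x"
  shows "has_weak_deriv I u g \<longleftrightarrow> has_weak_deriv I u' g'"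
proof -
  have "(LBINT x:I. h x *\<^sub>R u x) = (LBINT x:I. h x *\<^sub>R u' x)"
    "(LBINT x:I. h x *\<^sub>R g x) = (LBINT x:I. h x *\<^sub>R g' x)" for h :: "real \<Rightarrow> real"
    unfolding set_lebesgue_integral_def using assms
    by (auto intro!: Bochner_Integration.integral_cong split: split_indicator)
  then show ?thesis by (simp add: has_weak_deriv_def)
qed

text \<open>Integration by parts on [0, R], where the test function vanishes at both ends.\<close>

lemma prim_imp_has_weak_deriv:
  assumes "prim f g" shows "has_weak_deriv Rplus f g"
  unfolding has_weak_deriv_def
proof (intro allI impI)
  fix \<phi> assume t: "test_function Rplus \<phi>"
  obtain D where D: "\<And>x. (\<phi> has_real_derivative D x) (at x)" "continuous_on UNIV D" "deriv \<phi> = D"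
    using test_function_deriv[OF t] by blast
  obtain K where K: "compact K" "K \<subseteq> Rplus" "\<And>x. x \<notin> K \<Longrightarrow> \<phi> x = 0"
    using t by (auto simp: test_function_def)
  \<comment> \<open>The margin 1 places R itself outside the support, so that the boundary term at R
    vanishes.\<close>
  obtain R where R: "R > 0" "\<And>x. x \<in> K \<Longrightarrow> norm x \<le> R - 1"
  proof -
    obtain B where "\<forall>x\<in>K. norm x \<le> B" "B > 0" using compact_imp_bounded[OF K(1)] unfolding bounded_pos by blast
    then show thesis by (intro that[of "B + 1"]) auto
  qed
  have D0: "D x = 0" if "x \<notin> K" for x
  proof -
    have "open (- K)" using K(1) by (simp add: compact_imp_closed open_Compl)
    then have "((\<lambda>x. 0) has_real_derivative D x) (at x)"
      by (rule has_field_derivative_transform_within_open[OF D(1)[of x]]) (use K(3) that in auto)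
    then show ?thesis by (rule DERIV_unique) auto
  qed
  have p: "prim \<phi> D"
    using D by (intro prim_C1) (auto intro: has_vector_derivative_at_within continuous_on_subset
        simp: has_real_derivative_iff_has_vector_derivative)
  have z: "\<phi> 0 = 0" "\<phi> R = 0" using K(2) R(1) R(2)[of R] by (auto intro: K(3))
  have c: "continuous_on {0..R} f" "continuous_on {0..R} \<phi>"
    using prim_continuous[OF assms] prim_continuous[OF p] by (auto intro: continuous_on_subset)
  note i1 = set_integrable_scaleR_continuous[OF c(2) prim_integrable[OF assms order_refl] c(1) prim_integrable[OF p order_refl]]
  note i2 = set_integrable_continuous_scaleR[OF c(2) prim_integrable[OF assms order_refl] c(1) prim_integrable[OF p order_refl]]
  have "(LBINT x:{0..R}. D x *\<^sub>R f x + \<phi> x *\<^sub>R g x) = 0"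
    using prim_eq[OF prim_scaleR[OF p assms], of R] R(1) z by simp
  then have e: "(LBINT x:{0..R}. D x *\<^sub>R f x) = - (LBINT x:{0..R}. \<phi> x *\<^sub>R g x)"
    using i1 i2 by (simp add: set_integral_add(2) add_eq_0_iff2)
  have s: "(LBINT x:Rplus. h x *\<^sub>R k x) = (LBINT x:{0..R}. h x *\<^sub>R k x)"
    if "\<And>x. x \<notin> K \<Longrightarrow> h x = 0" for h and k :: "real \<Rightarrow> complex"
    unfolding set_lebesgue_integral_def
  proof (rule Bochner_Integration.integral_cong[OF refl])
    fix x show "indicat_real Rplus x *\<^sub>R h x *\<^sub>R k x = indicat_real {0..R} x *\<^sub>R h x *\<^sub>R k x"
      using K(2) R(2)[of x] that[of x] by (cases "x \<in> K") (auto split: split_indicator)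
  qed
  show "(LBINT x:Rplus. deriv \<phi> x *\<^sub>R f x) = - (LBINT x:Rplus. \<phi> x *\<^sub>R g x)"
    using s[OF D0] s[OF K(3)] e by (simp add: D(3))
qed

text \<open>The test functions rise from 0 to 1 just after a and fall back just after b. Their
  derivative is the difference of the approximate identities at a and b, while the functions
  themselves converge to the indicator of (a, b].\<close>

lemma weak_deriv_increment:
  fixes u :: "real \<Rightarrow> complex"
  assumes cont: "continuous_on {0<..} u" and g: "sqi g" and w: "has_weak_deriv Rplus u g"
    and ab: "0 < a" "a < b"
  shows "u b - u a = (LBINT x:{a..b}. g x)"
proof -
  define N where "N = (\<lambda>n. real (Suc n))"
  have N: "N n \<ge> 1" for n by (simp add: N_def)
  define \<phi> where "\<phi> = (\<lambda>n x. ramp (N n * (x - a)) - ramp (N n * (x - b)))"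
  define D where "D = (\<lambda>n c x. N n * dramp (N n * (x - c)))"
  have dr: "((\<lambda>x. ramp (N n * (x - c))) has_real_derivative D n c x) (at x)" for n c x
  proof -
    have "((\<lambda>x. N n * (x - c)) has_real_derivative N n) (at x)" by (auto intro!: derivative_eq_intros)
    from DERIV_chain2[where f = ramp, OF DERIV_ramp this] show ?thesis by (simp add: D_def mult.commute)
  qed
  have der: "(\<phi> n has_real_derivative D n a x - D n b x) (at x)" for n x
    unfolding \<phi>_def by (intro DERIV_diff dr)
  have cD: "continuous_on A (D n c)" for A n c
    unfolding D_def by (intro continuous_intros continuous_on_compose2[OF continuous_dramp]) auto
  \<comment> \<open>Both ramps are complete by b + 1 because N >= 1, which gives one compact support
    for all n.\<close>
  have \<phi>0: "\<phi> n x = 0" if nx: "x \<notin> {a..b+1}" for n x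
  proof -
    consider "x < a" | "x > b + 1" using nx by (auto simp: not_le)
    then show ?thesis
    proof cases
      case 1
      then show ?thesis using ab N[of n] by (simp add: \<phi>_def ramp_0 mult_nonneg_nonpos)
    next
      case 2
      have "1 * 1 \<le> N n * (x - b)" "1 * 1 \<le> N n * (x - a)"
        by (rule mult_mono; use 2 ab N[of n] in simp)+
      then show ?thesis by (simp add: \<phi>_def ramp_1)
    qed
  qed
  have t: "test_function Rplus (\<phi> n)" for n
    unfolding test_function_def C1_differentiable_on_def
  proof (intro conjI exI[of _ "{a..b+1}"] exI[of _ "\<lambda>x. D n a x - D n b x"] ballI)
    show "(\<phi> n has_vector_derivative D n a x - D n b x) (at x)" for x
      using der by (simp add: has_real_derivative_iff_has_vector_derivative)
  qed (use ab \<phi>0 in \<open>auto intro!: continuous_intros cD\<close>)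
  have iD: "set_integrable lborel Rplus (\<lambda>x. D n c x *\<^sub>R u x)" if "c > 0" for n c
  proof -
    have D0: "D n c x = 0" if "x \<notin> {c..c+1}" for x
    proof -
      have "N n * (x - c) \<notin> {0..1}"
      proof (cases "x < c")
        case True
        then show ?thesis using N[of n] by (simp add: mult_less_0_iff not_le)
      next
        case False
        then have "x - c \<le> N n * (x - c)" using N[of n] mult_right_mono[of 1 "N n" "x - c"] by simp
        moreover have "x - c > 1" using False that by auto
        ultimately show ?thesis unfolding atLeastAtMost_iff by linarith
      qed
      then show ?thesis by (simp add: D_def dramp_0)
    qed
    have "set_integrable lborel {c..c+1} (\<lambda>x. D n c x *\<^sub>R u x)"
      using that by (intro borel_integrable_atLeastAtMost' continuous_intros cD continuous_on_subset[OF cont]) auto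
    moreover have "(\<lambda>x. indicat_real {c..c+1} x *\<^sub>R D n c x *\<^sub>R u x) = (\<lambda>x. indicat_real Rplus x *\<^sub>R D n c x *\<^sub>R u x)"
      using D0 that by (auto simp: fun_eq_iff split: split_indicator)
    ultimately show ?thesis unfolding set_integrable_def by simp
  qed
  have L: "(LBINT x:Rplus. deriv (\<phi> n) x *\<^sub>R u x) = (LBINT x:Rplus. D n a x *\<^sub>R u x) - (LBINT x:Rplus. D n b x *\<^sub>R u x)" for n
  proof -
    have "deriv (\<phi> n) x = D n a x - D n b x" for x by (rule DERIV_imp_deriv[OF der])
    then show ?thesis using iD[of a n] iD[of b n] ab by (simp add: scaleR_left_diff_distrib set_integral_diff(2))
  qed
  have "(\<lambda>n. LBINT x:Rplus. D n c x *\<^sub>R u x) \<longlonglongrightarrow> u c" if "c > 0" for c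
    using approximate_evaluation[OF cont that] by (simp only: D_def N_def)
  then have "(\<lambda>n. (LBINT x:Rplus. D n a x *\<^sub>R u x) - (LBINT x:Rplus. D n b x *\<^sub>R u x)) \<longlonglongrightarrow> u a - u b"
    using ab by (intro tendsto_diff) auto
  then have l1: "(\<lambda>n. - (LBINT x:Rplus. \<phi> n x *\<^sub>R g x)) \<longlonglongrightarrow> u a - u b"
    using w t unfolding has_weak_deriv_def by (simp only: L[symmetric])
  have gi: "set_integrable lborel {a..b+1} g"
    by (rule set_integrable_subset[OF sqi_locally_integrable[OF g, of "b+1"]]) (use ab in auto)
  have gm: "(\<lambda>x. indicat_real Rplus x *\<^sub>R g x) \<in> borel_measurable borel"
    using sqi_measurable[OF g] by (simp add: HL_measurable_iff[symmetric] set_borel_measurable_def)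
  have l2: "(\<lambda>n. LBINT x:Rplus. \<phi> n x *\<^sub>R g x) \<longlonglongrightarrow> (LBINT x:{a<..b}. g x)"
    unfolding set_lebesgue_integral_def
  proof (rule integral_dominated_convergence)
    show "integrable lborel (\<lambda>x. norm (indicat_real {a..b+1} x *\<^sub>R g x))"
      using gi unfolding set_integrable_def by (rule integrable_norm)
    have "set_integrable lborel {a<..b} g" by (rule set_integrable_subset[OF gi]) auto
    then show "(\<lambda>x. indicat_real {a<..b} x *\<^sub>R g x) \<in> borel_measurable lborel"
      unfolding set_integrable_def by auto
    show "(\<lambda>x. indicat_real Rplus x *\<^sub>R \<phi> n x *\<^sub>R g x) \<in> borel_measurable lborel" for n
    proof -
      have "continuous_on UNIV (\<phi> n)" using der by (meson DERIV_isCont continuous_at_imp_continuous_on)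
      then have [measurable]: "\<phi> n \<in> borel_measurable borel" by (rule borel_measurable_continuous_onI)
      have "(\<lambda>x. \<phi> n x *\<^sub>R (indicat_real Rplus x *\<^sub>R g x)) \<in> borel_measurable lborel"
        using gm by measurable
      then show ?thesis by (simp add: mult.commute)
    qed
    show "AE x in lborel. (\<lambda>n. indicat_real Rplus x *\<^sub>R \<phi> n x *\<^sub>R g x) \<longlonglongrightarrow> indicat_real {a<..b} x *\<^sub>R g x"
    proof (intro AE_I2)
      fix x
      \<comment> \<open>\<open>ramp\<close> is 0 at 0, so the limit is a strict comparison; this
        makes the limiting interval half-open.\<close>
      have r: "(\<lambda>n. ramp (N n * (x - c))) \<longlonglongrightarrow> (if x > c then 1 else 0)" for c
      proof (cases "x > c")
        case True
        obtain m where m: "1 / (x - c) \<le> real m" using real_arch_simple by blast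
        have "ramp (N n * (x - c)) = 1" if "n \<ge> m" for n
        proof (rule ramp_1)
          have "1 / (x - c) \<le> N n" using m that by (simp add: N_def)
          then show "1 \<le> N n * (x - c)" using True by (simp add: field_simps)
        qed
        then show ?thesis using True by (auto intro!: tendsto_eventually eventually_sequentiallyI[of m])
      next
        case False
        then have "ramp (N n * (x - c)) = 0" for n using N[of n] by (intro ramp_0) (simp add: mult_nonneg_nonpos)
        then show ?thesis using False by simp
      qed
      have "(\<lambda>n. \<phi> n x) \<longlonglongrightarrow> (if x > a then 1 else 0) - (if x > b then 1 else 0)"
        unfolding \<phi>_def by (intro tendsto_diff r)
      then have "(\<lambda>n. indicat_real Rplus x *\<^sub>R \<phi> n x *\<^sub>R g x) \<longlonglongrightarrow> indicat_real Rplus x *\<^sub>R ((if x > a then 1 else 0) - (if x > b then 1 else 0)) *\<^sub>R g x"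
        by (intro tendsto_intros)
      then show "(\<lambda>n. indicat_real Rplus x *\<^sub>R \<phi> n x *\<^sub>R g x) \<longlonglongrightarrow> indicat_real {a<..b} x *\<^sub>R g x"
        using ab by (auto split: split_indicator)
    qed
    show "AE x in lborel. norm (indicat_real Rplus x *\<^sub>R \<phi> n x *\<^sub>R g x) \<le> norm (indicat_real {a..b+1} x *\<^sub>R g x)" for n
    proof (intro AE_I2)
      fix x
      have "\<bar>\<phi> n x\<bar> \<le> 1" using ramp_bounds[of "N n * (x - a)"] ramp_bounds[of "N n * (x - b)"] by (auto simp: \<phi>_def)
      then have "\<bar>\<phi> n x\<bar> * norm (g x) \<le> 1 * norm (g x)" by (intro mult_right_mono) auto
      then show "norm (indicat_real Rplus x *\<^sub>R \<phi> n x *\<^sub>R g x) \<le> norm (indicat_real {a..b+1} x *\<^sub>R g x)"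
        using \<phi>0[of x n] ab by (cases "x \<in> {a..b+1}") auto
    qed
  qed
  have "u a - u b = - (LBINT x:{a<..b}. g x)" by (rule LIMSEQ_unique[OF l1 tendsto_minus[OF l2]])
  then have "u b - u a = (LBINT x:{a<..b}. g x)" by (metis minus_diff_eq minus_minus)
  then show ?thesis by (simp add: set_integral_Ioc_Icc)
qed

lemma has_weak_deriv_imp_prim:
  fixes u :: "real \<Rightarrow> complex"
  assumes cont: "continuous_on {0<..} u" and g: "sqi g" and w: "has_weak_deriv Rplus u g"
  obtains l where "prim (u(0 := l)) g"
proof -
  have gi: "set_integrable lborel {0..x} g" for x by (rule sqi_locally_integrable[OF g])
  \<comment> \<open>The only possible trace: the increment formula continued from the base point 1
    down to 0. The value of u at 0 carries no information and is overwritten by it.\<close>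
  define l where "l = u 1 - (LBINT x:{0..1}. g x)"
  have "u x = l + (LBINT s:{0..x}. g s)" if "x > 0" for x
  proof -
    consider "x < 1" | "x = 1" | "x > 1" by linarith
    then show ?thesis
    proof cases
      case 1
      then show ?thesis using weak_deriv_increment[OF cont g w, of x 1] set_integral_Icc_split[of 0 x 1 g] that gi[of 1]
        by (simp add: l_def algebra_simps)
    next
      case 3
      then show ?thesis using weak_deriv_increment[OF cont g w, of 1 x] set_integral_Icc_split[of 0 1 x g] that gi[of x]
        by (simp add: l_def algebra_simps)
    qed (simp add: l_def)
  qed
  moreover have "(LBINT s:{0..0}. g s) = 0"
    using set_integral_Ioc_Icc[of 0 0 g] by (simp add: set_lebesgue_integral_def)
  ultimately have "prim (u(0 := l)) g" by (intro primI gi) auto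
  then show thesis by (rule that)
qed

section \<open>Reflection\<close>

lemma set_integral_Rminus: "(LBINT x:Rminus. f x) = (LBINT x:Rplus. f (- x))"
  for f :: "real \<Rightarrow> 'a::euclidean_space"
proof -
  have "{x. - x \<in> Rminus} = Rplus" by auto
  then show ?thesis using set_integral_reflect[of Rminus f] by (simp only:)
qed

lemma set_integrable_Rminus: "set_integrable lborel Rminus f \<longleftrightarrow> integrable HL (\<lambda>x. f (- x))"
  for f :: "real \<Rightarrow> 'a::euclidean_space"
proof -
  have "integrable lborel (\<lambda>x. indicat_real Rminus (0 + (-1) * x) *\<^sub>R f (0 + (-1) * x)) = integrable lborel (\<lambda>x. indicat_real Rminus x *\<^sub>R f x)"
    by (rule lborel_integrable_real_affine_iff[of "-1" "\<lambda>x. indicat_real Rminus x *\<^sub>R f x" 0]) simp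
  moreover have "indicat_real Rminus (0 + (-1) * x) = indicat_real Rplus x" for x by (auto split: split_indicator)
  ultimately show ?thesis by (simp add: HL_integrable_iff[symmetric] set_integrable_def)
qed

lemma set_measurable_Rminus: "set_borel_measurable lborel Rminus f \<longleftrightarrow> (\<lambda>x. f (- x)) \<in> borel_measurable HL"
  for f :: "real \<Rightarrow> 'a::euclidean_space"
proof -
  have e: "indicat_real Rplus (- x) = indicat_real Rminus x" "indicat_real Rminus (- x) = indicat_real Rplus x" for x
    by (auto split: split_indicator)
  have u: "uminus \<in> borel \<rightarrow>\<^sub>M (borel :: real measure)" by measurable
  have "(\<lambda>x. indicat_real Rminus x *\<^sub>R f x) \<in> borel_measurable borel \<longleftrightarrow> (\<lambda>x. indicat_real Rplus x *\<^sub>R f (- x)) \<in> borel_measurable borel"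
    (is "?F \<in> _ \<longleftrightarrow> ?G \<in> _")
  proof
    assume "?F \<in> borel_measurable borel"
    from measurable_compose[OF u this] show "?G \<in> borel_measurable borel" by (simp only: e)
  next
    assume "?G \<in> borel_measurable borel"
    from measurable_compose[OF u this] show "?F \<in> borel_measurable borel" by (simp only: e minus_minus)
  qed
  then show ?thesis by (simp add: HL_measurable_iff[symmetric] set_borel_measurable_def)
qed

lemma L2_on_Rminus_iff: "L2_on Rminus f \<longleftrightarrow> sqi (\<lambda>x. f (- x))"
  by (simp add: L2_on_def sqi_def set_measurable_Rminus set_integrable_Rminus)

lemma L2_sq_Rminus: "L2_sq Rminus f = (\<integral>x. norm (f (- x)) ^ 2 \<partial>HL)"
  by (simp add: L2_sq_def set_integral_Rminus HL_integral)

lemma test_function_reflect: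
  assumes "test_function I \<phi>" "\<And>x. x \<in> I \<Longrightarrow> - x \<in> J"
  shows "test_function J (\<lambda>x. \<phi> (- x))" "deriv (\<lambda>x. \<phi> (- x)) x = - deriv \<phi> (- x)"
proof -
  obtain D where D: "\<And>x. (\<phi> has_real_derivative D x) (at x)" "continuous_on UNIV D" "deriv \<phi> = D"
    using test_function_deriv[OF assms(1)] by blast
  have d: "((\<lambda>x. \<phi> (- x)) has_real_derivative - D (- x)) (at x)" for x
    using DERIV_chain2[where f = \<phi> and g = uminus and x = x and s = UNIV, OF D(1) DERIV_minus[OF DERIV_ident]] by simp
  show "deriv (\<lambda>x. \<phi> (- x)) x = - deriv \<phi> (- x)" using d D(3) by (auto intro: DERIV_imp_deriv)
  obtain K where K: "compact K" "K \<subseteq> I" "\<And>x. x \<notin> K \<Longrightarrow> \<phi> x = 0"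
    using assms by (auto simp: test_function_def)
  have cD: "continuous_on UNIV (\<lambda>x. - D (- x))"
    by (intro continuous_intros continuous_on_compose2[OF D(2)]) auto
  have "compact (uminus ` K)" by (intro compact_continuous_image K continuous_intros)
  moreover have "\<phi> (- x) = 0" if "x \<notin> uminus ` K" for x
    using that K(3)[of "- x"] by (metis image_eqI minus_minus)
  ultimately show "test_function J (\<lambda>x. \<phi> (- x))"
    unfolding test_function_def C1_differentiable_on_def
  proof (intro conjI exI[of _ "uminus ` K"] exI[of _ "\<lambda>x. - D (- x)"] ballI)
    show "((\<lambda>x. \<phi> (- x)) has_vector_derivative - D (- x)) (at x)" for x
      using d by (simp add: has_real_derivative_iff_has_vector_derivative)
  qed (use cD K(2) assms(2) in auto)
qed

lemma has_weak_deriv_reflect: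
  "has_weak_deriv Rminus u g \<longleftrightarrow> has_weak_deriv Rplus (\<lambda>x. u (- x)) (\<lambda>x. - g (- x))"
proof -
  have neg: "(LBINT x:Rplus. - f x) = - (LBINT x:Rplus. f x)" for f :: "real \<Rightarrow> complex"
    by (simp add: set_lebesgue_integral_def)
  show ?thesis
  proof
    assume l: "has_weak_deriv Rminus u g"
    show "has_weak_deriv Rplus (\<lambda>x. u (- x)) (\<lambda>x. - g (- x))"
      unfolding has_weak_deriv_def
    proof (intro allI impI)
      fix \<phi> assume t: "test_function Rplus \<phi>"
      note r = test_function_reflect[OF t, of Rminus, simplified]
      show "(LBINT x:Rplus. deriv \<phi> x *\<^sub>R u (- x)) = - (LBINT x:Rplus. \<phi> x *\<^sub>R - g (- x))"
        using l r(1) unfolding has_weak_deriv_def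
        by (auto simp: set_integral_Rminus r(2) neg dest!: spec[of _ "\<lambda>x. \<phi> (- x)"])
    qed
  next
    assume l: "has_weak_deriv Rplus (\<lambda>x. u (- x)) (\<lambda>x. - g (- x))"
    show "has_weak_deriv Rminus u g"
      unfolding has_weak_deriv_def
    proof (intro allI impI)
      fix \<phi> assume t: "test_function Rminus \<phi>"
      note r = test_function_reflect[OF t, of Rplus, simplified]
      have "(LBINT x:Rplus. deriv (\<lambda>x. \<phi> (- x)) x *\<^sub>R u (- x)) = - (LBINT x:Rplus. \<phi> (- x) *\<^sub>R - g (- x))"
        using l r(1) unfolding has_weak_deriv_def by blast
      then have "- (LBINT x:Rplus. deriv \<phi> (- x) *\<^sub>R u (- x)) = (LBINT x:Rplus. \<phi> (- x) *\<^sub>R g (- x))"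
        unfolding r(2) scaleR_minus_left scaleR_minus_right neg minus_minus .
      then show "(LBINT x:Rminus. deriv \<phi> x *\<^sub>R u x) = - (LBINT x:Rminus. \<phi> x *\<^sub>R g x)"
        unfolding set_integral_Rminus by (metis minus_minus)
    qed
  qed
qed

section \<open>Sobolev functions on the half-line\<close>

text \<open>The derivative is an explicit argument because it is determined only up to a null set,
  and the choice operator in \<open>weak_deriv\<close> gives no control over the version that it
  returns.\<close>

definition H1pair :: "(real \<Rightarrow> complex) \<Rightarrow> (real \<Rightarrow> complex) \<Rightarrow> bool" where
  "H1pair f g \<longleftrightarrow> prim f g \<and> sqi f \<and> sqi g"

lemma H1pairD: "H1pair f g \<Longrightarrow> prim f g" "H1pair f g \<Longrightarrow> sqi f" "H1pair f g \<Longrightarrow> sqi g"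
  by (auto simp: H1pair_def)

lemma H1pair_add: "H1pair f g \<Longrightarrow> H1pair f' g' \<Longrightarrow> H1pair (\<lambda>x. f x + f' x) (\<lambda>x. g x + g' x)"
  by (auto simp: H1pair_def intro: prim_add sqi_add)

lemma H1pair_scaleR: "H1pair f g \<Longrightarrow> H1pair (\<lambda>x. c *\<^sub>R f x) (\<lambda>x. c *\<^sub>R g x)"
  by (auto simp: H1pair_def intro: prim_scaleR_const sqi_scaleR)

lemma sqi_inner:
  assumes "sqi f" "sqi g" shows "integrable HL (\<lambda>x. Re (f x * cnj (g x)))"
proof (rule sqi_mult[OF assms, where C = 1])
  have [measurable]: "f \<in> borel_measurable HL" "g \<in> borel_measurable HL" using assms by (auto simp: sqi_def)
  have "(\<lambda>x. Re (f x) * Re (g x) + Im (f x) * Im (g x)) \<in> borel_measurable HL" by measurable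
  then show "(\<lambda>x. Re (f x * cnj (g x))) \<in> borel_measurable HL" by simp
  show "\<bar>Re (f x * cnj (g x))\<bar> \<le> 1 * (cmod (f x) * cmod (g x))" for x
    using abs_Re_le_cmod[of "f x * cnj (g x)"] by (simp add: norm_mult)
qed

lemma prim_norm_sq:
  assumes "prim f g" shows "prim (\<lambda>x. (cmod (f x))\<^sup>2) (\<lambda>x. 2 * Re (f x * cnj (g x)))"
proof -
  have "prim (\<lambda>x. Re (f x) *\<^sub>R Re (f x) + Im (f x) *\<^sub>R Im (f x))
      (\<lambda>x. (Re (g x) *\<^sub>R Re (f x) + Re (f x) *\<^sub>R Re (g x)) + (Im (g x) *\<^sub>R Im (f x) + Im (f x) *\<^sub>R Im (g x)))"
    by (intro prim_add prim_scaleR prim_Re prim_Im assms)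
  moreover have "(\<lambda>x. Re (f x) *\<^sub>R Re (f x) + Im (f x) *\<^sub>R Im (f x)) = (\<lambda>x. (cmod (f x))\<^sup>2)"
    by (simp add: fun_eq_iff cmod_power2) (simp add: power2_eq_square)
  moreover have "(\<lambda>x. (Re (g x) *\<^sub>R Re (f x) + Re (f x) *\<^sub>R Re (g x)) + (Im (g x) *\<^sub>R Im (f x) + Im (f x) *\<^sub>R Im (g x)))
      = (\<lambda>x. 2 * Re (f x * cnj (g x)))" by (simp add: fun_eq_iff algebra_simps)
  ultimately show ?thesis by simp
qed

text \<open>The derivative 2 Re(f conj g) of |f|^2 is integrable, so |f|^2 has a limit at infinity,
  and integrability of |f|^2 forces this limit to be 0.\<close>

lemma H1pair_tendsto_0:
  assumes "H1pair f g" shows "((\<lambda>x. (cmod (f x))\<^sup>2) \<longlongrightarrow> 0) at_top"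
proof -
  note p = prim_norm_sq[OF H1pairD(1)[OF assms]]
  have "integrable HL (\<lambda>x. 2 * Re (f x * cnj (g x)))"
    by (rule integrable_mult_right) (rule sqi_inner[OF H1pairD(2,3)[OF assms]])
  then have lim: "((\<lambda>x. (cmod (f x))\<^sup>2) \<longlongrightarrow> (cmod (f 0))\<^sup>2 + (LBINT x:{0<..}. 2 * Re (f x * cnj (g x)))) at_top"
    by (intro prim_limit_at_top[OF p]) (simp add: HL_integrable_iff)
  have "(cmod (f 0))\<^sup>2 + (LBINT x:{0<..}. 2 * Re (f x * cnj (g x))) = 0"
    by (rule integrable_limit_zero[OF sqi_integrable[OF H1pairD(2)[OF assms]] _ lim]) simp
  with lim show ?thesis by simp
qed

text \<open>Integrate the derivative of |f|^2 from x to infinity and use 2|f||g| <= |f|^2 + |g|^2.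
  The case x = 0 is the trace inequality.\<close>

lemma H1pair_bound:
  assumes H: "H1pair f g" and x: "0 \<le> x"
  shows "(cmod (f x))\<^sup>2 \<le> (\<integral>x. (cmod (f x))\<^sup>2 \<partial>HL) + (\<integral>x. (cmod (g x))\<^sup>2 \<partial>HL)"
proof -
  note p = prim_norm_sq[OF H1pairD(1)[OF H]]
  note i = sqi_integrable[OF H1pairD(2)[OF H]] sqi_integrable[OF H1pairD(3)[OF H]]
  have "(cmod (f x))\<^sup>2 - ((\<integral>x. (cmod (f x))\<^sup>2 \<partial>HL) + (\<integral>x. (cmod (g x))\<^sup>2 \<partial>HL)) \<le> 0"
  proof (rule tendsto_lowerbound[OF H1pair_tendsto_0[OF H]])
    have "(cmod (f x))\<^sup>2 - ((\<integral>x. (cmod (f x))\<^sup>2 \<partial>HL) + (\<integral>x. (cmod (g x))\<^sup>2 \<partial>HL)) \<le> (cmod (f R))\<^sup>2" if "R \<ge> x" for R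
    proof -
      have "(cmod (f x))\<^sup>2 - (cmod (f R))\<^sup>2 = - (LBINT t:{x..R}. 2 * Re (f t * cnj (g t)))"
        using prim_diff[OF p x that] by linarith
      also have "\<dots> = (LBINT t:{x..R}. - (2 * Re (f t * cnj (g t))))"
        by (rule set_integral_uminus[symmetric]) (rule prim_integrable[OF p x])
      also have "\<dots> \<le> (LBINT t:{x..R}. (cmod (f t))\<^sup>2 + (cmod (g t))\<^sup>2)"
      proof (rule set_integral_mono)
        show "set_integrable lborel {x..R} (\<lambda>t. - (2 * Re (f t * cnj (g t))))"
        proof -
          have "set_integrable lborel {x..R} (\<lambda>t. (-1) *\<^sub>R (2 * Re (f t * cnj (g t))))"
            by (intro set_integrable_scaleR_right prim_integrable[OF p x])
          then show ?thesis unfolding scaleR_minus1_left .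
        qed
        have "set_integrable lborel {x<..R} (\<lambda>t. (cmod (f t))\<^sup>2 + (cmod (g t))\<^sup>2)"
          by (rule set_integrable_subset[of _ "{0<..}"]) (use i x in \<open>auto simp: HL_integrable_iff\<close>)
        then show "set_integrable lborel {x..R} (\<lambda>t. (cmod (f t))\<^sup>2 + (cmod (g t))\<^sup>2)"
          by (simp add: set_integrable_Ioc_Icc)
        fix t
        have "\<bar>Re (f t * cnj (g t))\<bar> \<le> cmod (f t) * cmod (g t)"
          using abs_Re_le_cmod[of "f t * cnj (g t)"] by (simp add: norm_mult)
        then show "- (2 * Re (f t * cnj (g t))) \<le> (cmod (f t))\<^sup>2 + (cmod (g t))\<^sup>2"
          using sum_squares_bound[of "cmod (f t)" "cmod (g t)"] by linarith
      qed
      also have "\<dots> \<le> (\<integral>t. (cmod (f t))\<^sup>2 + (cmod (g t))\<^sup>2 \<partial>HL)"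
        by (rule HL_Icc_le) (use i x in auto)
      finally show ?thesis using i by simp
    qed
    then show "\<forall>\<^sub>F R in at_top. (cmod (f x))\<^sup>2 - ((\<integral>x. (cmod (f x))\<^sup>2 \<partial>HL) + (\<integral>x. (cmod (g x))\<^sup>2 \<partial>HL)) \<le> (cmod (f R))\<^sup>2"
      using eventually_ge_at_top[of x] by (rule eventually_mono[rotated])
  qed simp
  then show ?thesis by simp
qed

lemma H1pair_bounded:
  assumes "H1pair f g" obtains B where "B \<ge> 0" "\<And>x. 0 \<le> x \<Longrightarrow> cmod (f x) \<le> B"
proof -
  define B where "B = sqrt ((\<integral>x. (cmod (f x))\<^sup>2 \<partial>HL) + (\<integral>x. (cmod (g x))\<^sup>2 \<partial>HL))"
  have "cmod (f x) \<le> B" if "0 \<le> x" for x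
    unfolding B_def using H1pair_bound[OF assms that] by (intro real_le_rsqrt)
  then show thesis by (intro that[of B]) (auto simp: B_def)
qed

lemma H1pair_integrable_6:
  assumes "H1pair f g" shows "integrable HL (\<lambda>x. cmod (f x) ^ 6)"
proof -
  obtain B where B: "B \<ge> 0" "\<And>x. 0 \<le> x \<Longrightarrow> cmod (f x) \<le> B" using H1pair_bounded[OF assms] by blast
  have [measurable]: "f \<in> borel_measurable HL" using assms by (auto simp: H1pair_def sqi_def)
  show ?thesis
  proof (rule sqi_mult[OF H1pairD(2)[OF assms] H1pairD(2)[OF assms], where C = "B ^ 4"])
    fix x :: real assume "0 < x"
    then have "cmod (f x) ^ 4 * (cmod (f x) * cmod (f x)) \<le> B ^ 4 * (cmod (f x) * cmod (f x))"
      by (intro mult_right_mono power_mono B) auto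
    then show "\<bar>cmod (f x) ^ 6\<bar> \<le> B ^ 4 * (cmod (f x) * cmod (f x))" by (simp add: power_numeral_reduce mult_ac)
  qed measurable
qed

section \<open>Passage between the space \<open>H1\<close> and pairs with a trace\<close>

lemma H1_Rplus_pair:
  assumes "u \<in> H1 Rplus"
  obtains f where "H1pair f (weak_deriv Rplus u)" "\<And>x. x > 0 \<Longrightarrow> f x = u x"
proof -
  have c: "continuous_on Rplus u" and l: "L2_on Rplus u" and e: "\<exists>g. L2_on Rplus g \<and> has_weak_deriv Rplus u g"
    using assms by (auto simp: H1_def)
  have w: "L2_on Rplus (weak_deriv Rplus u) \<and> has_weak_deriv Rplus u (weak_deriv Rplus u)"
    unfolding weak_deriv_def by (rule someI_ex[OF e])
  then obtain l0 where p: "prim (u(0 := l0)) (weak_deriv Rplus u)"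
    using has_weak_deriv_imp_prim[OF c] by (auto simp: L2_on_Rplus_iff)
  have "L2_on Rplus (u(0 := l0))"
  proof -
    have "(\<lambda>x. indicat_real Rplus x *\<^sub>R (u(0 := l0)) x) = (\<lambda>x. indicat_real Rplus x *\<^sub>R u x)"
      "(\<lambda>x. indicat_real Rplus x *\<^sub>R (cmod ((u(0 := l0)) x))\<^sup>2) = (\<lambda>x. indicat_real Rplus x *\<^sub>R (cmod (u x))\<^sup>2)"
      by (auto simp: fun_eq_iff)
    then show ?thesis using l unfolding L2_on_def set_borel_measurable_def set_integrable_def by metis
  qed
  with p w show thesis by (intro that[of "u(0 := l0)"]) (auto simp: H1pair_def L2_on_Rplus_iff)
qed

lemma H1pair_tendsto_right:
  assumes "H1pair f g" shows "(f \<longlongrightarrow> f 0) (at_right 0)"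
proof -
  have "(f \<longlongrightarrow> f 0) (at 0 within {0..})"
    using prim_continuous[OF H1pairD(1)[OF assms]] by (auto simp: continuous_on_def)
  then show ?thesis by (rule tendsto_within_subset) auto
qed

lemma trace_right_eq:
  assumes "H1pair f g" "\<And>x. x > 0 \<Longrightarrow> u x = f x" shows "trace_right u = f 0"
proof -
  have "(u \<longlongrightarrow> f 0) (at_right 0)"
    using H1pair_tendsto_right[OF assms(1)]
    by (rule Lim_transform_eventually) (auto simp: eventually_at_right_less assms(2) intro: eventually_mono[OF eventually_at_right_less])
  then show ?thesis unfolding trace_right_def by (intro tendsto_Lim) auto
qed

lemma trace_left_eq:
  assumes "H1pair f g" "\<And>x. x > 0 \<Longrightarrow> u (- x) = f x" shows "trace_left u = f 0"
proof -
  have "((\<lambda>x. u (- x)) \<longlongrightarrow> f 0) (at_right 0)"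
    using H1pair_tendsto_right[OF assms(1)]
    by (rule Lim_transform_eventually) (auto simp: eventually_at_right_less assms(2) intro: eventually_mono[OF eventually_at_right_less])
  then have "(u \<longlongrightarrow> f 0) (at_left 0)"
    by (subst at_left_minus) (simp add: filterlim_filtermap)
  then show ?thesis unfolding trace_left_def by (intro tendsto_Lim) auto
qed

text \<open>The version chosen by \<open>weak_deriv\<close> also has a primitive that agrees with u
  on the open half-line; equality of the traces identifies this primitive with f, and then the two
  derivatives agree almost everywhere.\<close>

lemma H1pair_imp_H1_Rplus:
  assumes H: "H1pair f g" and u: "\<And>x. x > 0 \<Longrightarrow> u x = f x"
  shows "u \<in> H1 Rplus" "AE x in HL. weak_deriv Rplus u x = g x"
proof -
  have wd: "has_weak_deriv Rplus u g"
    using prim_imp_has_weak_deriv[OF H1pairD(1)[OF H]] u by (subst has_weak_deriv_cong[of _ u f g g]) auto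
  have c: "continuous_on Rplus u"
    using prim_continuous[OF H1pairD(1)[OF H]] u by (subst continuous_on_cong[of Rplus Rplus u f]) (auto intro: continuous_on_subset)
  have m: "L2_on Rplus u"
  proof -
    have "(\<lambda>x. indicat_real Rplus x *\<^sub>R f x) = (\<lambda>x. indicat_real Rplus x *\<^sub>R u x)"
      "(\<lambda>x. indicat_real Rplus x *\<^sub>R (cmod (f x))\<^sup>2) = (\<lambda>x. indicat_real Rplus x *\<^sub>R (cmod (u x))\<^sup>2)"
      using u by (auto simp: fun_eq_iff split: split_indicator)
    moreover have "L2_on Rplus f" using H by (simp add: H1pair_def L2_on_Rplus_iff)
    ultimately show ?thesis unfolding L2_on_def set_borel_measurable_def set_integrable_def by metis
  qed
  show h: "u \<in> H1 Rplus" using wd c m H by (auto simp: H1_def H1pair_def L2_on_Rplus_iff)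
  obtain f' where f': "H1pair f' (weak_deriv Rplus u)" "\<And>x. x > 0 \<Longrightarrow> f' x = u x"
    using H1_Rplus_pair[OF h] by blast
  have "f' 0 = f 0" using trace_right_eq[OF H u] trace_right_eq[OF f'(1), of u] f'(2) by simp
  then have "f' x = f x" if "0 \<le> x" for x using f'(2) u that by (cases "x = 0") auto
  then have "prim f (weak_deriv Rplus u)" using prim_cong[OF H1pairD(1)[OF f'(1)]] by blast
  from prim_unique[OF this H1pairD(1)[OF H]] show "AE x in HL. weak_deriv Rplus u x = g x"
    by (simp add: HL_AE_iff)
qed

lemma continuous_on_reflect:
  "continuous_on Rminus u \<longleftrightarrow> continuous_on Rplus (\<lambda>x. u (- x))" for u :: "real \<Rightarrow> complex"
proof
  assume "continuous_on Rminus u"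
  then show "continuous_on Rplus (\<lambda>x. u (- x))"
    by (rule continuous_on_compose2) (auto intro!: continuous_intros)
next
  assume "continuous_on Rplus (\<lambda>x. u (- x))"
  then have "continuous_on Rminus (\<lambda>x. u (- (- x)))"
    by (rule continuous_on_compose2) (auto intro!: continuous_intros)
  then show "continuous_on Rminus u" by simp
qed

lemma H1_reflect: "u \<in> H1 Rminus \<longleftrightarrow> (\<lambda>x. u (- x)) \<in> H1 Rplus"
proof -
  have "(\<exists>g. L2_on Rminus g \<and> has_weak_deriv Rminus u g) \<longleftrightarrow> (\<exists>g. L2_on Rplus g \<and> has_weak_deriv Rplus (\<lambda>x. u (- x)) g)"
  proof
    assume "\<exists>g. L2_on Rminus g \<and> has_weak_deriv Rminus u g"
    then obtain g where "L2_on Rminus g" "has_weak_deriv Rminus u g" by blast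
    then show "\<exists>g. L2_on Rplus g \<and> has_weak_deriv Rplus (\<lambda>x. u (- x)) g"
      using sqi_scaleR[of "\<lambda>x. g (- x)" "-1"]
      by (intro exI[of _ "\<lambda>x. - g (- x)"]) (simp add: has_weak_deriv_reflect L2_on_Rminus_iff L2_on_Rplus_iff)
  next
    assume "\<exists>g. L2_on Rplus g \<and> has_weak_deriv Rplus (\<lambda>x. u (- x)) g"
    then obtain g where "L2_on Rplus g" "has_weak_deriv Rplus (\<lambda>x. u (- x)) g" by blast
    then show "\<exists>g. L2_on Rminus g \<and> has_weak_deriv Rminus u g"
      using sqi_scaleR[of g "-1"]
      by (intro exI[of _ "\<lambda>x. - g (- x)"]) (simp add: has_weak_deriv_reflect L2_on_Rminus_iff L2_on_Rplus_iff)
  qed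
  then show ?thesis
    by (simp add: H1_def continuous_on_reflect L2_on_Rminus_iff L2_on_Rplus_iff)
qed

text \<open>The claim about the derivative does not follow from the right half-line by mere
  reflection: \<open>weak_deriv Rminus u\<close> and the weak derivative of the reflected function
  come from two independent choices. The reflected version of the first choice is therefore
  integrated anew.\<close>

lemma H1pair_imp_H1_Rminus:
  assumes H: "H1pair f g" and u: "\<And>x. x > 0 \<Longrightarrow> u (- x) = f x"
  shows "u \<in> H1 Rminus" "AE x in HL. weak_deriv Rminus u (- x) = - g x"
proof -
  show h: "u \<in> H1 Rminus" using H1pair_imp_H1_Rplus(1)[OF H u] by (simp add: H1_reflect)
  let ?G = "\<lambda>x. - weak_deriv Rminus u (- x)"
  have e: "\<exists>g. L2_on Rminus g \<and> has_weak_deriv Rminus u g" using h by (auto simp: H1_def)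
  have w: "L2_on Rminus (weak_deriv Rminus u) \<and> has_weak_deriv Rminus u (weak_deriv Rminus u)"
    unfolding weak_deriv_def by (rule someI_ex[OF e])
  have "sqi ?G" using w sqi_scaleR[of "\<lambda>x. weak_deriv Rminus u (- x)" "-1"] by (simp add: L2_on_Rminus_iff)
  moreover have "has_weak_deriv Rplus (\<lambda>x. u (- x)) ?G" using w by (simp add: has_weak_deriv_reflect)
  then have "has_weak_deriv Rplus f ?G" using u by (subst has_weak_deriv_cong[of _ f "\<lambda>x. u (- x)" ?G ?G]) auto
  moreover have "continuous_on Rplus f"
    using prim_continuous[OF H1pairD(1)[OF H]] by (rule continuous_on_subset) auto
  ultimately obtain l where l: "prim (f(0 := l)) ?G" using has_weak_deriv_imp_prim by blast
  have "((f(0 := l)) \<longlongrightarrow> l) (at 0 within {0..})"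
    using prim_continuous[OF l] unfolding continuous_on_def by (metis atLeast_iff fun_upd_same order_refl)
  then have "((f(0 := l)) \<longlongrightarrow> l) (at_right 0)" by (rule tendsto_within_subset) auto
  then have "(f \<longlongrightarrow> l) (at_right 0)"
    by (rule Lim_transform_eventually) (rule eventually_mono[OF eventually_at_right_less], simp)
  then have "l = f 0" using H1pair_tendsto_right[OF H] by (intro tendsto_unique[of "at_right 0" f]) auto
  then have "prim f ?G" using l by simp
  from prim_unique[OF this H1pairD(1)[OF H]] show "AE x in HL. weak_deriv Rminus u (- x) = - g x"
    unfolding HL_AE_iff by eventually_elim (metis minus_minus)
qed

section \<open>Functions on the broken line as pairs of half-line functions\<close>

text \<open>The left half is folded onto the right one, so v' is the derivative of the reflected
  function and has the opposite sign to u'; only its modulus enters the energy.\<close>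

definition rep :: "(real \<Rightarrow> complex) \<Rightarrow> (real \<Rightarrow> complex) \<Rightarrow> (real \<Rightarrow> complex)
    \<Rightarrow> (real \<Rightarrow> complex) \<Rightarrow> (real \<Rightarrow> complex) \<Rightarrow> bool" where
  "rep u v v' w w' \<longleftrightarrow> H1pair v v' \<and> H1pair w w' \<and> (\<forall>x>0. u (- x) = v x \<and> u x = w x)"

lemma repD:
  assumes "rep u v v' w w'"
  shows "H1pair v v'" "H1pair w w'" "\<And>x. x > 0 \<Longrightarrow> u (- x) = v x" "\<And>x. x > 0 \<Longrightarrow> u x = w x"
  using assms by (auto simp: rep_def)

lemma rep_exists:
  assumes "u \<in> H1 Rminus" "u \<in> H1 Rplus"
  obtains v v' w w' where "rep u v v' w w'"
proof -
  have "(\<lambda>x. u (- x)) \<in> H1 Rplus" using assms by (simp add: H1_reflect)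
  then obtain v where v: "H1pair v (weak_deriv Rplus (\<lambda>x. u (- x)))" "\<And>x. x > 0 \<Longrightarrow> v x = u (- x)"
    using H1_Rplus_pair by blast
  obtain w where "H1pair w (weak_deriv Rplus u)" "\<And>x. x > 0 \<Longrightarrow> w x = u x"
    using H1_Rplus_pair[OF assms(2)] by blast
  with v show thesis by (intro that[of v _ w]) (auto simp: rep_def)
qed

lemma rep_Dspace:
  assumes "rep u v v' w w'" shows "u \<in> Dspace \<tau> \<longleftrightarrow> w 0 = of_real \<tau> * v 0"
  using H1pair_imp_H1_Rminus(1)[of v v' u, OF repD(1)[OF assms] repD(3)[OF assms]]
    H1pair_imp_H1_Rplus(1)[OF repD(2)[OF assms] repD(4)[OF assms]]
    trace_left_eq[of v v' u, OF repD(1)[OF assms] repD(3)[OF assms]]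
    trace_right_eq[OF repD(2)[OF assms] repD(4)[OF assms]]
  by (simp add: Dspace_def)

lemma rep_add:
  assumes "rep u v v' w w'" "rep h p p' q q'"
  shows "rep (\<lambda>x. u x + h x) (\<lambda>x. v x + p x) (\<lambda>x. v' x + p' x) (\<lambda>x. w x + q x) (\<lambda>x. w' x + q' x)"
  using assms by (auto simp: rep_def intro: H1pair_add)

lemma rep_scaleR:
  assumes "rep u v v' w w'"
  shows "rep (\<lambda>x. c *\<^sub>R u x) (\<lambda>x. c *\<^sub>R v x) (\<lambda>x. c *\<^sub>R v' x) (\<lambda>x. c *\<^sub>R w x) (\<lambda>x. c *\<^sub>R w' x)"
  using assms unfolding rep_def by (auto intro: H1pair_scaleR[unfolded])

lemma integral_split_halves:
  fixes F :: "real \<Rightarrow> 'a::euclidean_space"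
  assumes "integrable HL F" "integrable HL (\<lambda>x. F (- x))"
  shows "(\<integral>x. F x \<partial>lborel) = (\<integral>x. F (- x) \<partial>HL) + (\<integral>x. F x \<partial>HL)"
proof -
  have "(\<integral>x. F x \<partial>lborel) = (LBINT x:Rminus \<union> Rplus. F x)"
    unfolding set_lebesgue_integral_def
    by (rule integral_discrete_difference[where X = "{0}"]) (auto split: split_indicator)
  also have "\<dots> = (LBINT x:Rminus. F x) + (LBINT x:Rplus. F x)"
    by (rule set_integral_Un) (use assms in \<open>auto simp: set_integrable_Rminus HL_integrable_iff\<close>)
  finally show ?thesis by (simp add: set_integral_Rminus HL_integral)
qed

lemma HL_integral_cong: "(\<And>x. x > 0 \<Longrightarrow> f x = g x) \<Longrightarrow> (\<integral>x. f x \<partial>HL) = (\<integral>x. g x \<partial>HL)"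
  and HL_integrable_cong: "(\<And>x. x > 0 \<Longrightarrow> f x = g x) \<Longrightarrow> integrable HL f = integrable HL g"
  for f g :: "real \<Rightarrow> 'a::euclidean_space"
  by (auto intro!: Bochner_Integration.integral_cong Bochner_Integration.integrable_cong simp: space_restrict_space)

lemma rep_mass:
  assumes r: "rep u v v' w w'"
  shows "mass u = (\<integral>x. (cmod (v x))\<^sup>2 \<partial>HL) + (\<integral>x. (cmod (w x))\<^sup>2 \<partial>HL)"
proof -
  have i: "integrable HL (\<lambda>x. (cmod (u x))\<^sup>2)" "integrable HL (\<lambda>x. (cmod (u (- x)))\<^sup>2)"
    using sqi_integrable[OF H1pairD(2)[OF repD(1)[OF r]]] sqi_integrable[OF H1pairD(2)[OF repD(2)[OF r]]] repD(3,4)[OF r]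
    by (auto cong: HL_integrable_cong)
  show ?thesis unfolding mass_def L2_sq_def
    using integral_split_halves[OF i] repD(3,4)[OF r] by (simp add: set_lebesgue_integral_def cong: HL_integral_cong)
qed

lemma rep_inner:
  assumes r: "rep u v v' w w'" and s: "rep h p p' q q'"
  shows "Re (\<integral>x. u x * cnj (h x) \<partial>lborel) = (\<integral>x. Re (v x * cnj (p x)) \<partial>HL) + (\<integral>x. Re (w x * cnj (q x)) \<partial>HL)"
proof -
  have ci: "integrable HL (\<lambda>x. f x * cnj (g x))" if f: "sqi f" and g: "sqi g" for f g :: "real \<Rightarrow> complex"
  proof -
    have "integrable HL (\<lambda>x. Re (f x * cnj (g x)))" by (rule sqi_inner[OF f g])
    moreover have "integrable HL (\<lambda>x. Im (f x * cnj (g x)))"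
    proof (rule sqi_mult[OF f g, where C = 1])
      have [measurable]: "f \<in> borel_measurable HL" "g \<in> borel_measurable HL" using f g by (auto simp: sqi_def)
      have "(\<lambda>x. Im (f x) * Re (g x) - Re (f x) * Im (g x)) \<in> borel_measurable HL" by measurable
      then show "(\<lambda>x. Im (f x * cnj (g x))) \<in> borel_measurable HL" by (simp add: algebra_simps)
      show "\<bar>Im (f x * cnj (g x))\<bar> \<le> 1 * (cmod (f x) * cmod (g x))" for x
        using abs_Im_le_cmod[of "f x * cnj (g x)"] by (simp add: norm_mult)
    qed
    ultimately have "integrable HL (\<lambda>x. of_real (Re (f x * cnj (g x))) + \<i> * of_real (Im (f x * cnj (g x))))"
      by (intro Bochner_Integration.integrable_add integrable_mult_right integrable_of_real)
    then show ?thesis by (simp only: complex_eq[symmetric])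
  qed
  note c1 = ci[OF H1pairD(2)[OF repD(1)[OF r]] H1pairD(2)[OF repD(1)[OF s]]]
  note c2 = ci[OF H1pairD(2)[OF repD(2)[OF r]] H1pairD(2)[OF repD(2)[OF s]]]
  have i: "integrable HL (\<lambda>x. u x * cnj (h x))" "integrable HL (\<lambda>x. u (- x) * cnj (h (- x)))"
    using c1 c2 repD(3,4)[OF r] repD(3,4)[OF s] by (auto cong: HL_integrable_cong)
  have "(\<integral>x. u x * cnj (h x) \<partial>lborel) = (\<integral>x. v x * cnj (p x) \<partial>HL) + (\<integral>x. w x * cnj (q x) \<partial>HL)"
    using integral_split_halves[OF i] repD(3,4)[OF r] repD(3,4)[OF s] by (simp cong: HL_integral_cong)
  then show ?thesis using integral_Re[OF c1] integral_Re[OF c2] by simp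
qed

lemma rep_AE:
  assumes "rep u v v' w w'"
  shows "AE x in HL. weak_deriv Rminus u (- x) = - v' x" "AE x in HL. weak_deriv Rplus u x = w' x"
  using H1pair_imp_H1_Rminus(2)[of v v' u, OF repD(1)[OF assms] repD(3)[OF assms]]
    H1pair_imp_H1_Rplus(2)[OF repD(2)[OF assms] repD(4)[OF assms]] by auto

lemma rep_L2_sq:
  assumes r: "rep u v v' w w'"
  shows "L2_sq Rminus u = (\<integral>x. (cmod (v x))\<^sup>2 \<partial>HL)" "L2_sq Rplus u = (\<integral>x. (cmod (w x))\<^sup>2 \<partial>HL)"
    "L2_sq Rminus (weak_deriv Rminus u) = (\<integral>x. (cmod (v' x))\<^sup>2 \<partial>HL)"
    "L2_sq Rplus (weak_deriv Rplus u) = (\<integral>x. (cmod (w' x))\<^sup>2 \<partial>HL)"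
proof -
  show "L2_sq Rminus u = (\<integral>x. (cmod (v x))\<^sup>2 \<partial>HL)" "L2_sq Rplus u = (\<integral>x. (cmod (w x))\<^sup>2 \<partial>HL)"
    using repD(3,4)[OF r] by (simp_all add: L2_sq_Rminus L2_sq_Rplus cong: HL_integral_cong)
  have u: "u \<in> H1 Rminus" "u \<in> H1 Rplus"
    using H1pair_imp_H1_Rminus(1)[of v v' u, OF repD(1)[OF r] repD(3)[OF r]]
      H1pair_imp_H1_Rplus(1)[OF repD(2)[OF r] repD(4)[OF r]] by auto
  have e: "L2_on Rminus (weak_deriv Rminus u)" "L2_on Rplus (weak_deriv Rplus u)"
    unfolding weak_deriv_def using u unfolding H1_def by (auto dest!: someI_ex[where P = "\<lambda>g. L2_on _ g \<and> has_weak_deriv _ u g"])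
  then have [measurable]: "(\<lambda>x. weak_deriv Rminus u (- x)) \<in> borel_measurable HL" "weak_deriv Rplus u \<in> borel_measurable HL"
    by (auto simp: L2_on_Rminus_iff L2_on_Rplus_iff sqi_def)
  have [measurable]: "v' \<in> borel_measurable HL" "w' \<in> borel_measurable HL"
    using repD(1,2)[OF r] by (auto simp: H1pair_def sqi_def)
  show "L2_sq Rminus (weak_deriv Rminus u) = (\<integral>x. (cmod (v' x))\<^sup>2 \<partial>HL)"
    unfolding L2_sq_Rminus using rep_AE(1)[OF r] by (intro integral_cong_AE) auto
  show "L2_sq Rplus (weak_deriv Rplus u) = (\<integral>x. (cmod (w' x))\<^sup>2 \<partial>HL)"
    unfolding L2_sq_Rplus using rep_AE(2)[OF r] by (intro integral_cong_AE) auto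
qed

lemma rep_energy:
  assumes r: "rep u v v' w w'"
  shows "energy \<alpha> u = 1/2 * ((\<integral>x. (cmod (v' x))\<^sup>2 \<partial>HL) + (\<integral>x. (cmod (w' x))\<^sup>2 \<partial>HL))
    - 1/6 * ((\<integral>x. cmod (v x) ^ 6 \<partial>HL) + (\<integral>x. cmod (w x) ^ 6 \<partial>HL)) - \<alpha> / 2 * (cmod (v 0))\<^sup>2"
proof -
  have i: "integrable HL (\<lambda>x. cmod (u x) ^ 6)" "integrable HL (\<lambda>x. cmod (u (- x)) ^ 6)"
    using H1pair_integrable_6[OF repD(1)[OF r]] H1pair_integrable_6[OF repD(2)[OF r]] repD(3,4)[OF r]
    by (auto cong: HL_integrable_cong)
  have "(\<integral>x. cmod (u x) ^ 6 \<partial>lborel) = (\<integral>x. cmod (v x) ^ 6 \<partial>HL) + (\<integral>x. cmod (w x) ^ 6 \<partial>HL)"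
    using integral_split_halves[OF i] repD(3,4)[OF r] by (simp cong: HL_integral_cong)
  moreover have "trace_left u = v 0" by (rule trace_left_eq[OF repD(1)[OF r]]) (rule repD(3)[OF r])
  ultimately show ?thesis unfolding energy_def rep_L2_sq[OF r] by simp
qed

lemma rep_H1_norm:
  assumes r: "rep u v v' w w'"
  shows "(H1_norm u)\<^sup>2 = (\<integral>x. (cmod (v x))\<^sup>2 \<partial>HL) + (\<integral>x. (cmod (v' x))\<^sup>2 \<partial>HL)
     + (\<integral>x. (cmod (w x))\<^sup>2 \<partial>HL) + (\<integral>x. (cmod (w' x))\<^sup>2 \<partial>HL)" "0 \<le> H1_norm u"
  unfolding H1_norm_def rep_L2_sq[OF r] by (auto intro!: add_nonneg_nonneg)

section \<open>The differential of the energy\<close>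

lemma HL_integral_abs_le:
  fixes f g :: "real \<Rightarrow> real"
  assumes "integrable HL f" "integrable HL g" "\<And>x. x > 0 \<Longrightarrow> \<bar>f x\<bar> \<le> g x"
  shows "\<bar>\<integral>x. f x \<partial>HL\<bar> \<le> (\<integral>x. g x \<partial>HL)"
proof -
  have "\<bar>\<integral>x. f x \<partial>HL\<bar> \<le> (\<integral>x. \<bar>f x\<bar> \<partial>HL)" by (rule integral_abs_bound)
  also have "\<dots> \<le> (\<integral>x. g x \<partial>HL)"
    using assms by (intro integral_mono) (auto simp: space_restrict_space)
  finally show ?thesis .
qed

text \<open>With a = |z|^2 and d = 2b + c = |z + h|^2 - |z|^2 the remainder is 3a^2 c + 3a d^2 +
  d^3. The bounds a <= K^2, |d| <= 3K|h| and |d| <= 3K^2 give the constant 57 = 3 + 27 + 27.\<close>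

lemma cmod_pow6_expansion:
  fixes z h :: complex
  assumes z: "cmod z \<le> K" and h: "cmod h \<le> K"
  shows "\<bar>cmod (z + h) ^ 6 - cmod z ^ 6 - 6 * (cmod z ^ 4 * Re (z * cnj h))\<bar> \<le> 57 * K ^ 4 * (cmod h)\<^sup>2"
proof -
  define a b c where "a = (cmod z)\<^sup>2" and "b = Re (z * cnj h)" and "c = (cmod h)\<^sup>2"
  define d where "d = 2 * b + c"
  have K: "0 \<le> K" using z norm_ge_zero[of z] by linarith
  have s: "(cmod (z + h))\<^sup>2 = a + d"
    unfolding a_def b_def c_def d_def cmod_power2 by (simp add: power2_eq_square algebra_simps)
  have a: "0 \<le> a" "a \<le> K\<^sup>2" using z by (auto simp: a_def intro: power_mono)
  have c: "0 \<le> c" "c \<le> K\<^sup>2" using h by (auto simp: c_def intro: power_mono)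
  have bd: "\<bar>b\<bar> \<le> K * cmod h"
  proof -
    have "\<bar>b\<bar> \<le> cmod (z * cnj h)" unfolding b_def by (rule abs_Re_le_cmod)
    also have "\<dots> \<le> K * cmod h" using z by (simp add: norm_mult mult_right_mono)
    finally show ?thesis .
  qed
  have cb: "c \<le> K * cmod h" using h by (simp add: c_def power2_eq_square mult_right_mono)
  have d: "\<bar>d\<bar> \<le> 3 * (K * cmod h)" using bd cb c(1) unfolding d_def by linarith
  have "3 * (K * cmod h) \<le> 3 * (K * K)" using h K by (simp add: mult_left_mono)
  then have d': "\<bar>d\<bar> \<le> 3 * K\<^sup>2" using d by (simp add: power2_eq_square)
  have dd: "d\<^sup>2 \<le> 9 * K\<^sup>2 * c"
  proof -
    have "\<bar>d\<bar>\<^sup>2 \<le> (3 * (K * cmod h))\<^sup>2" by (rule power_mono[OF d]) simp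
    then show ?thesis by (simp add: c_def power_mult_distrib)
  qed
  have e: "cmod (z + h) ^ 6 - cmod z ^ 6 - 6 * (cmod z ^ 4 * Re (z * cnj h)) = 3 * a\<^sup>2 * c + 3 * a * d\<^sup>2 + d ^ 3"
  proof -
    have "cmod (z + h) ^ 6 = ((cmod (z + h))\<^sup>2) ^ 3" "cmod z ^ 6 = a ^ 3" "cmod z ^ 4 = a\<^sup>2"
      by (simp_all add: a_def flip: power_mult)
    then show ?thesis unfolding s b_def[symmetric] by (simp add: d_def power2_eq_square power3_eq_cube algebra_simps)
  qed
  have t1: "a\<^sup>2 * c \<le> K ^ 4 * c"
  proof -
    have "a\<^sup>2 \<le> (K\<^sup>2)\<^sup>2" using a by (intro power_mono)
    then show ?thesis using c by (intro mult_right_mono) (auto simp flip: power_mult)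
  qed
  have t2: "a * d\<^sup>2 \<le> K\<^sup>2 * (9 * K\<^sup>2 * c)" using a dd by (intro mult_mono) auto
  have t3: "\<bar>d ^ 3\<bar> \<le> 3 * K\<^sup>2 * (9 * K\<^sup>2 * c)"
  proof -
    have "\<bar>d ^ 3\<bar> = \<bar>d\<bar> * d\<^sup>2" by (simp add: power3_eq_cube power2_eq_square abs_mult)
    also have "\<dots> \<le> 3 * K\<^sup>2 * (9 * K\<^sup>2 * c)" using d' dd by (intro mult_mono) auto
    finally show ?thesis .
  qed
  have K4: "K\<^sup>2 * (9 * K\<^sup>2 * c) = 9 * (K ^ 4 * c)" "3 * K\<^sup>2 * (9 * K\<^sup>2 * c) = 27 * (K ^ 4 * c)"
    by (simp_all add: power2_eq_square power4_eq_xxxx)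
  have "0 \<le> a\<^sup>2 * c" "0 \<le> a * d\<^sup>2" using a c by auto
  then have "\<bar>3 * a\<^sup>2 * c + 3 * a * d\<^sup>2 + d ^ 3\<bar> \<le> 57 * (K ^ 4 * c)"
    using t1 t2 t3 unfolding K4 by (simp only: abs_le_iff mult.assoc) linarith
  then show ?thesis unfolding e c_def by (simp add: mult.assoc)
qed

lemma pow4_inner_integrable:
  assumes v: "H1pair v v'" and p: "sqi p"
  shows "integrable HL (\<lambda>x. cmod (v x) ^ 4 * Re (v x * cnj (p x)))"
proof -
  obtain B where B: "B \<ge> 0" "\<And>x. 0 \<le> x \<Longrightarrow> cmod (v x) \<le> B" using H1pair_bounded[OF v] by blast
  have m[measurable]: "v \<in> borel_measurable HL" using v by (auto simp: H1pair_def sqi_def)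
  have [measurable]: "(\<lambda>x. Re (v x * cnj (p x))) \<in> borel_measurable HL"
    using sqi_inner[OF H1pairD(2)[OF v] p] by auto
  show ?thesis
  proof (rule sqi_mult[OF H1pairD(2)[OF v] p, where C = "B ^ 4"])
    fix x :: real assume "0 < x"
    then have "cmod (v x) ^ 4 \<le> B ^ 4" by (intro power_mono B) auto
    moreover have "\<bar>Re (v x * cnj (p x))\<bar> \<le> cmod (v x) * cmod (p x)"
      using abs_Re_le_cmod[of "v x * cnj (p x)"] by (simp add: norm_mult)
    ultimately have "cmod (v x) ^ 4 * \<bar>Re (v x * cnj (p x))\<bar> \<le> B ^ 4 * (cmod (v x) * cmod (p x))"
      by (intro mult_mono) auto
    then show "\<bar>cmod (v x) ^ 4 * Re (v x * cnj (p x))\<bar> \<le> B ^ 4 * (cmod (v x) * cmod (p x))"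
      by (simp only: abs_mult) (simp only: abs_of_nonneg zero_le_power norm_ge_zero)
  qed measurable
qed

lemma pow6_expansion_integral:
  assumes v: "H1pair v v'" and p: "H1pair p p'"
    and K: "\<And>x. 0 \<le> x \<Longrightarrow> cmod (v x) \<le> K" "\<And>x. 0 \<le> x \<Longrightarrow> cmod (p x) \<le> K"
  shows "\<bar>(\<integral>x. cmod (v x + p x) ^ 6 \<partial>HL) - (\<integral>x. cmod (v x) ^ 6 \<partial>HL)
    - 6 * (\<integral>x. cmod (v x) ^ 4 * Re (v x * cnj (p x)) \<partial>HL)\<bar> \<le> 57 * K ^ 4 * (\<integral>x. (cmod (p x))\<^sup>2 \<partial>HL)"
proof -
  have i1: "integrable HL (\<lambda>x. cmod (v x + p x) ^ 6)" by (rule H1pair_integrable_6[OF H1pair_add[OF v p]])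
  have i2: "integrable HL (\<lambda>x. cmod (v x) ^ 6)" by (rule H1pair_integrable_6[OF v])
  have i3: "integrable HL (\<lambda>x. 6 * (cmod (v x) ^ 4 * Re (v x * cnj (p x))))"
    by (rule integrable_mult_right[OF pow4_inner_integrable[OF v H1pairD(2)[OF p]]])
  have i4: "integrable HL (\<lambda>x. 57 * K ^ 4 * (cmod (p x))\<^sup>2)"
    by (rule integrable_mult_right[OF sqi_integrable[OF H1pairD(2)[OF p]]])
  have "\<bar>\<integral>x. cmod (v x + p x) ^ 6 - cmod (v x) ^ 6 - 6 * (cmod (v x) ^ 4 * Re (v x * cnj (p x))) \<partial>HL\<bar>
      \<le> (\<integral>x. 57 * K ^ 4 * (cmod (p x))\<^sup>2 \<partial>HL)"
    using i1 i2 i3 i4 K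
    by (intro HL_integral_abs_le Bochner_Integration.integrable_diff cmod_pow6_expansion) auto
  then show ?thesis using i1 i2 i3 by (simp del: times_complex.sel cnj.sel)
qed

text \<open>First variation of 1/2 int |v'|^2 - 1/6 int |v|^6 in the direction p.\<close>

definition half_diff :: "(real \<Rightarrow> complex) \<Rightarrow> (real \<Rightarrow> complex) \<Rightarrow> (real \<Rightarrow> complex) \<Rightarrow> (real \<Rightarrow> complex) \<Rightarrow> real" where
  "half_diff v v' p p' = (\<integral>x. Re (v' x * cnj (p' x)) \<partial>HL) - (\<integral>x. cmod (v x) ^ 4 * Re (v x * cnj (p x)) \<partial>HL)"

lemma half_diff_add:
  assumes v: "H1pair v v'" and "H1pair p p'" "H1pair q q'"
  shows "half_diff v v' (\<lambda>x. p x + q x) (\<lambda>x. p' x + q' x) = half_diff v v' p p' + half_diff v v' q q'"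
proof -
  note i = sqi_inner[OF H1pairD(3)[OF v] H1pairD(3)[OF assms(2)]] sqi_inner[OF H1pairD(3)[OF v] H1pairD(3)[OF assms(3)]]
    pow4_inner_integrable[OF v H1pairD(2)[OF assms(2)]] pow4_inner_integrable[OF v H1pairD(2)[OF assms(3)]]
  have "(\<lambda>x. Re (v' x * cnj (p' x + q' x))) = (\<lambda>x. Re (v' x * cnj (p' x)) + Re (v' x * cnj (q' x)))"
    "(\<lambda>x. cmod (v x) ^ 4 * Re (v x * cnj (p x + q x))) = (\<lambda>x. cmod (v x) ^ 4 * Re (v x * cnj (p x)) + cmod (v x) ^ 4 * Re (v x * cnj (q x)))"
    by (auto simp: algebra_simps)
  then show ?thesis unfolding half_diff_def using i by (simp del: times_complex.sel cnj.sel)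
qed

lemma half_diff_scaleR: "half_diff v v' (\<lambda>x. c *\<^sub>R p x) (\<lambda>x. c *\<^sub>R p' x) = c * half_diff v v' p p'"
proof -
  have "(\<lambda>x. Re (v' x * cnj (c *\<^sub>R p' x))) = (\<lambda>x. c * Re (v' x * cnj (p' x)))"
    "(\<lambda>x. cmod (v x) ^ 4 * Re (v x * cnj (c *\<^sub>R p x))) = (\<lambda>x. c * (cmod (v x) ^ 4 * Re (v x * cnj (p x))))"
    by (auto simp: algebra_simps)
  then show ?thesis unfolding half_diff_def by (simp add: right_diff_distrib del: times_complex.sel cnj.sel)
qed

text \<open>A bound that is affine in the squared norm needs only ab <= a^2 + b^2; homogeneity in
  the test function later turns it into a bound by the norm itself.\<close>

lemma half_diff_bound:
  assumes v: "H1pair v v'"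
  obtains A where "A \<ge> 0" "\<And>p p'. H1pair p p' \<Longrightarrow>
    \<bar>half_diff v v' p p'\<bar> \<le> A * (1 + ((\<integral>x. (cmod (p x))\<^sup>2 \<partial>HL) + (\<integral>x. (cmod (p' x))\<^sup>2 \<partial>HL)))"
proof -
  obtain B where B: "B \<ge> 0" "\<And>x. 0 \<le> x \<Longrightarrow> cmod (v x) \<le> B" using H1pair_bounded[OF v] by blast
  define I1 where "I1 = (\<integral>x. (cmod (v x))\<^sup>2 \<partial>HL)"
  define I2 where "I2 = (\<integral>x. (cmod (v' x))\<^sup>2 \<partial>HL)"
  have I: "I1 \<ge> 0" "I2 \<ge> 0" by (auto simp: I1_def I2_def)
  have ip: "\<bar>Re (z * cnj y)\<bar> \<le> (cmod z)\<^sup>2 + (cmod y)\<^sup>2" for z y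
  proof -
    have "\<bar>Re (z * cnj y)\<bar> \<le> cmod z * cmod y" using abs_Re_le_cmod[of "z * cnj y"] by (simp add: norm_mult)
    then show ?thesis using sum_squares_bound[of "cmod z" "cmod y"] mult_nonneg_nonneg[of "cmod z" "cmod y"] by simp
  qed
  show thesis
  proof (rule that[of "(1 + B ^ 4) * (1 + I1 + I2)"])
    show "0 \<le> (1 + B ^ 4) * (1 + I1 + I2)" using B I by simp
    fix p p' assume p: "H1pair p p'"
    define J1 where "J1 = (\<integral>x. (cmod (p x))\<^sup>2 \<partial>HL)"
    define J2 where "J2 = (\<integral>x. (cmod (p' x))\<^sup>2 \<partial>HL)"
    have J: "J1 \<ge> 0" "J2 \<ge> 0" by (auto simp: J1_def J2_def)
    note i = sqi_integrable[OF H1pairD(2)[OF v]] sqi_integrable[OF H1pairD(3)[OF v]]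
      sqi_integrable[OF H1pairD(2)[OF p]] sqi_integrable[OF H1pairD(3)[OF p]]
    have "\<bar>\<integral>x. Re (v' x * cnj (p' x)) \<partial>HL\<bar> \<le> (\<integral>x. (cmod (v' x))\<^sup>2 + (cmod (p' x))\<^sup>2 \<partial>HL)"
      by (intro HL_integral_abs_le ip sqi_inner[OF H1pairD(3)[OF v] H1pairD(3)[OF p]] Bochner_Integration.integrable_add i)
    then have b1: "\<bar>\<integral>x. Re (v' x * cnj (p' x)) \<partial>HL\<bar> \<le> I2 + J2" using i by (simp add: I2_def J2_def)
    have "\<bar>\<integral>x. cmod (v x) ^ 4 * Re (v x * cnj (p x)) \<partial>HL\<bar> \<le> (\<integral>x. B ^ 4 * ((cmod (v x))\<^sup>2 + (cmod (p x))\<^sup>2) \<partial>HL)"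
    proof (rule HL_integral_abs_le)
      fix x :: real assume "x > 0"
      then have "cmod (v x) ^ 4 * \<bar>Re (v x * cnj (p x))\<bar> \<le> B ^ 4 * ((cmod (v x))\<^sup>2 + (cmod (p x))\<^sup>2)"
        using B by (intro mult_mono ip power_mono) auto
      then show "\<bar>cmod (v x) ^ 4 * Re (v x * cnj (p x))\<bar> \<le> B ^ 4 * ((cmod (v x))\<^sup>2 + (cmod (p x))\<^sup>2)"
        by (simp only: abs_mult) (simp only: abs_of_nonneg zero_le_power norm_ge_zero)
    qed (intro pow4_inner_integrable[OF v H1pairD(2)[OF p]] integrable_mult_right Bochner_Integration.integrable_add i)+
    then have b2: "\<bar>\<integral>x. cmod (v x) ^ 4 * Re (v x * cnj (p x)) \<partial>HL\<bar> \<le> B ^ 4 * (I1 + J1)"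
      using i by (simp add: I1_def J1_def del: times_complex.sel cnj.sel)
    have m: "B ^ 4 \<ge> 0" using B by simp
    have "\<bar>half_diff v v' p p'\<bar> \<le> (I2 + J2) + B ^ 4 * (I1 + J1)" unfolding half_diff_def using b1 b2 by linarith
    also have "\<dots> \<le> (1 + B ^ 4) * (I2 + J2) + (1 + B ^ 4) * (I1 + J1)"
      using m I J by (intro add_mono) (auto simp: algebra_simps)
    also have "\<dots> = (1 + B ^ 4) * (I1 + I2 + (J1 + J2))" by (simp add: algebra_simps)
    also have "\<dots> \<le> (1 + B ^ 4) * ((1 + I1 + I2) * (1 + (J1 + J2)))"
    proof (rule mult_left_mono)
      have "0 \<le> (I1 + I2) * (J1 + J2)" using I J by simp
      then show "I1 + I2 + (J1 + J2) \<le> (1 + I1 + I2) * (1 + (J1 + J2))" by (simp add: algebra_simps)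
    qed (use m in simp)
    finally show "\<bar>half_diff v v' p p'\<bar> \<le> (1 + B ^ 4) * (1 + I1 + I2) * (1 + ((\<integral>x. (cmod (p x))\<^sup>2 \<partial>HL) + (\<integral>x. (cmod (p' x))\<^sup>2 \<partial>HL)))"
      by (simp add: J1_def J2_def mult.assoc)
  qed
qed

text \<open>Agreement on the open half-line forces equal traces, hence equal primitives and almost
  everywhere equal derivatives.\<close>

lemma half_diff_cong_AE:
  assumes v: "H1pair v v'" and "H1pair p p'" "H1pair q q'" "\<And>x. x > 0 \<Longrightarrow> p x = q x"
  shows "half_diff v v' p p' = half_diff v v' q q'"
proof -
  have "p 0 = q 0" using trace_right_eq[OF assms(2), of p] trace_right_eq[OF assms(3), of p] assms(4) by simp
  then have "\<And>x. 0 \<le> x \<Longrightarrow> p x = q x" using assms(4) by (metis order_le_less)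
  then have "prim q p'" using prim_cong[OF H1pairD(1)[OF assms(2)]] by blast
  then have ae: "AE x in HL. p' x = q' x"
    using prim_unique[OF _ H1pairD(1)[OF assms(3)]] by (simp add: HL_AE_iff)
  have "(\<integral>x. Re (v' x * cnj (p' x)) \<partial>HL) = (\<integral>x. Re (v' x * cnj (q' x)) \<partial>HL)"
    using ae sqi_inner[OF H1pairD(3)[OF v] H1pairD(3)[OF assms(2)]] sqi_inner[OF H1pairD(3)[OF v] H1pairD(3)[OF assms(3)]]
    by (intro integral_cong_AE) (auto simp del: times_complex.sel cnj.sel elim!: eventually_mono)
  moreover have "(\<integral>x. cmod (v x) ^ 4 * Re (v x * cnj (p x)) \<partial>HL) = (\<integral>x. cmod (v x) ^ 4 * Re (v x * cnj (q x)) \<partial>HL)"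
    using assms(4) by (intro HL_integral_cong) simp
  ultimately show ?thesis by (simp add: half_diff_def)
qed

definition energy_diff where
  "energy_diff \<alpha> v v' w w' p p' q q' = half_diff v v' p p' + half_diff w w' q q' - \<alpha> * Re (v 0 * cnj (p 0))"

text \<open>The differential as a functional on functions: its value does not depend on the pair of
  half-line functions that represents the argument.\<close>

definition energy_functional where
  "energy_functional \<alpha> v v' w w' \<eta> = (SOME e. \<exists>p p' q q'. rep \<eta> p p' q q' \<and> e = energy_diff \<alpha> v v' w w' p p' q q')"

lemma energy_functional_eq:
  assumes u: "rep u v v' w w'" and h: "rep \<eta> p p' q q'"
  shows "energy_functional \<alpha> v v' w w' \<eta> = energy_diff \<alpha> v v' w w' p p' q q'"
proof -
  have "energy_diff \<alpha> v v' w w' a a' b b' = energy_diff \<alpha> v v' w w' p p' q q'" if r: "rep \<eta> a a' b b'" for a a' b b'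
  proof -
    have e: "\<And>x. x > 0 \<Longrightarrow> a x = p x" "\<And>x. x > 0 \<Longrightarrow> b x = q x"
      using repD(3,4)[OF r] repD(3,4)[OF h] by auto
    have "a 0 = p 0" using trace_right_eq[OF repD(1)[OF r], of a] trace_right_eq[OF repD(1)[OF h], of a] e by simp
    then show ?thesis
      using half_diff_cong_AE[OF repD(1)[OF u] repD(1)[OF r] repD(1)[OF h] e(1)]
        half_diff_cong_AE[OF repD(2)[OF u] repD(2)[OF r] repD(2)[OF h] e(2)] by (simp add: energy_diff_def)
  qed
  then show ?thesis unfolding energy_functional_def using h by (intro some_equality) blast+
qed

lemma Dspace_rep:
  assumes "u \<in> Dspace \<tau>" obtains v v' w w' where "rep u v v' w w'" "w 0 = of_real \<tau> * v 0"
proof -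
  have "u \<in> H1 Rminus" "u \<in> H1 Rplus" using assms by (auto simp: Dspace_def)
  then obtain v v' w w' where r: "rep u v v' w w'" by (rule rep_exists)
  then show thesis using assms that rep_Dspace[OF r] by blast
qed

lemma Dspace_scaleR:
  assumes "\<eta> \<in> Dspace \<tau>" shows "(\<lambda>x. c *\<^sub>R \<eta> x) \<in> Dspace \<tau>"
proof -
  obtain p p' q q' where h: "rep \<eta> p p' q q'" "q 0 = of_real \<tau> * p 0" by (rule Dspace_rep[OF assms])
  show ?thesis unfolding rep_Dspace[OF rep_scaleR[OF h(1)]] h(2) by simp
qed

lemma H1_norm_nonneg:
  assumes "\<eta> \<in> Dspace \<tau>" shows "0 \<le> H1_norm \<eta>"
proof -
  obtain p p' q q' where h: "rep \<eta> p p' q q'" and "q 0 = of_real \<tau> * p 0" by (rule Dspace_rep[OF assms])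
  show ?thesis by (rule rep_H1_norm(2)[OF h])
qed

lemma H1_norm_scaleR:
  assumes "\<eta> \<in> Dspace \<tau>" shows "H1_norm (\<lambda>x. c *\<^sub>R \<eta> x) = \<bar>c\<bar> * H1_norm \<eta>"
proof -
  obtain p p' q q' where h: "rep \<eta> p p' q q'" and "q 0 = of_real \<tau> * p 0" by (rule Dspace_rep[OF assms])
  have "(H1_norm (\<lambda>x. c *\<^sub>R \<eta> x))\<^sup>2 = (\<bar>c\<bar> * H1_norm \<eta>)\<^sup>2"
    unfolding power_mult_distrib rep_H1_norm(1)[OF h] rep_H1_norm(1)[OF rep_scaleR[OF h, of c]]
    by (simp only: norm_scaleR power_mult_distrib integral_mult_right_zero distrib_left)
  then show ?thesis
    using rep_H1_norm(2)[OF h] rep_H1_norm(2)[OF rep_scaleR[OF h, of c]] power2_eq_iff_nonneg by (meson abs_ge_zero mult_nonneg_nonneg)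
qed

text \<open>Choose s = 1/N. If N = 0, the left side grows with s while the right side stays A, so L
  = 0.\<close>

lemma homogeneous_bound:
  fixes L N A :: real
  assumes "\<And>s. \<bar>s * L\<bar> \<le> A * (1 + s\<^sup>2 * N\<^sup>2)" "0 \<le> N" "0 \<le> A"
  shows "\<bar>L\<bar> \<le> 2 * A * N"
proof (cases "N = 0")
  case True
  have "L = 0"
  proof (rule ccontr)
    assume "L \<noteq> 0"
    then show False using assms(1)[of "(A + 1) / \<bar>L\<bar>"] assms(3) True by (simp add: abs_mult)
  qed
  then show ?thesis using True by simp
next
  case False
  then show ?thesis using assms(1)[of "1 / N"] assms(2) by (simp add: abs_mult field_simps power2_eq_square)
qed

lemma energy_functional_bounded_linear:
  assumes u: "rep u v v' w w'"
  shows "bounded_real_linear_on_D \<tau> (energy_functional \<alpha> v v' w w')"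
proof -
  let ?L = "energy_functional \<alpha> v v' w w'"
  have add: "?L (\<lambda>x. \<eta> x + \<zeta> x) = ?L \<eta> + ?L \<zeta>" if hD: "\<eta> \<in> Dspace \<tau>" "\<zeta> \<in> Dspace \<tau>" for \<eta> \<zeta>
  proof -
    obtain p p' q q' where h: "rep \<eta> p p' q q'" and "q 0 = of_real \<tau> * p 0" by (rule Dspace_rep[OF hD(1)])
    obtain a a' b b' where k: "rep \<zeta> a a' b b'" and "b 0 = of_real \<tau> * a 0" by (rule Dspace_rep[OF hD(2)])
    show ?thesis
      unfolding energy_functional_eq[OF u h] energy_functional_eq[OF u k] energy_functional_eq[OF u rep_add[OF h k]]
        energy_diff_def half_diff_add[OF repD(1)[OF u] repD(1)[OF h] repD(1)[OF k]] half_diff_add[OF repD(2)[OF u] repD(2)[OF h] repD(2)[OF k]]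
      by (simp add: algebra_simps)
  qed
  have scale: "?L (\<lambda>x. c *\<^sub>R \<eta> x) = c * ?L \<eta>" if hD: "\<eta> \<in> Dspace \<tau>" for \<eta> c
  proof -
    obtain p p' q q' where h: "rep \<eta> p p' q q'" and "q 0 = of_real \<tau> * p 0" by (rule Dspace_rep[OF hD(1)])
    show ?thesis
      unfolding energy_functional_eq[OF u h] energy_functional_eq[OF u rep_scaleR[OF h]] energy_diff_def half_diff_scaleR
      by (simp add: algebra_simps)
  qed
  obtain A1 where A1: "A1 \<ge> 0" "\<And>p p'. H1pair p p' \<Longrightarrow>
    \<bar>half_diff v v' p p'\<bar> \<le> A1 * (1 + ((\<integral>x. (cmod (p x))\<^sup>2 \<partial>HL) + (\<integral>x. (cmod (p' x))\<^sup>2 \<partial>HL)))"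
    using half_diff_bound[OF repD(1)[OF u]] by blast
  obtain A2 where A2: "A2 \<ge> 0" "\<And>p p'. H1pair p p' \<Longrightarrow>
    \<bar>half_diff w w' p p'\<bar> \<le> A2 * (1 + ((\<integral>x. (cmod (p x))\<^sup>2 \<partial>HL) + (\<integral>x. (cmod (p' x))\<^sup>2 \<partial>HL)))"
    using half_diff_bound[OF repD(2)[OF u]] by blast
  \<comment> \<open>The factor 1 + |v 0|^2 comes from |v 0||p 0| <= (1 + |v 0|^2)(1 + |p 0|^2),
    where |p 0|^2 is at most the squared norm of the test function.\<close>
  define A where "A = A1 + A2 + \<bar>\<alpha>\<bar> * (1 + (cmod (v 0))\<^sup>2)"
  have A: "A \<ge> 0" using A1 A2 by (simp add: A_def)
  have bd: "\<bar>?L \<eta>\<bar> \<le> A * (1 + (H1_norm \<eta>)\<^sup>2)" if hD: "\<eta> \<in> Dspace \<tau>" for \<eta>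
  proof -
    obtain p p' q q' where h: "rep \<eta> p p' q q'" and "q 0 = of_real \<tau> * p 0" by (rule Dspace_rep[OF hD(1)])
    let ?N = "(H1_norm \<eta>)\<^sup>2"
    have n: "(\<integral>x. (cmod (p x))\<^sup>2 \<partial>HL) \<ge> 0" "(\<integral>x. (cmod (p' x))\<^sup>2 \<partial>HL) \<ge> 0"
      "(\<integral>x. (cmod (q x))\<^sup>2 \<partial>HL) \<ge> 0" "(\<integral>x. (cmod (q' x))\<^sup>2 \<partial>HL) \<ge> 0" by auto
    have "\<bar>half_diff v v' p p'\<bar> \<le> A1 * (1 + ?N)"
      by (rule order_trans[OF A1(2)[OF repD(1)[OF h]]]) (use A1(1) n in \<open>auto simp: rep_H1_norm(1)[OF h] intro!: mult_left_mono\<close>)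
    moreover have "\<bar>half_diff w w' q q'\<bar> \<le> A2 * (1 + ?N)"
      by (rule order_trans[OF A2(2)[OF repD(2)[OF h]]]) (use A2(1) n in \<open>auto simp: rep_H1_norm(1)[OF h] intro!: mult_left_mono\<close>)
    moreover have "\<bar>\<alpha> * Re (v 0 * cnj (p 0))\<bar> \<le> \<bar>\<alpha>\<bar> * (1 + (cmod (v 0))\<^sup>2) * (1 + ?N)"
    proof -
      have "\<bar>Re (v 0 * cnj (p 0))\<bar> \<le> cmod (v 0) * cmod (p 0)" using abs_Re_le_cmod[of "v 0 * cnj (p 0)"] by (simp add: norm_mult)
      also have "\<dots> \<le> (1 + (cmod (v 0))\<^sup>2) * (1 + (cmod (p 0))\<^sup>2)"
      proof -
        have le: "x \<le> 1 + x\<^sup>2" for x :: real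
        proof -
          have "0 \<le> (2 * x - 1)\<^sup>2" by simp
          then show ?thesis by (simp add: power2_eq_square algebra_simps)
        qed
        show ?thesis by (intro mult_mono le) auto
      qed
      also have "\<dots> \<le> (1 + (cmod (v 0))\<^sup>2) * (1 + ?N)"
      proof (intro mult_left_mono)
        show "1 + (cmod (p 0))\<^sup>2 \<le> 1 + ?N"
          unfolding rep_H1_norm(1)[OF h] using H1pair_bound[OF repD(1)[OF h], of 0] n by linarith
      qed simp
      finally show ?thesis unfolding abs_mult mult.assoc by (intro mult_left_mono) auto
    qed
    ultimately have "\<bar>energy_diff \<alpha> v v' w w' p p' q q'\<bar> \<le> A1 * (1 + ?N) + A2 * (1 + ?N) + \<bar>\<alpha>\<bar> * (1 + (cmod (v 0))\<^sup>2) * (1 + ?N)"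
      unfolding energy_diff_def by linarith
    also have "\<dots> = A * (1 + ?N)" by (simp add: A_def algebra_simps)
    finally show ?thesis unfolding energy_functional_eq[OF u h] .
  qed
  have "\<bar>?L \<eta>\<bar> \<le> 2 * A * H1_norm \<eta>" if hD: "\<eta> \<in> Dspace \<tau>" for \<eta>
  proof (rule homogeneous_bound)
    show "\<bar>s * ?L \<eta>\<bar> \<le> A * (1 + s\<^sup>2 * (H1_norm \<eta>)\<^sup>2)" for s
      using bd[OF Dspace_scaleR[OF hD, of s]] by (simp add: scale[OF hD] H1_norm_scaleR[OF hD] power_mult_distrib)
    show "0 \<le> H1_norm \<eta>" by (rule H1_norm_nonneg[OF hD])
  qed (rule A)
  then show ?thesis unfolding bounded_real_linear_on_D_def using add scale by blast
qed

lemma energy_has_differential: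
  assumes u: "rep u v v' w w'"
  shows "has_differential_on_D \<tau> (energy \<alpha>) (energy_functional \<alpha> v v' w w') u"
  unfolding has_differential_on_D_def
proof (intro conjI energy_functional_bounded_linear[OF u] allI impI)
  fix \<epsilon> :: real assume \<epsilon>: "\<epsilon> > 0"
  obtain B1 where B1: "B1 \<ge> 0" "\<And>x. 0 \<le> x \<Longrightarrow> cmod (v x) \<le> B1" using H1pair_bounded[OF repD(1)[OF u]] by blast
  obtain B2 where B2: "B2 \<ge> 0" "\<And>x. 0 \<le> x \<Longrightarrow> cmod (w x) \<le> B2" using H1pair_bounded[OF repD(2)[OF u]] by blast
  \<comment> \<open>K bounds both halves of u and, being at least 1, also every perturbation of norm
    below 1, since the supremum is bounded by the norm.\<close>
  define K where "K = max 1 (max B1 B2)"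
  \<comment> \<open>The three summands bound the quadratic remainders of the kinetic, the sextic and
    the trace term.\<close>
  define C where "C = 1/2 + 57 * K ^ 4 + \<bar>\<alpha>\<bar>"
  have K4: "K ^ 4 \<ge> 0" by (simp add: K_def)
  have C: "C > 0" using K4 unfolding C_def by linarith
  \<comment> \<open>The bound 1 validates K for the perturbation; the bound \<epsilon> / C turns the
    remainder C N^2 into \<epsilon> N.\<close>
  define \<delta> where "\<delta> = min 1 (\<epsilon> / C)"
  have \<delta>: "\<delta> > 0" using C \<epsilon> by (simp add: \<delta>_def)
  show "\<exists>\<delta>>0. \<forall>h\<in>Dspace \<tau>. H1_norm h < \<delta> \<longrightarrow>
    \<bar>energy \<alpha> (\<lambda>x. u x + h x) - energy \<alpha> u - energy_functional \<alpha> v v' w w' h\<bar> \<le> \<epsilon> * H1_norm h"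
  proof (intro exI[of _ \<delta>] conjI \<delta> ballI impI)
    fix h assume hD: "h \<in> Dspace \<tau>" and hn: "H1_norm h < \<delta>"
    obtain p p' q q' where h: "rep h p p' q q'" and "q 0 = of_real \<tau> * p 0" by (rule Dspace_rep[OF hD])
    define N where "N = H1_norm h"
    have N0: "0 \<le> N" unfolding N_def by (rule rep_H1_norm(2)[OF h])
    have n: "(\<integral>x. (cmod (p x))\<^sup>2 \<partial>HL) \<ge> 0" "(\<integral>x. (cmod (p' x))\<^sup>2 \<partial>HL) \<ge> 0"
      "(\<integral>x. (cmod (q x))\<^sup>2 \<partial>HL) \<ge> 0" "(\<integral>x. (cmod (q' x))\<^sup>2 \<partial>HL) \<ge> 0" by auto
    note N2 = rep_H1_norm(1)[OF h, folded N_def]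
    have "N < 1" "N \<le> \<epsilon> / C" using hn unfolding N_def \<delta>_def by auto
    have le1: "z \<le> 1" if "z\<^sup>2 \<le> N\<^sup>2" for z
      using power2_le_imp_le[OF that N0] \<open>N < 1\<close> by linarith
    have pK: "cmod (p x) \<le> K" "cmod (q x) \<le> K" "cmod (v x) \<le> K" "cmod (w x) \<le> K" if "0 \<le> x" for x
    proof -
      have "cmod (p x) \<le> 1" "cmod (q x) \<le> 1"
        using H1pair_bound[OF repD(1)[OF h] that] H1pair_bound[OF repD(2)[OF h] that] n
        by (intro le1; unfold N2; linarith)+
      then show "cmod (p x) \<le> K" "cmod (q x) \<le> K" "cmod (v x) \<le> K" "cmod (w x) \<le> K"
        using B1(2)[OF that] B2(2)[OF that] unfolding K_def by linarith+
    qed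
    have p0: "(cmod (p 0))\<^sup>2 \<le> N\<^sup>2" unfolding N2 using H1pair_bound[OF repD(1)[OF h], of 0] n by linarith
    have kin: "(\<integral>x. (cmod (a x + b x))\<^sup>2 \<partial>HL) = (\<integral>x. (cmod (a x))\<^sup>2 \<partial>HL) + 2 * (\<integral>x. Re (a x * cnj (b x)) \<partial>HL) + (\<integral>x. (cmod (b x))\<^sup>2 \<partial>HL)"
      if ab: "sqi a" "sqi b" for a b :: "real \<Rightarrow> complex"
    proof -
      have "(cmod (a x + b x))\<^sup>2 = (cmod (a x))\<^sup>2 + 2 * Re (a x * cnj (b x)) + (cmod (b x))\<^sup>2" for x
        unfolding cmod_power2 by (simp add: power2_eq_square algebra_simps)
      then show ?thesis using sqi_integrable[OF ab(1)] sqi_integrable[OF ab(2)] sqi_inner[OF ab] by (simp del: times_complex.sel cnj.sel)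
    qed
    have x1: "\<bar>(\<integral>x. cmod (v x + p x) ^ 6 \<partial>HL) - (\<integral>x. cmod (v x) ^ 6 \<partial>HL)
       - 6 * (\<integral>x. cmod (v x) ^ 4 * Re (v x * cnj (p x)) \<partial>HL)\<bar> \<le> 57 * K ^ 4 * (\<integral>x. (cmod (p x))\<^sup>2 \<partial>HL)"
      by (rule pow6_expansion_integral[OF repD(1)[OF u] repD(1)[OF h]]) (use pK in auto)
    have x2: "\<bar>(\<integral>x. cmod (w x + q x) ^ 6 \<partial>HL) - (\<integral>x. cmod (w x) ^ 6 \<partial>HL)
       - 6 * (\<integral>x. cmod (w x) ^ 4 * Re (w x * cnj (q x)) \<partial>HL)\<bar> \<le> 57 * K ^ 4 * (\<integral>x. (cmod (q x))\<^sup>2 \<partial>HL)"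
      by (rule pow6_expansion_integral[OF repD(2)[OF u] repD(2)[OF h]]) (use pK in auto)
    have z0: "(cmod (v 0 + p 0))\<^sup>2 = (cmod (v 0))\<^sup>2 + 2 * Re (v 0 * cnj (p 0)) + (cmod (p 0))\<^sup>2"
      unfolding cmod_power2 by (simp add: power2_eq_square algebra_simps)
    define X where "X = (\<integral>x. (cmod (p x))\<^sup>2 \<partial>HL) + (\<integral>x. (cmod (q x))\<^sup>2 \<partial>HL)"
    define Y where "Y = (\<integral>x. (cmod (p' x))\<^sup>2 \<partial>HL) + (\<integral>x. (cmod (q' x))\<^sup>2 \<partial>HL)"
    define R1 where "R1 = (\<integral>x. cmod (v x + p x) ^ 6 \<partial>HL) - (\<integral>x. cmod (v x) ^ 6 \<partial>HL)
       - 6 * (\<integral>x. cmod (v x) ^ 4 * Re (v x * cnj (p x)) \<partial>HL)"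
    define R2 where "R2 = (\<integral>x. cmod (w x + q x) ^ 6 \<partial>HL) - (\<integral>x. cmod (w x) ^ 6 \<partial>HL)
       - 6 * (\<integral>x. cmod (w x) ^ 4 * Re (w x * cnj (q x)) \<partial>HL)"
    have XY: "X \<ge> 0" "Y \<ge> 0" "X + Y = N\<^sup>2" using n by (auto simp: X_def Y_def N2)
    have "\<bar>R1\<bar> + \<bar>R2\<bar> \<le> 57 * K ^ 4 * X" using x1 x2 by (simp add: X_def R1_def R2_def distrib_left)
    moreover have "57 * K ^ 4 * X \<le> 57 * K ^ 4 * N\<^sup>2" using XY K4 by (intro mult_left_mono) auto
    ultimately have R: "\<bar>R1\<bar> + \<bar>R2\<bar> \<le> 57 * K ^ 4 * N\<^sup>2" by linarith
    \<comment> \<open>The first-order terms cancel or are absorbed into the sextic remainders.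
      Stated for plain variables, the identity keeps the integrals out of the arithmetic.\<close>
    have alg: "1/2 * ((a1 + 2 * a2 + a3) + (b1 + 2 * b2 + b3)) - 1/6 * (S1 + S2) - \<alpha> / 2 * (z + 2 * r + pp)
        - (1/2 * (a1 + b1) - 1/6 * (T1 + T2) - \<alpha> / 2 * z) - ((a2 - F1) + (b2 - F2) - \<alpha> * r)
      = 1/2 * (a3 + b3) - 1/6 * ((S1 - T1 - 6 * F1) + (S2 - T2 - 6 * F2)) - 1/2 * (\<alpha> * pp)"
      for a1 a2 a3 b1 b2 b3 S1 S2 z r pp T1 T2 F1 F2 :: real
      by (simp add: field_simps)
    have ap: "\<bar>\<alpha> * (cmod (p 0))\<^sup>2\<bar> \<le> \<bar>\<alpha>\<bar> * N\<^sup>2" unfolding abs_mult using p0 by (intro mult_left_mono) auto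
    have "energy \<alpha> (\<lambda>x. u x + h x) - energy \<alpha> u - energy_functional \<alpha> v v' w w' h
       = 1/2 * Y - 1/6 * (R1 + R2) - 1/2 * (\<alpha> * (cmod (p 0))\<^sup>2)"
      unfolding rep_energy[OF u] rep_energy[OF rep_add[OF u h]] energy_functional_eq[OF u h] energy_diff_def half_diff_def
        kin[OF H1pairD(3)[OF repD(1)[OF u]] H1pairD(3)[OF repD(1)[OF h]]] kin[OF H1pairD(3)[OF repD(2)[OF u]] H1pairD(3)[OF repD(2)[OF h]]]
        z0 Y_def R1_def R2_def
      by (rule alg)
    also have "\<bar>\<dots>\<bar> \<le> C * N\<^sup>2"
    proof -
      have "C * N\<^sup>2 = 1/2 * N\<^sup>2 + 57 * K ^ 4 * N\<^sup>2 + \<bar>\<alpha>\<bar> * N\<^sup>2" by (simp add: C_def algebra_simps)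
      moreover have "\<bar>1/2 * Y - 1/6 * r - 1/2 * a\<bar> \<le> 1/2 * n + T + S"
        if "0 \<le> Y" "Y \<le> n" "\<bar>r\<bar> \<le> T" "\<bar>a\<bar> \<le> S" for n r a T S :: real
        unfolding abs_le_iff using that(1,2) that(3,4)[THEN abs_le_D1] that(3,4)[THEN abs_le_D2]
        by (intro conjI; linarith)
      moreover have "Y \<le> N\<^sup>2" "\<bar>R1 + R2\<bar> \<le> 57 * K ^ 4 * N\<^sup>2" using XY R abs_triangle_ineq[of R1 R2] by linarith+
      ultimately show ?thesis using XY(2) ap by presburger
    qed
    also have "C * N\<^sup>2 \<le> \<epsilon> * N"
    proof -
      have "C * N \<le> \<epsilon>" using \<open>N \<le> \<epsilon> / C\<close> C by (simp add: field_simps)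
      then have "C * N * N \<le> \<epsilon> * N" using N0 by (rule mult_right_mono)
      then show ?thesis by (simp add: power2_eq_square mult.assoc)
    qed
    finally show "\<bar>energy \<alpha> (\<lambda>x. u x + h x) - energy \<alpha> u - energy_functional \<alpha> v v' w w' h\<bar> \<le> \<epsilon> * H1_norm h"
      unfolding N_def .
  qed
qed

text \<open>Along s \<eta> both linear maps approximate the same increment to within \<epsilon> s N;
  dividing by s and letting \<epsilon> tend to 0 gives equality.\<close>

lemma has_differential_on_D_unique:
  assumes L: "has_differential_on_D \<tau> F L u" and M: "has_differential_on_D \<tau> F M u" and \<eta>: "\<eta> \<in> Dspace \<tau>"
  shows "L \<eta> = M \<eta>"
proof -
  define N where "N = H1_norm \<eta>"
  have N: "N \<ge> 0" unfolding N_def by (rule H1_norm_nonneg[OF \<eta>])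
  have sL: "L (\<lambda>x. s *\<^sub>R \<eta> x) = s * L \<eta>" and sM: "M (\<lambda>x. s *\<^sub>R \<eta> x) = s * M \<eta>" for s
    using L M \<eta> by (auto simp: has_differential_on_D_def bounded_real_linear_on_D_def)
  have le: "\<bar>L \<eta> - M \<eta>\<bar> \<le> \<epsilon> * (2 * N)" if "\<epsilon> > 0" for \<epsilon>
  proof -
    have ex: "\<exists>d>0. \<forall>h\<in>Dspace \<tau>. H1_norm h < d \<longrightarrow> \<bar>F (\<lambda>x. u x + h x) - F u - T h\<bar> \<le> \<epsilon> * H1_norm h"
      if "has_differential_on_D \<tau> F T u" for T
      using that \<open>\<epsilon> > 0\<close> unfolding has_differential_on_D_def by (elim conjE) (drule spec, erule mp)
    obtain d1 where d1: "d1 > 0" "\<forall>h\<in>Dspace \<tau>. H1_norm h < d1 \<longrightarrow> \<bar>F (\<lambda>x. u x + h x) - F u - L h\<bar> \<le> \<epsilon> * H1_norm h"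
      using ex[OF L] by (elim exE conjE)
    obtain d2 where d2: "d2 > 0" "\<forall>h\<in>Dspace \<tau>. H1_norm h < d2 \<longrightarrow> \<bar>F (\<lambda>x. u x + h x) - F u - M h\<bar> \<le> \<epsilon> * H1_norm h"
      using ex[OF M] by (elim exE conjE)
    \<comment> \<open>The summand 1 avoids a division by zero when \<eta> has norm 0.\<close>
    define s where "s = min d1 d2 / (N + 1)"
    have s: "s > 0" using d1 d2 N by (simp add: s_def)
    have "s * N < min d1 d2"
    proof -
      have "s * N < s * (N + 1)" using s by simp
      also have "\<dots> = min d1 d2" using N by (simp add: s_def)
      finally show ?thesis .
    qed
    then have n: "H1_norm (\<lambda>x. s *\<^sub>R \<eta> x) < d1" "H1_norm (\<lambda>x. s *\<^sub>R \<eta> x) < d2"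
      using s unfolding H1_norm_scaleR[OF \<eta>] N_def by auto
    have "\<bar>s * L \<eta> - s * M \<eta>\<bar> \<le> 2 * (\<epsilon> * (s * N))"
      using d1(2)[rule_format, OF Dspace_scaleR[OF \<eta>] n(1)] d2(2)[rule_format, OF Dspace_scaleR[OF \<eta>] n(2)] s
      unfolding sL sM H1_norm_scaleR[OF \<eta>] N_def by linarith
    then have "s * \<bar>L \<eta> - M \<eta>\<bar> \<le> s * (\<epsilon> * (2 * N))"
      using s by (simp add: abs_mult mult_ac flip: right_diff_distrib)
    then show ?thesis using s by simp
  qed
  have "\<bar>L \<eta> - M \<eta>\<bar> \<le> 0 + e" if "e > 0" for e
  proof -
    have "\<bar>L \<eta> - M \<eta>\<bar> \<le> e / (2 * N + 1) * (2 * N)" using that N by (intro le) auto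
    also have "\<dots> \<le> e" using that N by (simp add: field_simps)
    finally show ?thesis by simp
  qed
  then have "\<bar>L \<eta> - M \<eta>\<bar> \<le> 0" by (rule field_le_epsilon)
  then show ?thesis by simp
qed

section \<open>The lower bound for the energy\<close>

lemma prim_has_derivative:
  assumes p: "prim f g" and c: "continuous_on {0..} g" and x: "0 \<le> x"
  shows "(f has_vector_derivative g x) (at x within {0..})"
proof -
  have "((\<lambda>u. integral {0..u} g) has_vector_derivative g x) (at x within {0..x+1})"
    by (rule integral_has_vector_derivative) (use x in \<open>auto intro: continuous_on_subset[OF c]\<close>)
  then have "((\<lambda>u. f 0 + integral {0..u} g) has_vector_derivative 0 + g x) (at x within {0..x+1})"
    by (rule has_vector_derivative_add[OF has_vector_derivative_const])
  then have "((\<lambda>u. f 0 + integral {0..u} g) has_vector_derivative g x) (at x within {0..x+1})" by simp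
  moreover have "at x within {0..x+1} = at x within {0..}"
    by (rule at_within_nhd[of _ "{..<x+1}"]) auto
  ultimately have d: "((\<lambda>u. f 0 + integral {0..u} g) has_vector_derivative g x) (at x within {0..})" by simp
  have e: "f 0 + integral {0..u} g = f u" if "0 \<le> u" for u
    using prim_eq[OF p that] set_borel_integral_eq_integral(2)[OF prim_integrable[OF p order_refl, of u]] by simp
  show ?thesis
    by (rule has_vector_derivative_transform[OF _ _ d]) (use x e in auto)
qed

lemma prim_integral:
  assumes "\<And>x. set_integrable lborel {0..x} g" shows "prim (\<lambda>x. LBINT s:{0..x}. g s) g"
proof (rule primI)
  have "(LBINT s:{0..0}. g s) = 0" using set_integral_Ioc_Icc[of 0 0 g] by (simp add: set_lebesgue_integral_def)
  then show "(LBINT s:{0..x}. g s) = (LBINT s:{0..0}. g s) + (LBINT s:{0..x}. g s)" for x by simp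
qed (rule assms)

text \<open>With $s(x) = \varepsilon + \int_x^\infty |f|^2$ the derivative of
  $\kappa \cot(\kappa s)\,|f|^4$ differs from $\kappa^2|f|^6 - 4|f'|^2$ by a complete square.\<close>

lemma half_line_lower_bound:
  assumes H: "H1pair f g" and K: "K > 0" and e: "\<epsilon> > 0"
    and small: "K * ((\<integral>x. (cmod (f x))\<^sup>2 \<partial>HL) + \<epsilon>) < pi"
  shows "K * cot (K * ((\<integral>x. (cmod (f x))\<^sup>2 \<partial>HL) + \<epsilon>)) * cmod (f 0) ^ 4
    \<le> 4 * (\<integral>x. (cmod (g x))\<^sup>2 \<partial>HL) - K\<^sup>2 * (\<integral>x. cmod (f x) ^ 6 \<partial>HL)"
proof -
  define m where "m = (\<integral>x. (cmod (f x))\<^sup>2 \<partial>HL)"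
  define P where "P = (\<lambda>x. (cmod (f x))\<^sup>2)"
  define P' where "P' = (\<lambda>x. 2 * Re (f x * cnj (g x)))"
  have pP: "prim P P'" unfolding P_def P'_def by (rule prim_norm_sq[OF H1pairD(1)[OF H]])
  have cP: "continuous_on {0..} P" by (rule prim_continuous[OF pP])
  have P0: "P x \<ge> 0" for x by (simp add: P_def)
  have iP: "integrable HL P" unfolding P_def by (rule sqi_integrable[OF H1pairD(2)[OF H]])
  define S where "S = (\<lambda>x. LBINT t:{0..x}. P t)"
  have pS: "prim S P" unfolding S_def
    by (rule prim_integral) (rule borel_integrable_atLeastAtMost'[OF continuous_on_subset[OF cP]], auto)
  have S0: "S 0 = 0" unfolding S_def using set_integral_Ioc_Icc[of 0 0 P] by (simp add: set_lebesgue_integral_def)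
  have Sm: "S x \<le> m" for x unfolding S_def m_def P_def[symmetric] by (rule HL_Icc_le[OF iP P0]) simp
  have Snn: "0 \<le> S x" for x unfolding S_def set_lebesgue_integral_def by (rule integral_nonneg_AE) (simp add: P0)
  \<comment> \<open>The angle K s(x). The added \<epsilon> keeps it at least K \<epsilon> > 0, away
    from the pole of the cotangent, even where f has no mass left.\<close>
  define A where "A = (\<lambda>x. K * (m + \<epsilon> - S x))"
  have A: "0 < A x" "A x < pi" for x
  proof -
    show "0 < A x" using K e Sm[of x] by (simp add: A_def)
    have "A x \<le> K * (m + \<epsilon>)" using K Snn[of x] by (simp add: A_def)
    then show "A x < pi" using small by (simp add: m_def)
  qed
  have sA: "sin (A x) > 0" for x using A by (rule sin_gt_zero)
  define C where "C = (\<lambda>x. cot (A x))"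
  have dS: "(S has_real_derivative P x) (at x within {0..})" if "0 \<le> x" for x
    using prim_has_derivative[OF pS cP that] by (simp add: has_real_derivative_iff_has_vector_derivative)
  have cS: "continuous_on {0..} S" by (rule prim_continuous[OF pS])
  have dC: "(C has_real_derivative K * P x * (1 + (C x)\<^sup>2)) (at x within {0..})" if "0 \<le> x" for x
  proof -
    have dA: "(A has_real_derivative - (K * P x)) (at x within {0..})"
      unfolding A_def by (auto intro!: derivative_eq_intros dS[OF that])
    have "sin (A x) \<noteq> 0" using sA[of x] by simp
    from DERIV_chain2[OF DERIV_cot[OF this] dA]
    have "((\<lambda>x. cot (A x)) has_real_derivative - inverse ((sin (A x))\<^sup>2) * - (K * P x)) (at x within {0..})" .
    moreover have "inverse ((sin (A x))\<^sup>2) = 1 + (C x)\<^sup>2"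
      using sA[of x] sin_cos_squared_add[of "A x"] by (simp add: C_def cot_def power_divide field_simps)
    moreover have "- inverse ((sin (A x))\<^sup>2) * - (K * P x) = K * P x * inverse ((sin (A x))\<^sup>2)" by simp
    ultimately show ?thesis unfolding C_def by metis
  qed
  have cA: "continuous_on {0..} A" unfolding A_def by (intro continuous_intros cS)
  have cC: "continuous_on {0..} C"
  proof -
    have "sin (A x) \<noteq> 0" for x using sA[of x] by simp
    then show ?thesis unfolding C_def cot_def by (intro continuous_intros cA) auto
  qed
  have pC: "prim C (\<lambda>x. K * P x * (1 + (C x)\<^sup>2))"
    by (rule prim_C1) (auto intro!: continuous_intros cC cP dC simp: has_real_derivative_iff_has_vector_derivative[symmetric])
  \<comment> \<open>The derivative of C |f|^4. The summand 1 in 1 + C^2 produces the term that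
    cancels K^2 |f|^6 in \<open>E\<close>.\<close>
  define Q where "Q = (\<lambda>x. K * P x * (1 + (C x)\<^sup>2) * (P x * P x) + C x * (P' x * P x + P x * P' x))"
  have pQ: "prim (\<lambda>x. C x * (P x * P x)) Q"
    using prim_scaleR[OF pC prim_scaleR[OF pP pP]] by (simp add: Q_def)
  define E where "E = (\<lambda>x. 4 * (cmod (g x))\<^sup>2 - K\<^sup>2 * cmod (f x) ^ 6)"
  have iE: "integrable HL E" unfolding E_def
    by (intro Bochner_Integration.integrable_diff integrable_mult_right sqi_integrable[OF H1pairD(3)[OF H]] H1pair_integrable_6[OF H])
  have iEl: "set_integrable lborel {0..x} E" for x
  proof -
    have "set_integrable lborel {0<..x} E"
      by (rule set_integrable_subset[of _ "{0<..}"]) (use iE in \<open>auto simp: HL_integrable_iff\<close>)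
    then show ?thesis by (simp add: set_integrable_Ioc_Icc)
  qed
  define W where "W = (\<lambda>x. LBINT t:{0..x}. E t)"
  have pW: "prim W E" unfolding W_def by (rule prim_integral[OF iEl])
  have W0: "W 0 = 0" unfolding W_def using set_integral_Ioc_Icc[of 0 0 E] by (simp add: set_lebesgue_integral_def)
  \<comment> \<open>After that cancellation E + K Q = 4d^2 + (K|C|c^3)^2 + 2K C c^2 P' with c = |f|
    and d = |g|, and |P'| <= 2cd bounds it below by (2d - K|C|c^3)^2.\<close>
  have point: "0 \<le> E x + K * Q x" for x
  proof -
    define c d where "c = cmod (f x)" and "d = cmod (g x)"
    have cd: "0 \<le> c" "0 \<le> d" by (auto simp: c_def d_def)
    have "\<bar>P' x\<bar> \<le> 2 * (c * d)"
      using abs_Re_le_cmod[of "f x * cnj (g x)"] unfolding P'_def c_def d_def by (simp add: norm_mult abs_mult del: times_complex.sel cnj.sel)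
    then have "\<bar>2 * K * C x * c\<^sup>2\<bar> * \<bar>P' x\<bar> \<le> \<bar>2 * K * C x * c\<^sup>2\<bar> * (2 * (c * d))" by (intro mult_left_mono) auto
    then have "\<bar>2 * K * C x * c\<^sup>2 * P' x\<bar> \<le> 4 * (K * \<bar>C x\<bar> * c ^ 3) * d"
      using K cd by (simp add: abs_mult power2_eq_square power3_eq_cube mult_ac)
    moreover have "E x + K * Q x = 4 * d\<^sup>2 + (K * \<bar>C x\<bar> * c ^ 3)\<^sup>2 + 2 * K * C x * c\<^sup>2 * P' x"
    proof -
      have Px: "P x = c\<^sup>2" by (simp add: P_def c_def)
      have sq: "(K * \<bar>C x\<bar> * c ^ 3)\<^sup>2 = K\<^sup>2 * (C x)\<^sup>2 * c ^ 6" by (simp add: power_mult_distrib flip: power_mult)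
      show ?thesis unfolding sq E_def Q_def Px c_def[symmetric] d_def[symmetric]
        by (simp add: power2_eq_square power3_eq_cube power_numeral_reduce algebra_simps)
    qed
    moreover have "0 \<le> (2 * d - K * \<bar>C x\<bar> * c ^ 3)\<^sup>2" by simp
    moreover have "(2 * d - K * \<bar>C x\<bar> * c ^ 3)\<^sup>2 = 4 * d\<^sup>2 + (K * \<bar>C x\<bar> * c ^ 3)\<^sup>2 - 4 * (K * \<bar>C x\<bar> * c ^ 3) * d"
      by (simp add: power2_diff power_mult_distrib)
    ultimately show ?thesis by linarith
  qed
  have key: "0 \<le> W R + K * (C R * (P R * P R) - C 0 * (P 0 * P 0))" if R: "0 \<le> R" for R
  proof -
    have "W R = (LBINT x:{0..R}. E x)" by (simp add: W_def)
    moreover have "C R * (P R * P R) - C 0 * (P 0 * P 0) = (LBINT x:{0..R}. Q x)"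
      using prim_diff[OF pQ order_refl R] by simp
    moreover have "(LBINT x:{0..R}. E x + K * Q x) = (LBINT x:{0..R}. E x) + K * (LBINT x:{0..R}. Q x)"
      using iEl[of R] prim_integrable[OF pQ order_refl, of R] by (simp add: set_integral_add(2))
    moreover have "0 \<le> (LBINT x:{0..R}. E x + K * Q x)"
      unfolding set_lebesgue_integral_def by (rule integral_nonneg_AE) (use point in auto)
    ultimately show ?thesis by simp
  qed
  have limW: "(W \<longlongrightarrow> (\<integral>x. E x \<partial>HL)) at_top"
    using prim_limit_at_top[OF pW] iE by (simp add: W0 HL_integrable_iff HL_integral)
  have limP: "(P \<longlongrightarrow> 0) at_top" unfolding P_def by (rule H1pair_tendsto_0[OF H])
  have limS: "(S \<longlongrightarrow> m) at_top"
    using prim_limit_at_top[OF pS] iP by (simp add: S0 HL_integrable_iff HL_integral m_def P_def)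
  \<comment> \<open>The cotangent tends to the finite value cot(K \<epsilon>), so the boundary term
    at infinity vanishes together with |f|^4.\<close>
  have limC: "(C \<longlongrightarrow> cot (K * (m + \<epsilon> - m))) at_top"
  proof -
    have "0 < K * \<epsilon>" using K e by simp
    moreover have "K * \<epsilon> \<le> K * (m + \<epsilon>)" using K Snn[of 0] Sm[of 0] by simp
    ultimately have "sin (K * (m + \<epsilon> - m)) > 0" using small by (intro sin_gt_zero) (auto simp: m_def)
    then show ?thesis unfolding C_def A_def cot_def by (intro tendsto_intros limS) auto
  qed
  have "((\<lambda>R. W R + K * (C R * (P R * P R) - C 0 * (P 0 * P 0))) \<longlongrightarrow>
      (\<integral>x. E x \<partial>HL) + K * (cot (K * (m + \<epsilon> - m)) * (0 * 0) - C 0 * (P 0 * P 0))) at_top"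
    by (intro tendsto_intros limW limC limP)
  then have "0 \<le> (\<integral>x. E x \<partial>HL) + K * (cot (K * (m + \<epsilon> - m)) * (0 * 0) - C 0 * (P 0 * P 0))"
    by (rule tendsto_lowerbound) (auto intro: eventually_mono[OF eventually_ge_at_top[of 0]] key)
  then have "K * C 0 * (P 0 * P 0) \<le> (\<integral>x. E x \<partial>HL)" by (simp add: algebra_simps)
  moreover have "C 0 = cot (K * (m + \<epsilon>))" by (simp add: C_def A_def S0)
  moreover have "P 0 * P 0 = cmod (f 0) ^ 4" by (simp add: P_def power2_eq_square power4_eq_xxxx)
  moreover have "(\<integral>x. E x \<partial>HL) = 4 * (\<integral>x. (cmod (g x))\<^sup>2 \<partial>HL) - K\<^sup>2 * (\<integral>x. cmod (f x) ^ 6 \<partial>HL)"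
    unfolding E_def using sqi_integrable[OF H1pairD(3)[OF H]] H1pair_integrable_6[OF H] by simp
  ultimately show ?thesis by (simp add: m_def)
qed

section \<open>The cotangent inequality and the quadratic lower bound\<close>

definition cot_bound :: "real \<Rightarrow> real \<Rightarrow> real" where
  "cot_bound t M = ((1 + t ^ 4) * cos M + 2 * t\<^sup>2) / sin M"

text \<open>Multiplied by sin(x + y), the two cotangents become cos(x + y) + sin y / sin x and cos(x
  + y) + sin x / sin y. The quotients are handled by the arithmetic-geometric mean inequality, with
  equality exactly when sin y = t^2 sin x.\<close>

lemma cot_sum_ge:
  assumes x: "0 < x" and y: "0 < y" and xy: "x + y < pi"
  shows "cot_bound t (x + y) \<le> cot x + t ^ 4 * cot y"
proof -
  have s: "sin x > 0" "sin y > 0" "sin (x + y) > 0" using assms by (auto intro!: sin_gt_zero)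
  have a: "cot x * sin (x + y) = cos (x + y) + sin y / sin x"
  proof -
    have "cos x * sin (x + y) - cos (x + y) * sin x = sin ((x + y) - x)" by (simp only: sin_diff) (simp add: mult.commute)
    then show ?thesis using s by (simp add: cot_def field_simps)
  qed
  have b: "cot y * sin (x + y) = cos (x + y) + sin x / sin y"
  proof -
    have "cos y * sin (x + y) - cos (x + y) * sin y = sin ((x + y) - y)" by (simp only: sin_diff) (simp add: mult.commute)
    then show ?thesis using s by (simp add: cot_def field_simps)
  qed
  have amgm: "2 * t\<^sup>2 \<le> sin y / sin x + t ^ 4 * (sin x / sin y)"
  proof -
    have "0 \<le> (sin y - t\<^sup>2 * sin x)\<^sup>2 / (sin x * sin y)" using s by simp
    also have "\<dots> = sin y / sin x + t ^ 4 * (sin x / sin y) - 2 * t\<^sup>2"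
      using s by (simp add: power2_diff field_simps power2_eq_square power4_eq_xxxx)
    finally show ?thesis by simp
  qed
  have "(cot x + t ^ 4 * cot y) * sin (x + y) = cot x * sin (x + y) + t ^ 4 * (cot y * sin (x + y))" by (simp add: algebra_simps)
  also have "\<dots> = (1 + t ^ 4) * cos (x + y) + (sin y / sin x + t ^ 4 * (sin x / sin y))"
    unfolding a b by (simp add: algebra_simps)
  finally have "(1 + t ^ 4) * cos (x + y) + 2 * t\<^sup>2 \<le> (cot x + t ^ 4 * cot y) * sin (x + y)" using amgm by linarith
  then show ?thesis using s(3) unfolding cot_bound_def by (simp add: pos_divide_le_eq)
qed

text \<open>The square 4/3 makes 4|f'|^2 - kap^2 |f|^6 eight times the energy density 1/2 |f'|^2 -
  1/6 |f|^6.\<close>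

definition kap :: real where "kap = 2 / sqrt 3"

lemma kap_sq: "kap\<^sup>2 = 4 / 3" and kap_pos: "kap > 0" by (auto simp: kap_def power_divide)

text \<open>The half-line bounds are added for small \<epsilon> > 0, and \<epsilon> tends to 0 only
  in the sum, where \<open>cot_bound\<close> is continuous because 0 < kap \<mu> < pi. One of the
  two half-line masses may vanish, and this order avoids a cotangent at 0.\<close>

lemma energy_ge_quadratic:
  assumes r: "rep u v v' w w'" and jump: "w 0 = of_real \<tau> * v 0" and m: "mass u = \<mu>"
    and \<mu>: "0 < \<mu>" "kap * \<mu> < pi"
  shows "kap / 8 * cot_bound \<tau> (kap * \<mu>) * ((cmod (v 0))\<^sup>2)\<^sup>2 - \<alpha> / 2 * (cmod (v 0))\<^sup>2 \<le> energy \<alpha> u"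
proof -
  define m1 where "m1 = (\<integral>x. (cmod (v x))\<^sup>2 \<partial>HL)"
  define m2 where "m2 = (\<integral>x. (cmod (w x))\<^sup>2 \<partial>HL)"
  have mm: "m1 + m2 = \<mu>" using rep_mass[OF r] m by (simp add: m1_def m2_def)
  have nn: "0 \<le> m1" "0 \<le> m2" by (auto simp: m1_def m2_def)
  note k = kap_pos
  define B where "B = (cmod (v 0))\<^sup>2"
  have w0: "cmod (w 0) ^ 4 = \<tau> ^ 4 * B\<^sup>2" "cmod (v 0) ^ 4 = B\<^sup>2"
    by (simp_all add: jump norm_mult power_mult_distrib B_def power_even_abs flip: power_mult)
  \<comment> \<open>Each of the two masses is enlarged by \<epsilon>, hence 2 \<epsilon> in the
    total.\<close>
  have step: "kap / 8 * (cot_bound \<tau> (kap * (\<mu> + 2 * \<epsilon>)) * B\<^sup>2) - \<alpha> / 2 * B \<le> energy \<alpha> u"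
    if e: "\<epsilon> > 0" "kap * (\<mu> + 2 * \<epsilon>) < pi" for \<epsilon>
  proof -
    have p1: "0 < kap * (m1 + \<epsilon>)" "0 < kap * (m2 + \<epsilon>)" using k nn e by (auto intro!: mult_pos_pos)
    have sum: "kap * (m1 + \<epsilon>) + kap * (m2 + \<epsilon>) = kap * (\<mu> + 2 * \<epsilon>)" unfolding mm[symmetric] by (simp add: algebra_simps)
    have p2: "kap * (m1 + \<epsilon>) < pi" "kap * (m2 + \<epsilon>) < pi" using p1 sum e by linarith+
    have l1: "kap * cot (kap * (m1 + \<epsilon>)) * B\<^sup>2 \<le> 4 * (\<integral>x. (cmod (v' x))\<^sup>2 \<partial>HL) - 4 / 3 * (\<integral>x. cmod (v x) ^ 6 \<partial>HL)"
      using half_line_lower_bound[OF repD(1)[OF r] k e(1)] p2(1) unfolding m1_def[symmetric] kap_sq w0 by blast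
    have l2: "kap * cot (kap * (m2 + \<epsilon>)) * (\<tau> ^ 4 * B\<^sup>2) \<le> 4 * (\<integral>x. (cmod (w' x))\<^sup>2 \<partial>HL) - 4 / 3 * (\<integral>x. cmod (w x) ^ 6 \<partial>HL)"
      using half_line_lower_bound[OF repD(2)[OF r] k e(1)] p2(2) unfolding m2_def[symmetric] kap_sq w0 by blast
    have gen1: "X \<le> 8 * (1/2 * (a + b) - 1/6 * (c + d) - q + q)"
      if "X \<le> Y + Z" "Y \<le> 4 * a - 4/3 * c" "Z \<le> 4 * b - 4/3 * d" for X Y Z a b c d q :: real
      using that by argo
    have gen2: "A - q \<le> E" if "X \<le> 8 * (E + q)" "A = X / 8" for A q E X :: real using that by argo
    have "cot_bound \<tau> (kap * (\<mu> + 2 * \<epsilon>)) \<le> cot (kap * (m1 + \<epsilon>)) + \<tau> ^ 4 * cot (kap * (m2 + \<epsilon>))"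
      using cot_sum_ge[OF p1] e(2) unfolding sum by blast
    then have "kap * B\<^sup>2 * cot_bound \<tau> (kap * (\<mu> + 2 * \<epsilon>)) \<le> kap * B\<^sup>2 * (cot (kap * (m1 + \<epsilon>)) + \<tau> ^ 4 * cot (kap * (m2 + \<epsilon>)))"
      using k by (intro mult_left_mono) auto
    also have "\<dots> = kap * cot (kap * (m1 + \<epsilon>)) * B\<^sup>2 + kap * cot (kap * (m2 + \<epsilon>)) * (\<tau> ^ 4 * B\<^sup>2)"
      by (simp add: distrib_left mult_ac)
    finally have "kap * B\<^sup>2 * cot_bound \<tau> (kap * (\<mu> + 2 * \<epsilon>)) \<le> 8 * (energy \<alpha> u + \<alpha> / 2 * B)"
      unfolding rep_energy[OF r] B_def[symmetric] by (rule gen1[OF _ l1 l2])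
    moreover have "kap / 8 * (cot_bound \<tau> (kap * (\<mu> + 2 * \<epsilon>)) * B\<^sup>2) = kap * B\<^sup>2 * cot_bound \<tau> (kap * (\<mu> + 2 * \<epsilon>)) / 8" by simp
    ultimately show ?thesis by (rule gen2)
  qed
  have "((\<lambda>\<epsilon>. kap / 8 * (cot_bound \<tau> (kap * (\<mu> + 2 * \<epsilon>)) * B\<^sup>2) - \<alpha> / 2 * B) \<longlongrightarrow>
      kap / 8 * (cot_bound \<tau> (kap * (\<mu> + 2 * 0)) * B\<^sup>2) - \<alpha> / 2 * B) (at_right 0)"
  proof -
    have "sin (kap * (\<mu> + 2 * 0)) > 0" using \<mu> kap_pos by (intro sin_gt_zero) auto
    then show ?thesis unfolding cot_bound_def by (intro tendsto_intros) auto
  qed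
  moreover have "\<forall>\<^sub>F \<epsilon> in at_right 0. kap / 8 * (cot_bound \<tau> (kap * (\<mu> + 2 * \<epsilon>)) * B\<^sup>2) - \<alpha> / 2 * B \<le> energy \<alpha> u"
  proof -
    have "((\<lambda>\<epsilon>. kap * (\<mu> + 2 * \<epsilon>)) \<longlongrightarrow> kap * (\<mu> + 2 * 0)) (at_right 0)" by (intro tendsto_intros)
    then have "\<forall>\<^sub>F \<epsilon> in at_right 0. kap * (\<mu> + 2 * \<epsilon>) < pi" by (rule order_tendstoD) (use \<mu> in simp)
    then show ?thesis using eventually_at_right_less[of 0] by eventually_elim (rule step)
  qed
  ultimately have "kap / 8 * (cot_bound \<tau> (kap * (\<mu> + 2 * 0)) * B\<^sup>2) - \<alpha> / 2 * B \<le> energy \<alpha> u"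
    by (intro tendsto_upperbound) auto
  then show ?thesis unfolding B_def by simp
qed

lemma energy_lower_bound:
  assumes r: "rep u v v' w w'" and jump: "w 0 = of_real \<tau> * v 0" and m: "mass u = \<mu>"
    and \<mu>: "0 < \<mu>" "kap * \<mu> < pi" and F: "0 < cot_bound \<tau> (kap * \<mu>)"
  shows "- \<alpha>\<^sup>2 / (2 * kap * cot_bound \<tau> (kap * \<mu>)) \<le> energy \<alpha> u"
proof -
  define a where "a = kap * cot_bound \<tau> (kap * \<mu>)"
  have a: "a > 0" using F kap_pos unfolding a_def by (intro mult_pos_pos)
  define B where "B = (cmod (v 0))\<^sup>2"
  \<comment> \<open>Completing the square: the minimum of the polynomial lies at B = 2 \<alpha> /
    a.\<close>
  have "0 \<le> (a * B - 2 * \<alpha>)\<^sup>2 / (8 * a)" using a by simp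
  also have "\<dots> = a / 8 * B\<^sup>2 - \<alpha> / 2 * B + \<alpha>\<^sup>2 / (2 * a)"
    using a by (simp add: power2_diff field_simps power2_eq_square)
  finally have "- \<alpha>\<^sup>2 / (2 * a) \<le> a / 8 * B\<^sup>2 - \<alpha> / 2 * B" by simp
  also have "\<dots> \<le> energy \<alpha> u" using energy_ge_quadratic[OF r jump m \<mu>, of \<alpha>] by (simp add: a_def B_def)
  finally show ?thesis by (simp add: a_def mult.assoc)
qed

section \<open>Half-solitons\<close>

text \<open>Positive decaying solutions of f'' = k^2 f - f^5. The first integral is listed as well,
  since the later computations run through it; decay is what makes its constant of integration
  0.\<close>

definition soliton :: "real \<Rightarrow> (real \<Rightarrow> real) \<Rightarrow> (real \<Rightarrow> real) \<Rightarrow> bool" where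
  "soliton k f f' \<longleftrightarrow> 0 < k \<and> (\<forall>x\<ge>0. 0 < f x
     \<and> (f has_real_derivative f' x) (at x within {0..})
     \<and> (f' has_real_derivative k\<^sup>2 * f x - f x ^ 5) (at x within {0..})
     \<and> (f' x)\<^sup>2 = k\<^sup>2 * (f x)\<^sup>2 - f x ^ 6 / 3) \<and> (f \<longlongrightarrow> 0) at_top"

lemma solitonD:
  assumes "soliton k f f'"
  shows "0 < k" "\<And>x. 0 \<le> x \<Longrightarrow> 0 < f x" "\<And>x. 0 \<le> x \<Longrightarrow> (f has_real_derivative f' x) (at x within {0..})"
    "\<And>x. 0 \<le> x \<Longrightarrow> (f' has_real_derivative k\<^sup>2 * f x - f x ^ 5) (at x within {0..})"
    "\<And>x. 0 \<le> x \<Longrightarrow> (f' x)\<^sup>2 = k\<^sup>2 * (f x)\<^sup>2 - f x ^ 6 / 3" "(f \<longlongrightarrow> 0) at_top"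
  using assms by (auto simp: soliton_def)

text \<open>The first integral gives $\sin\varphi = f^2/(\sqrt3\,k)$ and hence $\varphi' = -\kappa f^2$ with
  $\kappa = 2/\sqrt3$, so that the angle at the vertex measures the mass.\<close>

definition soliton_angle :: "real \<Rightarrow> (real \<Rightarrow> real) \<Rightarrow> (real \<Rightarrow> real) \<Rightarrow> real \<Rightarrow> real" where
  "soliton_angle k f f' x = arccos (- f' x / (k * f x))"

text \<open>Division of the first integral by k^2 f^2. Positivity of f makes the bound strict, so
  that \<open>arccos\<close> is differentiable at this argument.\<close>

lemma soliton_cos_bound:
  assumes s: "soliton k f f'" and x: "0 \<le> x"
  shows "1 - (- f' x / (k * f x))\<^sup>2 = (f x ^ 2 / (sqrt 3 * k))\<^sup>2" "\<bar>- f' x / (k * f x)\<bar> < 1"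
proof -
  have p: "f x > 0" "k > 0" using solitonD[OF s] x by auto
  show e: "1 - (- f' x / (k * f x))\<^sup>2 = (f x ^ 2 / (sqrt 3 * k))\<^sup>2"
  proof -
    have f6: "f x ^ 6 = f x ^ 4 * (f x)\<^sup>2" "((f x)\<^sup>2)\<^sup>2 = f x ^ 4" by (simp_all flip: power_add power_mult)
    have "(- f' x / (k * f x))\<^sup>2 = (k\<^sup>2 * (f x)\<^sup>2 - f x ^ 6 / 3) / (k\<^sup>2 * (f x)\<^sup>2)"
      unfolding power_divide power_mult_distrib power2_minus solitonD(5)[OF s x] ..
    then have "1 - (- f' x / (k * f x))\<^sup>2 = f x ^ 6 / (3 * k\<^sup>2 * (f x)\<^sup>2)"
      using p by (simp add: diff_divide_distrib mult.assoc)
    also have "\<dots> = f x ^ 4 / (3 * k\<^sup>2)"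
      unfolding f6 using p by (intro nonzero_mult_divide_mult_cancel_right) auto
    finally have "1 - (- f' x / (k * f x))\<^sup>2 = f x ^ 4 / (3 * k\<^sup>2)" .
    moreover have "(f x ^ 2 / (sqrt 3 * k))\<^sup>2 = f x ^ 4 / (3 * k\<^sup>2)"
      unfolding power_divide power_mult_distrib f6 by simp
    ultimately show ?thesis by simp
  qed
  have "(f x ^ 2 / (sqrt 3 * k))\<^sup>2 > 0" using p by simp
  then have "(- f' x / (k * f x))\<^sup>2 < 1" using e by linarith
  then show "\<bar>- f' x / (k * f x)\<bar> < 1" by (simp only: abs_square_less_1)
qed

lemma soliton_angle:
  assumes s: "soliton k f f'" and x: "0 \<le> x"
  shows "0 < soliton_angle k f f' x" "soliton_angle k f f' x < pi"
    "cos (soliton_angle k f f' x) = - f' x / (k * f x)"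
    "sin (soliton_angle k f f' x) = f x ^ 2 / (sqrt 3 * k)"
proof -
  have b: "\<bar>- f' x / (k * f x)\<bar> < 1" by (rule soliton_cos_bound(2)[OF s x])
  then have b': "-1 < - f' x / (k * f x)" "- f' x / (k * f x) < 1" unfolding abs_less_iff by linarith+
  have p: "f x > 0" "k > 0" using solitonD[OF s] x by auto
  show "0 < soliton_angle k f f' x" "soliton_angle k f f' x < pi"
    using arccos_lt_bounded[OF b'] by (auto simp: soliton_angle_def)
  show "cos (soliton_angle k f f' x) = - f' x / (k * f x)"
    unfolding soliton_angle_def using b' by (intro cos_arccos) auto
  have "sin (soliton_angle k f f' x) = sqrt (1 - (- f' x / (k * f x))\<^sup>2)"
    unfolding soliton_angle_def using b' by (intro sin_arccos) auto
  also have "\<dots> = f x ^ 2 / (sqrt 3 * k)" unfolding soliton_cos_bound(1)[OF s x] using p by simp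
  finally show "sin (soliton_angle k f f' x) = f x ^ 2 / (sqrt 3 * k)" .
qed

text \<open>The argument of \<open>arccos\<close> has derivative (2/3) f^4 / k by the equation and
  the first integral, and the derivative of \<open>arccos\<close> at it is -sqrt 3 k / f^2.\<close>

lemma soliton_angle_deriv:
  assumes s: "soliton k f f'" and x: "0 \<le> x"
  shows "(soliton_angle k f f' has_real_derivative - (kap * (f x)\<^sup>2)) (at x within {0..})"
proof -
  have p: "f x > 0" "k > 0" using solitonD[OF s] x by auto
  define q where "q = (\<lambda>x. - f' x / (k * f x))"
  have b: "-1 < q x" "q x < 1" using soliton_cos_bound(2)[OF s x] unfolding q_def abs_less_iff by linarith+
  have dq: "(q has_real_derivative 2 / 3 * f x ^ 4 / k) (at x within {0..})"
  proof -
    have "(q has_real_derivative ((- (k\<^sup>2 * f x - f x ^ 5)) * (k * f x) - (- f' x) * (k * f' x)) / ((k * f x) * (k * f x))) (at x within {0..})"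
      unfolding q_def using p
      by (intro DERIV_divide DERIV_minus solitonD(4)[OF s x] DERIV_cmult solitonD(3)[OF s x]) auto
    moreover have "((- (k\<^sup>2 * f x - f x ^ 5)) * (k * f x) - (- f' x) * (k * f' x)) / ((k * f x) * (k * f x)) = 2 / 3 * f x ^ 4 / k"
    proof -
      have "(- (k\<^sup>2 * f x - f x ^ 5)) * (k * f x) - (- f' x) * (k * f' x) = k * ((f' x)\<^sup>2 - k\<^sup>2 * (f x)\<^sup>2 + f x ^ 6)"
        by (simp add: algebra_simps power2_eq_square power_numeral_reduce)
      also have "\<dots> = k * (2 / 3 * f x ^ 6)" unfolding solitonD(5)[OF s x] by simp
      finally have N: "(- (k\<^sup>2 * f x - f x ^ 5)) * (k * f x) - (- f' x) * (k * f' x) = k * (2 / 3 * f x ^ 6)" .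
      show ?thesis unfolding N using p by (simp add: field_simps power_numeral_reduce)
    qed
    ultimately show ?thesis by simp
  qed
  have "((\<lambda>x. arccos (q x)) has_real_derivative inverse (- sqrt (1 - (q x)\<^sup>2)) * (2 / 3 * f x ^ 4 / k)) (at x within {0..})"
    by (rule DERIV_chain2[where f = arccos and g = q, OF DERIV_arccos[OF b] dq])
  moreover have "inverse (- sqrt (1 - (q x)\<^sup>2)) * (2 / 3 * f x ^ 4 / k) = - (kap * (f x)\<^sup>2)"
  proof -
    have "sqrt (1 - (q x)\<^sup>2) = f x ^ 2 / (sqrt 3 * k)" unfolding q_def soliton_cos_bound(1)[OF s x] using p by simp
    moreover have "inverse (- (f x ^ 2 / (sqrt 3 * k))) * (2 / 3 * f x ^ 4 / k) = - (sqrt 3 * (2 / 3) * (f x)\<^sup>2)"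
      using p by (simp add: field_simps power2_eq_square power4_eq_xxxx)
    moreover have "sqrt 3 * (2 / 3) = kap" by (simp add: kap_def field_simps)
    ultimately show ?thesis by simp
  qed
  ultimately show ?thesis by (simp add: soliton_angle_def[abs_def] q_def)
qed

lemma soliton_continuous:
  assumes s: "soliton k f f'"
  shows "continuous_on {0..} f" "continuous_on {0..} f'" "continuous_on {0..} (soliton_angle k f f')"
  by (auto intro!: DERIV_continuous_on solitonD(3,4)[OF s] soliton_angle_deriv[OF s])

text \<open>Decay of f only gives that the sine of the angle tends to 0, which leaves the limits 0
  and pi. The angle is nonincreasing, and it cannot stay above pi/2, for then f' > 0 throughout and
  f could not decay. Once it is at most pi/2, it equals arcsin(f^2 / (sqrt 3 k)).\<close>

lemma soliton_angle_tendsto_0: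
  assumes s: "soliton k f f'" shows "(soliton_angle k f f' \<longlongrightarrow> 0) at_top"
proof -
  let ?\<phi> = "soliton_angle k f f'"
  have mono: "?\<phi> y \<le> ?\<phi> x" if "0 \<le> x" "x \<le> y" for x y
  proof (rule DERIV_nonpos_imp_decreasing_open[OF that(2)])
    show "\<exists>d. (?\<phi> has_real_derivative d) (at z) \<and> d \<le> 0" if z: "x < z" "z < y" for z
    proof -
      have "(?\<phi> has_real_derivative - (kap * (f z)\<^sup>2)) (at z within {0..})"
        using z \<open>0 \<le> x\<close> by (intro soliton_angle_deriv[OF s]) auto
      moreover have "at z within {0..} = at z" using z \<open>0 \<le> x\<close> by (intro at_within_interior) auto
      ultimately show ?thesis using kap_pos by (intro exI[of _ "- (kap * (f z)\<^sup>2)"]) auto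
    qed
    show "continuous_on {x..y} ?\<phi>" by (rule continuous_on_subset[OF soliton_continuous(3)[OF s]]) (use that in auto)
  qed
  have "\<exists>R\<ge>0. ?\<phi> R \<le> pi / 2"
  proof (rule ccontr)
    assume "\<not> (\<exists>R\<ge>0. ?\<phi> R \<le> pi / 2)"
    then have n: "?\<phi> R > pi / 2" if "R \<ge> 0" for R using that not_le by blast
    have fp: "f' R > 0" if R: "R \<ge> 0" for R
    proof -
      have "cos (?\<phi> R) < 0" by (rule cos_lt_zero_pi) (use n[OF R] soliton_angle(2)[OF s R] in auto)
      moreover have p: "0 < k * f R" using solitonD(1)[OF s] solitonD(2)[OF s R] by simp
      moreover have "cos (?\<phi> R) * (k * f R) = - f' R"
      proof -
        have nz: "k * f R \<noteq> 0" using p by linarith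
        show ?thesis unfolding soliton_angle(3)[OF s R] by (rule nonzero_divide_eq_eq[OF nz, THEN iffD1, OF refl, symmetric])
      qed
      ultimately show ?thesis using mult_neg_pos[of "cos (?\<phi> R)" "k * f R"] by linarith
    qed
    have "f 0 \<le> f y" if "0 \<le> y" for y
    proof (rule DERIV_nonneg_imp_increasing_open[OF that])
      show "\<exists>d. (f has_real_derivative d) (at z) \<and> d \<ge> 0" if z: "0 < z" "z < y" for z
      proof -
        have "(f has_real_derivative f' z) (at z within {0..})" using z by (intro solitonD(3)[OF s]) auto
        moreover have "at z within {0..} = at z" using z by (intro at_within_interior) auto
        ultimately show ?thesis using fp[of z] z by (intro exI[of _ "f' z"]) auto
      qed
      show "continuous_on {0..y} f" by (rule continuous_on_subset[OF soliton_continuous(1)[OF s]]) auto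
    qed
    then have "f 0 \<le> 0"
      by (intro tendsto_lowerbound[OF solitonD(6)[OF s]]) (auto intro: eventually_mono[OF eventually_ge_at_top[of 0]])
    then show False using solitonD(2)[OF s, of 0] by simp
  qed
  then obtain R where R: "R \<ge> 0" "?\<phi> R \<le> pi / 2" by (elim exE conjE)
  have e: "arcsin (f x ^ 2 / (sqrt 3 * k)) = ?\<phi> x" if "x \<ge> R" for x
  proof -
    have x: "0 \<le> x" using R(1) that by linarith
    have "?\<phi> x \<le> pi / 2" using mono[OF R(1) that] R(2) by linarith
    moreover have "- (pi / 2) \<le> ?\<phi> x" using soliton_angle(1)[OF s x] pi_gt_zero by linarith
    ultimately have "arcsin (sin (?\<phi> x)) = ?\<phi> x" by (intro arcsin_sin)
    then show ?thesis by (simp only: soliton_angle(4)[OF s x])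
  qed
  have "((\<lambda>x. arcsin (f x ^ 2 / (sqrt 3 * k))) \<longlongrightarrow> arcsin (0 ^ 2 / (sqrt 3 * k))) at_top"
  proof (rule isCont_tendsto_compose[of _ arcsin])
    show "isCont arcsin (0 ^ 2 / (sqrt 3 * k))" by (rule isCont_arcsin) auto
    show "((\<lambda>x. f x ^ 2 / (sqrt 3 * k)) \<longlongrightarrow> 0 ^ 2 / (sqrt 3 * k)) at_top"
      using solitonD(1)[OF s] by (intro tendsto_intros solitonD(6)[OF s]) auto
  qed
  moreover have "\<forall>\<^sub>F x in at_top. arcsin (f x ^ 2 / (sqrt 3 * k)) = ?\<phi> x"
    using e by (auto simp: eventually_at_top_linorder)
  ultimately show ?thesis by (simp add: tendsto_cong)
qed

text \<open>Minus the angle is an antiderivative of the nonnegative function kap f^2 with limit 0 at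
  infinity; the fundamental theorem for nonnegative integrands yields integrability and the value
  together.\<close>

lemma soliton_mass:
  assumes s: "soliton k f f'"
  shows "integrable HL (\<lambda>x. (f x)\<^sup>2)" "kap * (\<integral>x. (f x)\<^sup>2 \<partial>HL) = soliton_angle k f f' 0"
proof -
  let ?\<phi> = "soliton_angle k f f'"
  have d: "((\<lambda>x. - ?\<phi> x) has_real_derivative kap * (f x)\<^sup>2) (at x)" if "x > 0" for x
  proof -
    have h: "((\<lambda>x. - ?\<phi> x) has_real_derivative - (- (kap * (f x)\<^sup>2))) (at x within {0..})"
      using that by (intro DERIV_minus soliton_angle_deriv[OF s]) auto
    have e: "at x within {0..} = at x" using that by (intro at_within_interior) auto
    show ?thesis using h unfolding e minus_minus .
  qed
  have c: "isCont (\<lambda>x. kap * (f x)\<^sup>2) x" if "x > 0" for x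
  proof -
    have "continuous_on {0<..} f" by (rule continuous_on_subset[OF soliton_continuous(1)[OF s]]) auto
    then have "isCont f x" using that by (simp add: continuous_on_eq_continuous_at)
    then show ?thesis by (intro continuous_intros)
  qed
  have t0: "(((\<lambda>x. - ?\<phi> x) \<circ> real_of_ereal) \<longlongrightarrow> - ?\<phi> 0) (at_right (ereal 0))"
  proof -
    have "(?\<phi> \<longlongrightarrow> ?\<phi> 0) (at 0 within {0..})"
      using soliton_continuous(3)[OF s] unfolding continuous_on_def by (auto dest: bspec[of _ _ 0])
    then have "(?\<phi> \<longlongrightarrow> ?\<phi> 0) (at_right 0)" by (rule tendsto_within_subset) auto
    then have "((\<lambda>x. - ?\<phi> x) \<longlongrightarrow> - ?\<phi> 0) (at_right 0)" by (rule tendsto_minus)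
    then show ?thesis by (simp only: ereal_tendsto_simps)
  qed
  have t1: "(((\<lambda>x. - ?\<phi> x) \<circ> real_of_ereal) \<longlongrightarrow> - 0) (at_left \<infinity>)"
    using tendsto_minus[OF soliton_angle_tendsto_0[OF s]] by (simp only: ereal_tendsto_simps)
  note ftc = interval_integral_FTC_nonneg[of "ereal 0" "\<infinity>" "\<lambda>x. - ?\<phi> x" "\<lambda>x. kap * (f x)\<^sup>2" "- ?\<phi> 0" "- 0"]
  have ei: "einterval (ereal 0) \<infinity> = {0<..}" by (auto simp: einterval_def)
  have "set_integrable lborel (einterval (ereal 0) \<infinity>) (\<lambda>x. kap * (f x)\<^sup>2)"
    by (rule ftc(1)) (use d c t0 t1 kap_pos in auto)
  then have i: "integrable HL (\<lambda>x. kap * (f x)\<^sup>2)" by (simp only: ei HL_integrable_iff)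
  then show "integrable HL (\<lambda>x. (f x)\<^sup>2)" using kap_pos by simp
  have "(LBINT x=ereal 0..\<infinity>. kap * (f x)\<^sup>2) = - 0 - - ?\<phi> 0"
    by (rule ftc(2)) (use d c t0 t1 kap_pos in auto)
  then have "(\<integral>x. kap * (f x)\<^sup>2 \<partial>HL) = ?\<phi> 0"
    unfolding interval_lebesgue_integral_def ei HL_integral by simp
  then show "kap * (\<integral>x. (f x)\<^sup>2 \<partial>HL) = ?\<phi> 0" by simp
qed

text \<open>The first integral gives |f'| <= k f and expresses f^6 through f^2 and f'^2, so
  everything follows from the integrability of f^2.\<close>

lemma soliton_H1:
  assumes s: "soliton k f f'"
  shows "prim f f'" "sqi f" "sqi f'" "integrable HL (\<lambda>x. f x ^ 6)"
proof -
  show "prim f f'"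
    by (rule prim_C1) (auto simp: has_real_derivative_iff_has_vector_derivative[symmetric] intro: solitonD(3)[OF s] soliton_continuous[OF s])
  have m: "f \<in> borel_measurable HL" "f' \<in> borel_measurable HL"
    by (auto intro!: continuous_HL_measurable continuous_on_subset[OF soliton_continuous(1)[OF s]] continuous_on_subset[OF soliton_continuous(2)[OF s]])
  show sf: "sqi f" using m soliton_mass(1)[OF s] by (simp add: sqi_def)
  have i': "integrable HL (\<lambda>x. (f' x)\<^sup>2)"
  proof (rule sqi_mult[OF sf sf, where C = "k\<^sup>2"])
    show "(\<lambda>x. (f' x)\<^sup>2) \<in> borel_measurable HL" using m by measurable
    fix x :: real assume "0 < x"
    then have "(f' x)\<^sup>2 \<le> k\<^sup>2 * (f x)\<^sup>2"
      using solitonD(5)[OF s, of x] solitonD(2)[OF s, of x] by simp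
    then show "\<bar>(f' x)\<^sup>2\<bar> \<le> k\<^sup>2 * (norm (f x) * norm (f x))" by (simp add: power2_eq_square)
  qed
  then show "sqi f'" using m by (simp add: sqi_def)
  have "integrable HL (\<lambda>x. 3 * (k\<^sup>2 * (f x)\<^sup>2 - (f' x)\<^sup>2))"
    by (intro integrable_mult_right Bochner_Integration.integrable_diff soliton_mass(1)[OF s] i')
  then show "integrable HL (\<lambda>x. f x ^ 6)"
    by (rule HL_integrable_cong[THEN iffD1, rotated]) (use solitonD(5)[OF s] in auto)
qed

text \<open>By the equation and the first integral (f f')' = 2f'^2 - (2/3) f^6, which is four times
  the energy density; the energy of a half-soliton is therefore a boundary term.\<close>

lemma soliton_energy:
  assumes s: "soliton k f f'"
  shows "(\<integral>x. (f' x)\<^sup>2 \<partial>HL) / 2 - (\<integral>x. f x ^ 6 \<partial>HL) / 6 = - (f 0 * f' 0) / 4"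
proof -
  have i: "integrable HL (\<lambda>x. (f' x)\<^sup>2)" "integrable HL (\<lambda>x. f x ^ 6)"
    using soliton_H1[OF s] by (auto simp: sqi_def)
  have p: "prim (\<lambda>x. f x * f' x) (\<lambda>x. 2 * (f' x)\<^sup>2 - 2 / 3 * f x ^ 6)"
  proof (rule prim_C1)
    fix x :: real assume x: "0 \<le> x"
    have "((\<lambda>x. f x * f' x) has_real_derivative f' x * f' x + (k\<^sup>2 * f x - f x ^ 5) * f x) (at x within {0..})"
      by (rule DERIV_mult[OF solitonD(3)[OF s x] solitonD(4)[OF s x]])
    moreover have "f' x * f' x + (k\<^sup>2 * f x - f x ^ 5) * f x = 2 * (f' x)\<^sup>2 - 2 / 3 * f x ^ 6"
    proof -
      have "f' x * f' x + (k\<^sup>2 * f x - f x ^ 5) * f x = (f' x)\<^sup>2 + k\<^sup>2 * (f x)\<^sup>2 - f x ^ 6"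
        by (simp add: algebra_simps power2_eq_square power_numeral_reduce)
      then show ?thesis using solitonD(5)[OF s x] by simp
    qed
    ultimately show "((\<lambda>x. f x * f' x) has_vector_derivative 2 * (f' x)\<^sup>2 - 2 / 3 * f x ^ 6) (at x within {0..})"
      by (simp add: has_real_derivative_iff_has_vector_derivative)
  qed (intro continuous_intros soliton_continuous[OF s])
  have ii: "integrable HL (\<lambda>x. 2 * (f' x)\<^sup>2 - 2 / 3 * f x ^ 6)" using i by simp
  then have lim: "((\<lambda>x. f x * f' x) \<longlongrightarrow> f 0 * f' 0 + (\<integral>x. 2 * (f' x)\<^sup>2 - 2 / 3 * f x ^ 6 \<partial>HL)) at_top"
    using prim_limit_at_top[OF p] by (simp add: HL_integrable_iff HL_integral)
  have "((\<lambda>x. f x * f' x) \<longlongrightarrow> 0) at_top"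
  proof (rule Lim_null_comparison)
    show "\<forall>\<^sub>F x in at_top. norm (f x * f' x) \<le> k * (f x)\<^sup>2"
      using eventually_ge_at_top[of 0]
    proof eventually_elim
      case (elim x)
      have p: "f x > 0" "k > 0" using solitonD[OF s] elim by auto
      have "(f' x)\<^sup>2 \<le> (k * f x)\<^sup>2" using solitonD(5)[OF s elim] p by (simp add: power_mult_distrib)
      then have "\<bar>f' x\<bar> \<le> k * f x" using p by (simp add: abs_le_square_iff[symmetric])
      then have "f x * \<bar>f' x\<bar> \<le> f x * (k * f x)" using p by (intro mult_left_mono) auto
      then show ?case using p by (simp add: abs_mult power2_eq_square mult_ac)
    qed
    have "((\<lambda>x. k * (f x)\<^sup>2) \<longlongrightarrow> k * 0\<^sup>2) at_top" by (intro tendsto_intros solitonD(6)[OF s])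
    then show "((\<lambda>x. k * (f x)\<^sup>2) \<longlongrightarrow> 0) at_top" by simp
  qed
  then have "f 0 * f' 0 + (\<integral>x. 2 * (f' x)\<^sup>2 - 2 / 3 * f x ^ 6 \<partial>HL) = 0"
    by (rule tendsto_unique[OF trivial_limit_at_top_linorder lim])
  then show ?thesis using i by (simp add: field_simps)
qed

text \<open>The phase $p = \mathrm{arsinh}(\cot\theta)$ satisfies $\tanh p = \cos\theta$, which makes $\theta$ the soliton
  angle at the vertex.\<close>

definition sech_profile :: "real \<Rightarrow> real \<Rightarrow> real \<Rightarrow> real" where
  "sech_profile k \<theta> x = sqrt (sqrt 3 * k / cosh (2 * k * x + arsinh (cos \<theta> / sin \<theta>)))"

definition sech_profile_deriv :: "real \<Rightarrow> real \<Rightarrow> real \<Rightarrow> real" where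
  "sech_profile_deriv k \<theta> x = - k * tanh (2 * k * x + arsinh (cos \<theta> / sin \<theta>)) * sech_profile k \<theta> x"

text \<open>With z the argument of cosh, f' = -k tanh(z) f and f^4 = 3k^2 (1 - tanh(z)^2); the
  equation and the first integral both reduce to these two relations.\<close>

lemma sech_profile_soliton:
  assumes k: "k > 0" shows "soliton k (sech_profile k \<theta>) (sech_profile_deriv k \<theta>)"
proof -
  define p where "p = arsinh (cos \<theta> / sin \<theta>)"
  define z where "z = (\<lambda>x. 2 * k * x + p)"
  define f where "f = (\<lambda>x. sqrt (sqrt 3 * k / cosh (z x)))"
  define f' where "f' = (\<lambda>x. - k * tanh (z x) * f x)"
  have ef: "sech_profile k \<theta> = f" "sech_profile_deriv k \<theta> = f'"
    by (auto simp: fun_eq_iff sech_profile_def sech_profile_deriv_def f_def f'_def z_def p_def)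
  have fpos: "f x > 0" for x using k by (simp add: f_def)
  have f2: "(f x)\<^sup>2 = sqrt 3 * k / cosh (z x)" for x using k by (simp add: f_def)
  have ct: "1 / (cosh (z x))\<^sup>2 = 1 - (tanh (z x))\<^sup>2" for x
  proof -
    have "cosh (z x) * tanh (z x) = sinh (z x)" by (simp add: tanh_def)
    then have "(cosh (z x))\<^sup>2 * (1 - (tanh (z x))\<^sup>2) = (cosh (z x))\<^sup>2 - (sinh (z x))\<^sup>2"
      by (metis mult.right_neutral power_mult_distrib right_diff_distrib)
    also have "\<dots> = 1" unfolding cosh_square_eq[of "z x"] by (rule add_diff_cancel_left')
    finally have m: "(cosh (z x))\<^sup>2 * (1 - (tanh (z x))\<^sup>2) = 1" .
    have c: "(cosh (z x))\<^sup>2 \<noteq> 0" by simp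
    show ?thesis using m nonzero_mult_div_cancel_left[OF c, of "1 - (tanh (z x))\<^sup>2"] by (simp only:)
  qed
  have f4: "f x ^ 4 = 3 * k\<^sup>2 * (1 - (tanh (z x))\<^sup>2)" for x
  proof -
    have "f x ^ 4 = ((f x)\<^sup>2)\<^sup>2" by (simp flip: power_mult)
    also have "\<dots> = 3 * k\<^sup>2 * (1 / (cosh (z x))\<^sup>2)" unfolding f2 by (simp add: power_divide power_mult_distrib)
    finally show ?thesis unfolding ct .
  qed
  have dz: "(z has_real_derivative 2 * k) (at x within {0..})" for x
    unfolding z_def by (auto intro!: derivative_eq_intros)
  have DERIV_cosh': "(cosh has_real_derivative sinh y) (at y)" for y :: real
    by (auto intro!: derivative_eq_intros)
  have df: "(f has_real_derivative f' x) (at x within {0..})" for x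
  proof -
    have pos: "sqrt 3 * k / cosh (z x) > 0" using k by simp
    have "((\<lambda>x. sqrt 3 * k / cosh (z x)) has_real_derivative (0 * cosh (z x) - sqrt 3 * k * (sinh (z x) * (2 * k))) / (cosh (z x) * cosh (z x))) (at x within {0..})"
      by (intro DERIV_divide DERIV_const DERIV_chain2[where f = cosh and g = z, OF DERIV_cosh' dz]) simp
    from DERIV_chain2[where f = sqrt and g = "\<lambda>x. sqrt 3 * k / cosh (z x)", OF DERIV_real_sqrt[OF pos] this]
    have "(f has_real_derivative inverse (sqrt (sqrt 3 * k / cosh (z x))) / 2 * ((0 * cosh (z x) - sqrt 3 * k * (sinh (z x) * (2 * k))) / (cosh (z x) * cosh (z x)))) (at x within {0..})"
      unfolding f_def .
    moreover have "inverse (sqrt (sqrt 3 * k / cosh (z x))) / 2 * ((0 * cosh (z x) - sqrt 3 * k * (sinh (z x) * (2 * k))) / (cosh (z x) * cosh (z x))) = f' x"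
    proof -
      have "(0 * cosh (z x) - sqrt 3 * k * (sinh (z x) * (2 * k))) / (cosh (z x) * cosh (z x)) = - 2 * k * tanh (z x) * (f x)\<^sup>2"
        unfolding f2 by (simp add: tanh_def field_simps)
      moreover have "sqrt (sqrt 3 * k / cosh (z x)) = f x" by (simp add: f_def)
      ultimately show ?thesis using fpos[of x] by (simp add: f'_def field_simps power2_eq_square)
    qed
    ultimately show ?thesis by simp
  qed
  have dt: "((\<lambda>x. tanh (z x)) has_real_derivative (1 - (tanh (z x))\<^sup>2) * (2 * k)) (at x within {0..})" for x
    by (rule DERIV_chain2[where f = tanh and g = z, OF _ dz]) (auto intro!: derivative_eq_intros)
  have df': "(f' has_real_derivative k\<^sup>2 * f x - f x ^ 5) (at x within {0..})" for x
  proof -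
    have "(f' has_real_derivative (- k * ((1 - (tanh (z x))\<^sup>2) * (2 * k))) * f x + f' x * (- k * tanh (z x))) (at x within {0..})"
      unfolding f'_def by (intro DERIV_mult DERIV_cmult dt df[unfolded f'_def])
    moreover have "(- k * ((1 - (tanh (z x))\<^sup>2) * (2 * k))) * f x + f' x * (- k * tanh (z x)) = k\<^sup>2 * f x - f x ^ 5"
    proof -
      have "f x ^ 5 = f x ^ 4 * f x" by (simp add: power_numeral_reduce)
      then show ?thesis unfolding f4 f'_def by (simp add: algebra_simps power2_eq_square)
    qed
    ultimately show ?thesis by simp
  qed
  have fi: "(f' x)\<^sup>2 = k\<^sup>2 * (f x)\<^sup>2 - f x ^ 6 / 3" for x
  proof -
    have "f x ^ 6 = f x ^ 4 * (f x)\<^sup>2" by (simp flip: power_add)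
    then show ?thesis unfolding f4 f'_def by (simp add: power_mult_distrib algebra_simps)
  qed
  have lim: "(f \<longlongrightarrow> 0) at_top"
  proof -
    have "LIM x at_top. 2 * k * x :> at_top"
      using k by (intro filterlim_tendsto_pos_mult_at_top[OF tendsto_const _ filterlim_ident]) auto
    then have "LIM x at_top. p + 2 * k * x :> at_top" by (rule filterlim_tendsto_add_at_top[OF tendsto_const])
    then have zt: "LIM x at_top. z x :> at_top" by (simp add: z_def add.commute)
    have "LIM x at_top. cosh (z x) :> at_top"
      by (rule filterlim_compose[OF cosh_real_at_top zt])
    then have "LIM x at_top. cosh (z x) :> at_infinity" by (rule filterlim_at_top_imp_at_infinity)
    then have "((\<lambda>x. sqrt 3 * k / cosh (z x)) \<longlongrightarrow> 0) at_top" by (rule tendsto_divide_0[OF tendsto_const])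
    from tendsto_real_sqrt[OF this] show ?thesis by (simp add: f_def)
  qed
  show ?thesis unfolding soliton_def ef using k fpos df df' fi lim by auto
qed

lemma sech_profile_0:
  assumes k: "k > 0" and \<theta>: "0 < \<theta>" "\<theta> < pi"
  shows "(sech_profile k \<theta> 0)\<^sup>2 = sqrt 3 * k * sin \<theta>"
    "sech_profile_deriv k \<theta> 0 = - k * cos \<theta> * sech_profile k \<theta> 0"
    "soliton_angle k (sech_profile k \<theta>) (sech_profile_deriv k \<theta>) 0 = \<theta>"
proof -
  define p where "p = arsinh (cos \<theta> / sin \<theta>)"
  have s: "sin \<theta> > 0" using \<theta> by (rule sin_gt_zero)
  have sh: "sinh p = cos \<theta> / sin \<theta>" by (simp add: p_def)
  have "(cosh p)\<^sup>2 = (1 / sin \<theta>)\<^sup>2"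
    unfolding cosh_square_eq sh using s sin_cos_squared_add[of \<theta>] by (simp add: power_divide field_simps)
  then have ch: "cosh p = 1 / sin \<theta>" using s cosh_real_pos[of p] by (simp add: power2_eq_iff_nonneg)
  have th: "tanh p = cos \<theta>" unfolding tanh_def sh ch using s by simp
  show f2: "(sech_profile k \<theta> 0)\<^sup>2 = sqrt 3 * k * sin \<theta>"
    using k s by (simp add: sech_profile_def p_def[symmetric] ch)
  show f': "sech_profile_deriv k \<theta> 0 = - k * cos \<theta> * sech_profile k \<theta> 0"
    by (simp add: sech_profile_deriv_def p_def[symmetric] th)
  have "sech_profile k \<theta> 0 > 0" using solitonD(2)[OF sech_profile_soliton[OF k]] by simp
  then show "soliton_angle k (sech_profile k \<theta>) (sech_profile_deriv k \<theta>) 0 = \<theta>"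
    unfolding soliton_angle_def f' using k \<theta> by (simp add: arccos_cos)
qed

section \<open>The first variation at a half-soliton\<close>

lemma soliton_H1pair:
  assumes "soliton k f f'" shows "H1pair (\<lambda>x. complex_of_real (f x)) (\<lambda>x. complex_of_real (f' x))"
  unfolding H1pair_def sqi_of_real using soliton_H1[OF assms] prim_of_real by blast

lemma half_diff_real:
  "half_diff (\<lambda>x. complex_of_real (f x)) (\<lambda>x. complex_of_real (f' x)) p p'
    = (\<integral>x. f' x * Re (p' x) \<partial>HL) - (\<integral>x. f x ^ 5 * Re (p x) \<partial>HL)"
proof -
  have "Re (complex_of_real a * cnj z) = a * Re z" for a z by simp
  moreover have "cmod (complex_of_real a) ^ 4 * (a * b) = a ^ 5 * b" for a b :: real
    by (simp add: power_even_abs power_numeral_reduce)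
  ultimately show ?thesis unfolding half_diff_def by (simp only:)
qed

text \<open>Integrating f' Re p' by parts and inserting f'' = k^2 f - f^5 cancels the f^5 term. The
  boundary term at infinity vanishes because |f'| <= k f tends to 0 and p is bounded; the one at the
  vertex remains.\<close>

lemma half_diff_soliton:
  assumes s: "soliton k f f'" and p: "H1pair p p'"
  shows "half_diff (\<lambda>x. complex_of_real (f x)) (\<lambda>x. complex_of_real (f' x)) p p'
    = - f' 0 * Re (p 0) - k\<^sup>2 * (\<integral>x. Re (complex_of_real (f x) * cnj (p x)) \<partial>HL)"
proof -
  let ?F = "\<lambda>x. complex_of_real (f x)" and ?F' = "\<lambda>x. complex_of_real (f' x)"
  note H = soliton_H1pair[OF s]
  have e1: "Re (?F x * cnj (p x)) = f x * Re (p x)" for x by simp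
  have e2: "Re (?F' x * cnj (p' x)) = f' x * Re (p' x)" for x by simp
  have e3: "cmod (?F x) ^ 4 * Re (?F x * cnj (p x)) = f x ^ 5 * Re (p x)" for x
    unfolding e1 by (simp add: power_even_abs power_numeral_reduce)
  have i1: "integrable HL (\<lambda>x. f x * Re (p x))" using sqi_inner[OF H1pairD(2)[OF H] H1pairD(2)[OF p]] unfolding e1 .
  have i2: "integrable HL (\<lambda>x. f' x * Re (p' x))" using sqi_inner[OF H1pairD(3)[OF H] H1pairD(3)[OF p]] unfolding e2 .
  have i3: "integrable HL (\<lambda>x. f x ^ 5 * Re (p x))" using pow4_inner_integrable[OF H H1pairD(2)[OF p]] unfolding e3 .
  have pf': "prim f' (\<lambda>x. k\<^sup>2 * f x - f x ^ 5)"
    by (rule prim_C1) (auto simp: has_real_derivative_iff_has_vector_derivative[symmetric]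
        intro!: solitonD(4)[OF s] continuous_intros soliton_continuous[OF s])
  have pr: "prim (\<lambda>x. f' x * Re (p x)) (\<lambda>x. (k\<^sup>2 * f x - f x ^ 5) * Re (p x) + f' x * Re (p' x))"
    using prim_scaleR[OF pf' prim_Re[OF H1pairD(1)[OF p]]] by simp
  have eq: "(\<lambda>x. (k\<^sup>2 * f x - f x ^ 5) * Re (p x) + f' x * Re (p' x))
      = (\<lambda>x. k\<^sup>2 * (f x * Re (p x)) - f x ^ 5 * Re (p x) + f' x * Re (p' x))" by (simp add: algebra_simps)
  have ii: "integrable HL (\<lambda>x. k\<^sup>2 * (f x * Re (p x)) - f x ^ 5 * Re (p x) + f' x * Re (p' x))"
    by (intro Bochner_Integration.integrable_add Bochner_Integration.integrable_diff integrable_mult_right i1 i2 i3)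
  have lim: "((\<lambda>x. f' x * Re (p x)) \<longlongrightarrow> f' 0 * Re (p 0) + (\<integral>x. k\<^sup>2 * (f x * Re (p x)) - f x ^ 5 * Re (p x) + f' x * Re (p' x) \<partial>HL)) at_top"
    using prim_limit_at_top[OF pr[unfolded eq]] ii unfolding HL_integrable_iff HL_integral by simp
  obtain B where B: "B \<ge> 0" "\<And>x. 0 \<le> x \<Longrightarrow> cmod (p x) \<le> B" using H1pair_bounded[OF p] by blast
  have lim0: "((\<lambda>x. f' x * Re (p x)) \<longlongrightarrow> 0) at_top"
  proof (rule Lim_null_comparison)
    show "\<forall>\<^sub>F x in at_top. norm (f' x * Re (p x)) \<le> k * f x * B"
      using eventually_ge_at_top[of 0]
    proof eventually_elim
      case (elim x)
      have q: "f x > 0" "k > 0" using solitonD(1)[OF s] solitonD(2)[OF s elim] by auto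
      have "f x ^ 6 \<ge> 0" using q by simp
      then have "(f' x)\<^sup>2 \<le> (k * f x)\<^sup>2" unfolding solitonD(5)[OF s elim] power_mult_distrib by linarith
      then have "\<bar>f' x\<bar> \<le> \<bar>k * f x\<bar>" by (simp only: abs_le_square_iff)
      then have "\<bar>f' x\<bar> \<le> k * f x" using q by simp
      moreover have "\<bar>Re (p x)\<bar> \<le> B" using abs_Re_le_cmod[of "p x"] B(2)[OF elim] by linarith
      ultimately show ?case unfolding real_norm_def abs_mult using q by (intro mult_mono) auto
    qed
    have "((\<lambda>x. k * f x * B) \<longlongrightarrow> k * 0 * B) at_top" by (intro tendsto_intros solitonD(6)[OF s])
    then show "((\<lambda>x. k * f x * B) \<longlongrightarrow> 0) at_top" by simp
  qed
  have "f' 0 * Re (p 0) + (\<integral>x. k\<^sup>2 * (f x * Re (p x)) - f x ^ 5 * Re (p x) + f' x * Re (p' x) \<partial>HL) = 0"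
    by (rule tendsto_unique[OF trivial_limit_at_top_linorder lim lim0])
  moreover have "(\<integral>x. k\<^sup>2 * (f x * Re (p x)) - f x ^ 5 * Re (p x) + f' x * Re (p' x) \<partial>HL)
     = k\<^sup>2 * (\<integral>x. f x * Re (p x) \<partial>HL) - (\<integral>x. f x ^ 5 * Re (p x) \<partial>HL) + (\<integral>x. f' x * Re (p' x) \<partial>HL)"
    using i1 i2 i3 by simp
  ultimately show ?thesis unfolding half_diff_real e1 by simp
qed

section \<open>Stationary states\<close>

text \<open>Differentials are unique on the space, so the existentially quantified functional in
  \<open>stationary_state\<close> may be replaced by the explicit one.\<close>

lemma stationary_state_iff:
  assumes r: "rep u v v' w w'" and D: "u \<in> Dmass \<tau> \<mu>"
  shows "stationary_state \<alpha> \<tau> \<mu> u \<longleftrightarrow> (\<forall>\<eta> p p' q q'. rep \<eta> p p' q q' \<longrightarrow> q 0 = of_real \<tau> * p 0 \<longrightarrow>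
    (\<integral>x. Re (v x * cnj (p x)) \<partial>HL) + (\<integral>x. Re (w x * cnj (q x)) \<partial>HL) = 0 \<longrightarrow> energy_diff \<alpha> v v' w w' p p' q q' = 0)"
    (is "_ \<longleftrightarrow> ?R")
proof
  assume "stationary_state \<alpha> \<tau> \<mu> u"
  then obtain L where L: "has_differential_on_D \<tau> (energy \<alpha>) L u"
    and L0: "\<forall>\<eta>\<in>Dspace \<tau>. Re (LBINT x. u x * cnj (\<eta> x)) = 0 \<longrightarrow> L \<eta> = 0"
    unfolding stationary_state_def by (elim conjE exE)
  show ?R
  proof (intro allI impI)
    fix \<eta> p p' q q' assume h: "rep \<eta> p p' q q'" and j: "q 0 = of_real \<tau> * p 0"
      and o: "(\<integral>x. Re (v x * cnj (p x)) \<partial>HL) + (\<integral>x. Re (w x * cnj (q x)) \<partial>HL) = 0"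
    have hD: "\<eta> \<in> Dspace \<tau>" using rep_Dspace[OF h] j by (rule iffD2)
    have "L \<eta> = 0" by (rule L0[rule_format, OF hD o[folded rep_inner[OF r h]]])
    moreover have "L \<eta> = energy_functional \<alpha> v v' w w' \<eta>"
      by (rule has_differential_on_D_unique[OF L energy_has_differential[OF r] hD])
    ultimately show "energy_diff \<alpha> v v' w w' p p' q q' = 0" unfolding energy_functional_eq[OF r h] by simp
  qed
next
  assume R: ?R
  show "stationary_state \<alpha> \<tau> \<mu> u"
    unfolding stationary_state_def
  proof (intro conjI D exI[of _ "energy_functional \<alpha> v v' w w'"] energy_has_differential[OF r] ballI impI)
    fix \<eta> assume hD: "\<eta> \<in> Dspace \<tau>" and o: "Re (LBINT x. u x * cnj (\<eta> x)) = 0"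
    obtain p p' q q' where h: "rep \<eta> p p' q q'" and j: "q 0 = of_real \<tau> * p 0" by (rule Dspace_rep[OF hD])
    show "energy_functional \<alpha> v v' w w' \<eta> = 0"
      unfolding energy_functional_eq[OF r h]
      by (rule R[rule_format, OF h j o[unfolded rep_inner[OF r h]]])
  qed
qed

text \<open>The du Bois-Reymond argument: if G is a primitive of h = l W - W^5, then W' - G is
  almost everywhere constant, so that W is twice differentiable. Decay then fixes the constant of
  the first integral.\<close>

lemma weak_solution_is_soliton:
  fixes W W' :: "real \<Rightarrow> real"
  assumes H: "H1pair (\<lambda>x. complex_of_real (W x)) (\<lambda>x. complex_of_real (W' x))" and pos: "\<And>x. x > 0 \<Longrightarrow> W x > 0"
    and weak: "\<And>Q Q'. prim Q Q' \<Longrightarrow> sqi Q \<Longrightarrow> sqi Q' \<Longrightarrow> Q 0 = 0 \<Longrightarrow>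
      (\<integral>x. W' x * Q' x \<partial>HL) + (\<integral>x. (l * W x - W x ^ 5) * Q x \<partial>HL) = 0"
  obtains Wd where "soliton (sqrt l) W Wd" "l > 0" "AE x in lborel. x > 0 \<longrightarrow> W' x = Wd x"
proof -
  have pW: "prim W W'" using prim_Re[OF H1pairD(1)[OF H]] by simp
  have sW: "sqi W" "sqi W'" using H1pairD(2,3)[OF H] by (auto simp: sqi_of_real)
  have cW: "continuous_on {0..} W" by (rule prim_continuous[OF pW])
  define h where "h = (\<lambda>x. l * W x - W x ^ 5)"
  have ch: "continuous_on {0..} h" unfolding h_def by (intro continuous_intros cW)
  define G where "G = (\<lambda>x. LBINT s:{0..x}. h s)"
  have pG: "prim G h" unfolding G_def
    by (rule prim_integral) (rule borel_integrable_atLeastAtMost'[OF continuous_on_subset[OF ch]], auto)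
  have cG: "continuous_on {0..} G" by (rule prim_continuous[OF pG])
  have z: "(LBINT s:{0..0}. f s) = 0" for f :: "real \<Rightarrow> real"
    using set_integral_Ioc_Icc[of 0 0 f] by (simp add: set_lebesgue_integral_def)
  have iG: "set_integrable lborel {0..x} G" for x by (rule borel_integrable_atLeastAtMost'[OF continuous_on_subset[OF cG]]) auto
  have iW': "set_integrable lborel {0..x} W'" for x by (rule prim_integrable[OF pW order_refl])
  have ic: "set_integrable lborel {0..x} (\<lambda>_. c)" for x c :: real by (rule borel_integrable_atLeastAtMost'[OF continuous_on_const])
  have loc: "\<exists>c. \<forall>x\<in>{0..R}. W x = W 0 + (LBINT s:{0..x}. G s + c)" if R: "R > 0" for R
  proof -
    \<comment> \<open>The mean value of W' - G over [0, R]: exactly the constant for which the test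
      function Q returns to 0 at R.\<close>
    define c where "c = (LBINT s:{0..R}. W' s - G s) / R"
    \<comment> \<open>Set to 0 beyond R, so that its primitive Q vanishes there and is square
      integrable.\<close>
    define \<psi> where "\<psi> = (\<lambda>x. indicat_real {..R} x * (W' x - G x - c))"
    have i\<psi>0: "set_integrable lborel {0..x} (\<lambda>s. W' s - G s - c)" for x
      by (intro set_integral_diff(1) iW' iG ic)
    have i\<psi>: "set_integrable lborel {0..x} \<psi>" for x
    proof -
      have "set_integrable lborel {0..min x R} (\<lambda>s. W' s - G s - c)" by (rule i\<psi>0)
      moreover have "(\<lambda>s. indicat_real {0..min x R} s *\<^sub>R (W' s - G s - c)) = (\<lambda>s. indicat_real {0..x} s *\<^sub>R \<psi> s)"
        by (auto simp: \<psi>_def fun_eq_iff split: split_indicator)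
      ultimately show ?thesis by (simp only: set_integrable_def)
    qed
    define Q where "Q = (\<lambda>x. LBINT s:{0..x}. \<psi> s)"
    have pQ: "prim Q \<psi>" unfolding Q_def by (rule prim_integral[OF i\<psi>])
    have Q0: "Q 0 = 0" by (simp only: Q_def z)
    have \<psi>R: "(LBINT s:{0..x}. \<psi> s) = (LBINT s:{0..x}. W' s - G s - c)" if "x \<le> R" for x
      unfolding set_lebesgue_integral_def \<psi>_def using that
      by (intro Bochner_Integration.integral_cong) (auto split: split_indicator)
    have QR: "Q R = 0"
    proof -
      have "Q R = (LBINT s:{0..R}. W' s - G s) - (LBINT s:{0..R}. c)"
        unfolding Q_def \<psi>R[OF order_refl] by (rule set_integral_diff(2)[OF set_integral_diff(1)[OF iW' iG] ic])
      moreover have "(LBINT s:{0..R}. c) = c * R" using R by (simp add: set_lebesgue_integral_def)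
      ultimately show ?thesis using R by (simp add: c_def)
    qed
    have Qx: "Q x = 0" if "x \<ge> R" for x
    proof -
      have "Q x - Q R = (LBINT s:{R..x}. \<psi> s)" by (rule prim_diff[OF pQ]) (use R that in auto)
      also have "\<dots> = (LBINT s:{R<..x}. \<psi> s)" by (rule set_integral_Ioc_Icc[symmetric])
      also have "\<dots> = (LBINT s:{R<..x}. 0)"
        unfolding set_lebesgue_integral_def \<psi>_def by (intro Bochner_Integration.integral_cong) (auto split: split_indicator)
      finally show ?thesis using QR by simp
    qed
    have m\<psi>: "\<psi> \<in> borel_measurable HL" by (rule prim_measurable[OF pQ])
    have cQ: "continuous_on {0..} Q" by (rule prim_continuous[OF pQ])
    have cut: "(\<integral>x. F x \<partial>HL) = (LBINT x:{0..R}. F x)" "integrable HL F \<longleftrightarrow> set_integrable lborel {0..R} F"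
      if "\<And>x. x > R \<Longrightarrow> F x = 0" for F :: "real \<Rightarrow> real"
    proof -
      have e: "(\<lambda>x. indicat_real {0<..} x *\<^sub>R F x) = (\<lambda>x. indicat_real {0<..R} x *\<^sub>R F x)"
        using that by (auto simp: fun_eq_iff split: split_indicator)
      show "(\<integral>x. F x \<partial>HL) = (LBINT x:{0..R}. F x)"
      proof -
        have "(\<integral>x. F x \<partial>HL) = (LBINT x:{0<..}. F x)" by (rule HL_integral[symmetric])
        also have "\<dots> = (LBINT x:{0<..R}. F x)" unfolding set_lebesgue_integral_def e ..
        finally show ?thesis unfolding set_integral_Ioc_Icc .
      qed
      show "integrable HL F \<longleftrightarrow> set_integrable lborel {0..R} F"
      proof -
        have "integrable HL F = set_integrable lborel {0<..} F" by (rule HL_integrable_iff[symmetric])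
        also have "\<dots> = set_integrable lborel {0<..R} F" unfolding set_integrable_def e ..
        finally show ?thesis unfolding set_integrable_Ioc_Icc .
      qed
    qed
    have sQ: "sqi Q"
    proof -
      have "integrable HL (\<lambda>x. (Q x)\<^sup>2)"
        by (subst cut(2)) (auto simp: Qx intro!: borel_integrable_atLeastAtMost' continuous_intros continuous_on_subset[OF cQ])
      then show ?thesis using prim_HL_measurable[OF pQ] by (simp add: sqi_def)
    qed
    have s\<psi>: "sqi \<psi>"
    proof -
      have cGc: "continuous_on {0..R} (\<lambda>x. G x + c)" by (intro continuous_intros continuous_on_subset[OF cG]) auto
      have i1: "integrable HL (\<lambda>x. 2 * (W' x)\<^sup>2)" using sqi_integrable[OF sW(2)] by simp
      have i2: "integrable HL (\<lambda>x. 2 * (indicat_real {..R} x * (G x + c)\<^sup>2))"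
      proof -
        have "set_integrable lborel {0..R} (\<lambda>x. (G x + c)\<^sup>2)" by (intro borel_integrable_atLeastAtMost' continuous_intros cGc)
        moreover have "(\<lambda>x. indicat_real {0..R} x *\<^sub>R (G x + c)\<^sup>2) = (\<lambda>x. indicat_real {0..R} x *\<^sub>R (indicat_real {..R} x * (G x + c)\<^sup>2))"
          by (auto simp: fun_eq_iff split: split_indicator)
        ultimately have "set_integrable lborel {0..R} (\<lambda>x. indicat_real {..R} x * (G x + c)\<^sup>2)" by (simp only: set_integrable_def)
        then have "integrable HL (\<lambda>x. indicat_real {..R} x * (G x + c)\<^sup>2)" by (subst cut(2)) auto
        then show ?thesis by simp
      qed
      have "integrable HL (\<lambda>x. (\<psi> x)\<^sup>2)"
      proof (rule Bochner_Integration.integrable_bound[OF Bochner_Integration.integrable_add[OF i1 i2]])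
        show "(\<lambda>x. (\<psi> x)\<^sup>2) \<in> borel_measurable HL" using m\<psi> by measurable
        show "AE x in HL. norm ((\<psi> x)\<^sup>2) \<le> norm (2 * (W' x)\<^sup>2 + 2 * (indicat_real {..R} x * (G x + c)\<^sup>2))"
        proof (rule AE_I2)
          fix x
          have "(a - b)\<^sup>2 = 2 * a\<^sup>2 + 2 * b\<^sup>2 - (a + b)\<^sup>2" for a b :: real
            by (simp add: power2_eq_square algebra_simps)
          from this[of "W' x" "G x + c"] have "(W' x - (G x + c))\<^sup>2 \<le> 2 * (W' x)\<^sup>2 + 2 * (G x + c)\<^sup>2"
            using zero_le_power2[of "W' x + (G x + c)"] by linarith
          then show "norm ((\<psi> x)\<^sup>2) \<le> norm (2 * (W' x)\<^sup>2 + 2 * (indicat_real {..R} x * (G x + c)\<^sup>2))"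
            by (simp add: \<psi>_def power_mult_distrib diff_diff_eq split: split_indicator)
        qed
      qed
      then show ?thesis using m\<psi> by (simp add: sqi_def)
    qed
    have "(\<integral>x. W' x * \<psi> x \<partial>HL) + (\<integral>x. h x * Q x \<partial>HL) = 0"
      unfolding h_def by (rule weak[OF pQ sQ s\<psi> Q0])
    moreover have "(\<integral>x. W' x * \<psi> x \<partial>HL) = (LBINT x:{0..R}. W' x * \<psi> x)" by (rule cut(1)) (simp add: \<psi>_def)
    moreover have "(\<integral>x. h x * Q x \<partial>HL) = (LBINT x:{0..R}. h x * Q x)" by (rule cut(1)) (simp add: Qx)
    ultimately have e1: "(LBINT x:{0..R}. W' x * \<psi> x) + (LBINT x:{0..R}. h x * Q x) = 0" by simp
    have cGR: "continuous_on {0..R} G" and cQR: "continuous_on {0..R} Q" and chR: "continuous_on {0..R} h"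
      using cG cQ ch by (auto elim: continuous_on_subset)
    have ihQ: "set_integrable lborel {0..R} (\<lambda>x. h x * Q x)"
      by (intro borel_integrable_atLeastAtMost' continuous_intros chR cQR)
    have iG\<psi>: "set_integrable lborel {0..R} (\<lambda>x. G x * \<psi> x)"
      using set_integrable_continuous_scaleR[OF cGR i\<psi> cQR i\<psi>] by simp
    \<comment> \<open>Integration by parts replaces the term with h by -int G \<psi>. With the weak
      equation int (W' - G) \<psi> = 0, and as int c \<psi> = 0 too, int \<psi>^2 = 0.\<close>
    have e2: "(LBINT x:{0..R}. h x * Q x) + (LBINT x:{0..R}. G x * \<psi> x) = 0"
    proof -
      have "G R *\<^sub>R Q R - G 0 *\<^sub>R Q 0 = (LBINT x:{0..R}. h x *\<^sub>R Q x + G x *\<^sub>R \<psi> x)"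
        by (rule prim_diff[OF prim_scaleR[OF pG pQ]]) (use R in auto)
      also have "\<dots> = (LBINT x:{0..R}. h x * Q x) + (LBINT x:{0..R}. G x * \<psi> x)"
        unfolding real_scaleR_def by (rule set_integral_add(2)[OF ihQ iG\<psi>])
      finally show ?thesis by (simp add: Q0 QR)
    qed
    have e3: "(LBINT x:{0..R}. c * \<psi> x) = 0" using QR by (simp add: Q_def)
    have i\<psi>2: "integrable HL (\<lambda>x. (\<psi> x)\<^sup>2)" using sqi_integrable[OF s\<psi>] by simp
    have iW\<psi>: "set_integrable lborel {0..R} (\<lambda>x. W' x * \<psi> x)"
    proof -
      have "integrable HL (\<lambda>x. W' x * \<psi> x)"
        by (rule sqi_mult[OF sW(2) s\<psi>, where C = 1])
          (use sqi_measurable[OF sW(2)] m\<psi> in \<open>auto simp: abs_mult\<close>)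
      then show ?thesis by (subst cut(2)[symmetric]) (auto simp: \<psi>_def)
    qed
    have ic\<psi>: "set_integrable lborel {0..R} (\<lambda>x. c * \<psi> x)" by (intro set_integrable_mult_right i\<psi>)
    have "(\<integral>x. (\<psi> x)\<^sup>2 \<partial>HL) = (LBINT x:{0..R}. (\<psi> x)\<^sup>2)" by (rule cut(1)) (simp add: \<psi>_def)
    also have "\<dots> = (LBINT x:{0..R}. W' x * \<psi> x - G x * \<psi> x - c * \<psi> x)"
      unfolding set_lebesgue_integral_def \<psi>_def
      by (intro Bochner_Integration.integral_cong) (auto simp: power2_eq_square algebra_simps split: split_indicator)
    also have "\<dots> = (LBINT x:{0..R}. W' x * \<psi> x) - (LBINT x:{0..R}. G x * \<psi> x) - (LBINT x:{0..R}. c * \<psi> x)"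
      by (simp only: set_integral_diff(2)[OF set_integral_diff(1)[OF iW\<psi> iG\<psi>] ic\<psi>] set_integral_diff(2)[OF iW\<psi> iG\<psi>])
    also have "\<dots> = 0" using e1 e2 e3 by linarith
    finally have "AE x in HL. (\<psi> x)\<^sup>2 = 0" using i\<psi>2 by (subst (asm) integral_nonneg_eq_0_iff_AE) auto
    then have ae: "AE x in lborel. x > 0 \<longrightarrow> \<psi> x = 0" by (simp add: HL_AE_iff)
    show ?thesis
    proof (intro exI[of _ c] ballI)
      fix x assume x: "x \<in> {0..R}"
      have "W x = W 0 + (LBINT s:{0..x}. W' s)" by (rule prim_eq[OF pW]) (use x in simp)
      also have "(LBINT s:{0..x}. W' s) = (LBINT s:{0..x}. G s + c)"
      proof -
        have "(LBINT s:{0..x}. W' s) - (LBINT s:{0..x}. G s + c) = (LBINT s:{0..x}. W' s - (G s + c))"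
          by (rule set_integral_diff(2)[symmetric]) (intro set_integral_add(1) iW' iG ic)+
        also have "\<dots> = (LBINT s:{0..x}. \<psi> s)" using \<psi>R[of x] x by (simp add: diff_diff_eq)
        also have "\<dots> = (LBINT s:{0<..x}. \<psi> s)" by (rule set_integral_Ioc_Icc[symmetric])
        also have "\<dots> = 0"
          unfolding set_lebesgue_integral_def
          by (rule integral_eq_zero_AE) (use ae in \<open>eventually_elim, auto split: split_indicator\<close>)
        finally show ?thesis by simp
      qed
      finally show "W x = W 0 + (LBINT s:{0..x}. G s + c)" .
    qed
  qed
  \<comment> \<open>Evaluation at 1 determines the constant, so the constants for all R >= 1
    coincide.\<close>
  define c where "c = W 1 - W 0 - (LBINT s:{0..1}. G s)"
  have cc: "c' = c" if "\<forall>x\<in>{0..R}. W x = W 0 + (LBINT s:{0..x}. G s + c')" "R \<ge> 1" for c' R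
  proof -
    have "W 1 = W 0 + (LBINT s:{0..1}. G s + c')" by (rule bspec[OF that(1)]) (use that(2) in simp)
    also have "(LBINT s:{0..1}. G s + c') = (LBINT s:{0..1}. G s) + (LBINT s:{0..1::real}. c')"
      by (rule set_integral_add(2)[OF iG ic])
    also have "(LBINT s:{0..1::real}. c') = c'" by (simp add: set_lebesgue_integral_def)
    finally show ?thesis by (simp add: c_def)
  qed
  define Wd where "Wd = (\<lambda>x. G x + c)"
  have pWd: "prim W Wd"
  proof (rule primI)
    show "set_integrable lborel {0..x} Wd" for x unfolding Wd_def by (intro set_integral_add(1) iG ic)
    fix x :: real assume x: "0 \<le> x"
    have "max 1 x > 0" by simp
    from loc[OF this] obtain c' where c': "\<forall>y\<in>{0..max 1 x}. W y = W 0 + (LBINT s:{0..y}. G s + c')" ..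
    have e: "c' = c" by (rule cc[OF c']) simp
    show "W x = W 0 + (LBINT s:{0..x}. Wd s)"
      unfolding Wd_def by (rule bspec[OF c'[unfolded e]]) (use x in simp)
  qed
  have cWd: "continuous_on {0..} Wd" unfolding Wd_def by (intro continuous_intros cG)
  have d1: "(W has_real_derivative Wd x) (at x within {0..})" if "0 \<le> x" for x
    using prim_has_derivative[OF pWd cWd that] by (simp add: has_real_derivative_iff_has_vector_derivative)
  have d2: "(Wd has_real_derivative l * W x - W x ^ 5) (at x within {0..})" if "0 \<le> x" for x
  proof -
    have "(G has_real_derivative h x) (at x within {0..})"
      using prim_has_derivative[OF pG ch that] by (simp add: has_real_derivative_iff_has_vector_derivative)
    then have "(Wd has_real_derivative h x + 0) (at x within {0..})" unfolding Wd_def by (intro DERIV_add DERIV_const)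
    then show ?thesis by (simp add: h_def)
  qed
  have ae: "AE x in lborel. x > 0 \<longrightarrow> W' x = Wd x" by (rule prim_unique_real[OF pW pWd])
  have iWd2: "integrable HL (\<lambda>x. (Wd x)\<^sup>2)"
  proof -
    have m: "Wd \<in> borel_measurable HL" by (rule prim_measurable[OF pWd])
    have "integrable HL (\<lambda>x. (W' x)\<^sup>2) = integrable HL (\<lambda>x. (Wd x)\<^sup>2)"
      using ae sqi_measurable[OF sW(2)] m by (intro integrable_cong_AE) (auto simp: HL_AE_iff elim!: eventually_mono)
    then show ?thesis using sqi_integrable[OF sW(2)] by simp
  qed
  have W0: "W x \<ge> 0" if "x \<ge> 0" for x
  proof (cases "x = 0")
    case True
    have "(W \<longlongrightarrow> W 0) (at 0 within {0..})" using cW unfolding continuous_on_def by (auto dest: bspec[of _ _ 0])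
    then have "(W \<longlongrightarrow> W 0) (at_right 0)" by (rule tendsto_within_subset) auto
    then have "0 \<le> W 0"
      by (rule tendsto_lowerbound) (auto intro!: eventually_mono[OF eventually_at_right_less[of 0]] less_imp_le pos)
    then show ?thesis using True by simp
  qed (use pos[of x] that in auto)
  have W2lim: "((\<lambda>x. (W x)\<^sup>2) \<longlongrightarrow> 0) at_top" using H1pair_tendsto_0[OF H] by simp
  have Wlim: "(W \<longlongrightarrow> 0) at_top"
  proof -
    have "((\<lambda>x. sqrt ((W x)\<^sup>2)) \<longlongrightarrow> sqrt 0) at_top" by (rule tendsto_real_sqrt[OF W2lim])
    then show ?thesis by (simp add: tendsto_rabs_zero_iff)
  qed
  \<comment> \<open>The first integral. Its constant value is the limit of Wd^2 at infinity, and an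
    integrable nonnegative function can only have the limit 0.\<close>
  define J where "J = (\<lambda>x. (Wd x)\<^sup>2 - l * (W x)\<^sup>2 + W x ^ 6 / 3)"
  have dJ: "(J has_real_derivative 0) (at x within {0..})" if "x \<in> {0..}" for x
  proof -
    have x: "0 \<le> x" using that by simp
    have "(J has_real_derivative of_nat 2 * ((l * W x - W x ^ 5) * Wd x ^ (2 - Suc 0)) - l * (of_nat 2 * (Wd x * W x ^ (2 - Suc 0)))
        + of_nat 6 * (Wd x * W x ^ (6 - Suc 0)) / 3) (at x within {0..})"
      unfolding J_def by (intro DERIV_add DERIV_diff DERIV_cmult DERIV_cdivide DERIV_power d1[OF x] d2[OF x])
    moreover have "of_nat 2 * ((l * W x - W x ^ 5) * Wd x ^ (2 - Suc 0)) - l * (of_nat 2 * (Wd x * W x ^ (2 - Suc 0)))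
        + of_nat 6 * (Wd x * W x ^ (6 - Suc 0)) / 3 = 0" by (simp add: algebra_simps)
    ultimately show ?thesis by simp
  qed
  have "\<exists>C. \<forall>x\<in>{0..}. J x = C"
    by (rule has_field_derivative_zero_constant[OF convex_real_interval(1) dJ])
  then obtain C where C: "\<forall>x\<in>{0..}. J x = C" ..
  have Weq: "(Wd x)\<^sup>2 = C + l * (W x)\<^sup>2 - W x ^ 6 / 3" if "0 \<le> x" for x
    using bspec[OF C, of x] that by (simp add: J_def)
  have t: "((\<lambda>x. C + l * (W x)\<^sup>2 - W x ^ 6 / 3) \<longlongrightarrow> C + l * 0 - 0 ^ 6 / 3) at_top"
    by (intro tendsto_intros W2lim Wlim) simp
  have "((\<lambda>x. (Wd x)\<^sup>2) \<longlongrightarrow> C + l * 0 - 0 ^ 6 / 3) at_top"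
    by (rule Lim_transform_eventually[OF t]) (rule eventually_mono[OF eventually_ge_at_top[of 0]], simp add: Weq)
  then have "C + l * 0 - 0 ^ 6 / 3 = 0" by (intro integrable_limit_zero[OF iWd2]) auto
  then have C0: "C = 0" by simp
  have fi: "(Wd x)\<^sup>2 = l * (W x)\<^sup>2 - W x ^ 6 / 3" if "0 \<le> x" for x
    using Weq[OF that] C0 by simp
  \<comment> \<open>A nonpositive l would make the right side of the first integral negative at
    1.\<close>
  have l: "l > 0"
  proof -
    have "W 1 > 0" by (rule pos) simp
    then have p: "(W 1)\<^sup>2 > 0" "W 1 ^ 6 > 0" by auto
    have "0 \<le> l * (W 1)\<^sup>2 - W 1 ^ 6 / 3" unfolding fi[of 1, OF zero_le_one, symmetric] by simp
    then have "0 < l * (W 1)\<^sup>2" using p(2) by linarith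
    then show ?thesis using p(1) by (rule zero_less_mult_pos2)
  qed
  have slope: "Wd x \<le> sqrt l * W x" if x: "0 \<le> x" for x
  proof -
    have "W x ^ 6 \<ge> 0" using W0[OF x] by simp
    then have "(Wd x)\<^sup>2 \<le> (sqrt l * W x)\<^sup>2" unfolding fi[OF x] power_mult_distrib using l by simp
    then have "\<bar>Wd x\<bar> \<le> \<bar>sqrt l * W x\<bar>" by (simp only: abs_le_square_iff)
    then show ?thesis using W0[OF x] l by simp
  qed
  \<comment> \<open>Positivity is given only on the open half-line. By Wd <= sqrt l W the function W
    exp(-sqrt l x) is nonincreasing, so W 0 = 0 would force W 1 <= 0.\<close>
  have pos0: "W 0 > 0"
  proof (rule ccontr)
    assume "\<not> W 0 > 0"
    then have z0: "W 0 = 0" using W0[of 0] by simp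
    define E where "E = (\<lambda>x. W x * exp (- (sqrt l * x)))"
    have "E 1 \<le> E 0"
    proof (rule DERIV_nonpos_imp_decreasing_open[OF zero_le_one])
      show "\<exists>d. (E has_real_derivative d) (at x) \<and> d \<le> 0" if x: "0 < x" "x < 1" for x :: real
      proof -
        have e: "at x within {0..} = at x" using x by (intro at_within_interior) auto
        have dW: "(W has_real_derivative Wd x) (at x)" using d1[of x] x unfolding e by simp
        have "(E has_real_derivative Wd x * exp (- (sqrt l * x)) + exp (- (sqrt l * x)) * (- sqrt l) * W x) (at x)"
          unfolding E_def by (intro DERIV_mult dW) (auto intro!: derivative_eq_intros)
        moreover have "Wd x * exp (- (sqrt l * x)) + exp (- (sqrt l * x)) * (- sqrt l) * W x = (Wd x - sqrt l * W x) * exp (- (sqrt l * x))"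
          by (simp add: algebra_simps)
        moreover have "(Wd x - sqrt l * W x) * exp (- (sqrt l * x)) \<le> 0"
          using slope[of x] x by (intro mult_nonpos_nonneg) auto
        ultimately show ?thesis by auto
      qed
      show "continuous_on {0..1} E" unfolding E_def by (intro continuous_intros continuous_on_subset[OF cW]) auto
    qed
    moreover have "E 1 > 0" unfolding E_def using pos[of 1] by simp
    ultimately show False by (simp add: E_def z0)
  qed
  have posW: "0 < W x" if "0 \<le> x" for x using pos0 pos[of x] that by (cases "x = 0") auto
  have "soliton (sqrt l) W Wd"
    unfolding soliton_def using l posW d1 d2 fi Wlim by simp
  then show thesis using l ae by (rule that)
qed

text \<open>u is real off the vertex, so the real parts of any representing pair represent it as
  well.\<close>

lemma positive_rep:
  assumes D: "u \<in> Dspace \<tau>" and pos: "\<And>x. x \<noteq> 0 \<Longrightarrow> Im (u x) = 0 \<and> 0 < Re (u x)"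
  obtains V V' W W' :: "real \<Rightarrow> real" where
    "rep u (\<lambda>x. complex_of_real (V x)) (\<lambda>x. complex_of_real (V' x)) (\<lambda>x. complex_of_real (W x)) (\<lambda>x. complex_of_real (W' x))"
    "\<forall>x>0. V x > 0" "\<forall>x>0. W x > 0" "W 0 = \<tau> * V 0"
proof -
  obtain v v' w w' where r: "rep u v v' w w'" and "w 0 = of_real \<tau> * v 0" by (rule Dspace_rep[OF D])
  have re: "H1pair (\<lambda>x. complex_of_real (Re (f x))) (\<lambda>x. complex_of_real (Re (f' x)))" if "H1pair f f'" for f f'
    unfolding H1pair_def sqi_of_real using H1pairD[OF that] by (intro conjI prim_of_real prim_Re sqi_Re)
  have uc: "complex_of_real (Re (u x)) = u x" if "x \<noteq> 0" for x using pos[OF that] by (simp add: complex_eq_iff)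
  have r': "rep u (\<lambda>x. complex_of_real (Re (v x))) (\<lambda>x. complex_of_real (Re (v' x)))
      (\<lambda>x. complex_of_real (Re (w x))) (\<lambda>x. complex_of_real (Re (w' x)))"
    unfolding rep_def
  proof (intro conjI re repD(1,2)[OF r] allI impI)
    fix x :: real assume x: "0 < x"
    show "u (- x) = complex_of_real (Re (v x))" using uc[of "- x"] x by (simp add: repD(3)[OF r x])
    show "u x = complex_of_real (Re (w x))" using uc[of x] x by (simp add: repD(4)[OF r x])
  qed
  have "complex_of_real (Re (w 0)) = of_real \<tau> * complex_of_real (Re (v 0))"
    using rep_Dspace[OF r'] D by blast
  then have "Re (w 0) = \<tau> * Re (v 0)" by (metis of_real_eq_iff of_real_mult)
  moreover have vp: "Re (v x) > 0" if "x > 0" for x using pos[of "- x"] that by (simp add: repD(3)[OF r that])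
  moreover have wp: "Re (w x) > 0" if "x > 0" for x using pos[of x] that by (simp add: repD(4)[OF r that])
  ultimately show thesis by (intro that[OF r'] allI impI)
qed

section \<open>The Lagrange multiplier and the vertex condition\<close>

lemma half_diff_deriv_cong:
  assumes v: "H1pair v v'" "H1pair v v''" and p: "H1pair p p'"
  shows "half_diff v v' p p' = half_diff v v'' p p'"
proof -
  have "AE x in HL. v' x = v'' x"
    unfolding HL_AE_iff by (rule prim_unique[OF H1pairD(1)[OF v(1)] H1pairD(1)[OF v(2)]])
  then have "AE x in HL. Re (v' x * cnj (p' x)) = Re (v'' x * cnj (p' x))" by eventually_elim simp
  then have "(\<integral>x. Re (v' x * cnj (p' x)) \<partial>HL) = (\<integral>x. Re (v'' x * cnj (p' x)) \<partial>HL)"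
    by (intro integral_cong_AE borel_measurable_integrable sqi_inner H1pairD(3)[OF v(1)] H1pairD(3)[OF v(2)] H1pairD(3)[OF p])
  then show ?thesis by (simp only: half_diff_def)
qed

text \<open>Subtracting from \<eta> its projection onto u gives a direction that is orthogonal to u
  and keeps the jump condition. Stationarity and linearity then give the multiplier: minus the
  differential along u itself, divided by \<mu>.\<close>

lemma stationary_multiplier:
  assumes r: "rep u v v' w w'" and D: "u \<in> Dmass \<tau> \<mu>" and \<mu>: "\<mu> > 0" and st: "stationary_state \<alpha> \<tau> \<mu> u"
  shows "\<exists>l. \<forall>\<eta> p p' q q'. rep \<eta> p p' q q' \<longrightarrow> q 0 = of_real \<tau> * p 0 \<longrightarrow>
    energy_diff \<alpha> v v' w w' p p' q q' = - l * ((\<integral>x. Re (v x * cnj (p x)) \<partial>HL) + (\<integral>x. Re (w x * cnj (q x)) \<partial>HL))"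
proof -
  have jump: "w 0 = of_real \<tau> * v 0" using D rep_Dspace[OF r] by (simp add: Dmass_def)
  have m: "(\<integral>x. (cmod (v x))\<^sup>2 \<partial>HL) + (\<integral>x. (cmod (w x))\<^sup>2 \<partial>HL) = \<mu>"
    using rep_mass[OF r] D by (simp add: Dmass_def)
  note S = stationary_state_iff[OF r D, THEN iffD1, OF st, rule_format]
  have add_scale: "energy_diff \<alpha> v v' w w' (\<lambda>x. p x + c *\<^sub>R v x) (\<lambda>x. p' x + c *\<^sub>R v' x) (\<lambda>x. q x + c *\<^sub>R w x) (\<lambda>x. q' x + c *\<^sub>R w' x)
      = energy_diff \<alpha> v v' w w' p p' q q' + c * energy_diff \<alpha> v v' w w' v v' w w'"
    if h: "rep \<eta> p p' q q'" for \<eta> p p' q q' c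
    unfolding energy_diff_def half_diff_add[OF repD(1)[OF r] repD(1)[OF h] H1pair_scaleR[OF repD(1)[OF r]]]
      half_diff_add[OF repD(2)[OF r] repD(2)[OF h] H1pair_scaleR[OF repD(2)[OF r]]] half_diff_scaleR
    by (simp add: algebra_simps)
  have inner: "(\<integral>x. Re (f x * cnj (g x + c *\<^sub>R f x)) \<partial>HL) = (\<integral>x. Re (f x * cnj (g x)) \<partial>HL) + c * (\<integral>x. (cmod (f x))\<^sup>2 \<partial>HL)"
    if f: "sqi f" and g: "sqi g" for f g :: "real \<Rightarrow> complex" and c
  proof -
    have "Re (f x * cnj (g x + c *\<^sub>R f x)) = Re (f x * cnj (g x)) + c * (cmod (f x))\<^sup>2" for x
      unfolding cmod_power2 by (simp add: power2_eq_square algebra_simps)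
    then show ?thesis
      using sqi_inner[OF f g] sqi_integrable[OF f] by (simp only:) (subst Bochner_Integration.integral_add, auto)
  qed
  define l where "l = - energy_diff \<alpha> v v' w w' v v' w w' / \<mu>"
  show ?thesis
  proof (intro exI[of _ l] allI impI)
    fix \<eta> p p' q q' assume h: "rep \<eta> p p' q q'" and j: "q 0 = of_real \<tau> * p 0"
    define I where "I = (\<integral>x. Re (v x * cnj (p x)) \<partial>HL) + (\<integral>x. Re (w x * cnj (q x)) \<partial>HL)"
    define c where "c = - I / \<mu>"
    have "(\<integral>x. Re (v x * cnj (p x + c *\<^sub>R v x)) \<partial>HL) + (\<integral>x. Re (w x * cnj (q x + c *\<^sub>R w x)) \<partial>HL) = I + c * \<mu>"
      unfolding inner[OF H1pairD(2)[OF repD(1)[OF r]] H1pairD(2)[OF repD(1)[OF h]]]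
        inner[OF H1pairD(2)[OF repD(2)[OF r]] H1pairD(2)[OF repD(2)[OF h]]] I_def m[symmetric] by (simp add: algebra_simps)
    also have "\<dots> = 0" using \<mu> by (simp add: c_def)
    finally have o: "(\<integral>x. Re (v x * cnj (p x + c *\<^sub>R v x)) \<partial>HL) + (\<integral>x. Re (w x * cnj (q x + c *\<^sub>R w x)) \<partial>HL) = 0" .
    have j': "q 0 + c *\<^sub>R w 0 = of_real \<tau> * (p 0 + c *\<^sub>R v 0)" unfolding j jump by (simp add: algebra_simps)
    have "energy_diff \<alpha> v v' w w' p p' q q' + c * energy_diff \<alpha> v v' w w' v v' w w' = 0"
      unfolding add_scale[OF h, symmetric] by (rule S[OF rep_add[OF h rep_scaleR[OF r]] j' o])
    then show "energy_diff \<alpha> v v' w w' p p' q q' = - l * ((\<integral>x. Re (v x * cnj (p x)) \<partial>HL) + (\<integral>x. Re (w x * cnj (q x)) \<partial>HL))"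
      unfolding I_def[symmetric] using \<mu> by (simp add: l_def c_def field_simps)
  qed
qed

lemma half_line_weak_equation:
  fixes W W' Q Q' :: "real \<Rightarrow> real"
  assumes W: "H1pair (\<lambda>x. complex_of_real (W x)) (\<lambda>x. complex_of_real (W' x))" and Q: "sqi Q"
    and e: "half_diff (\<lambda>x. complex_of_real (W x)) (\<lambda>x. complex_of_real (W' x)) (\<lambda>x. complex_of_real (Q x)) (\<lambda>x. complex_of_real (Q' x))
      = - l * (\<integral>x. Re (complex_of_real (W x) * cnj (complex_of_real (Q x))) \<partial>HL)"
  shows "(\<integral>x. W' x * Q' x \<partial>HL) + (\<integral>x. (l * W x - W x ^ 5) * Q x \<partial>HL) = 0"
proof -
  have sQ: "sqi (\<lambda>x. complex_of_real (Q x))" using Q by (simp add: sqi_of_real)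
  have r1: "Re (complex_of_real a * cnj (complex_of_real b)) = a * b" for a b by simp
  have r2: "cmod (complex_of_real a) ^ 4 * (a * b) = a ^ 5 * b" for a b :: real
    by (simp add: power_even_abs power_numeral_reduce)
  have i1: "integrable HL (\<lambda>x. W x * Q x)" using sqi_inner[OF H1pairD(2)[OF W] sQ] unfolding r1 .
  have i3: "integrable HL (\<lambda>x. W x ^ 5 * Q x)" using pow4_inner_integrable[OF W sQ] unfolding r1 r2 .
  have "(\<integral>x. (l * W x - W x ^ 5) * Q x \<partial>HL) = (\<integral>x. l * (W x * Q x) - W x ^ 5 * Q x \<partial>HL)"
    by (simp only: left_diff_distrib mult.assoc)
  also have "\<dots> = l * (\<integral>x. W x * Q x \<partial>HL) - (\<integral>x. W x ^ 5 * Q x \<partial>HL)"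
    using i1 i3 by simp
  finally show ?thesis using e unfolding half_diff_real r1 Re_complex_of_real by linarith
qed

lemma H1pair_0: "H1pair (\<lambda>x. complex_of_real 0) (\<lambda>x. complex_of_real 0)"
  using prim_const[of "complex_of_real 0"] by (simp add: H1pair_def sqi_def)

lemma half_diff_0: "half_diff v v' (\<lambda>x. complex_of_real 0) (\<lambda>x. complex_of_real 0) = 0"
  by (simp add: half_diff_def)

lemma energy_soliton_pair:
  assumes r: "rep u (\<lambda>x. complex_of_real (V x)) (\<lambda>x. complex_of_real (V' x)) (\<lambda>x. complex_of_real (W x)) (\<lambda>x. complex_of_real (W' x))"
    and V: "soliton k V V'" and W: "soliton k W W'"
  shows "energy \<alpha> u = - (V 0 * V' 0 + W 0 * W' 0) / 4 - \<alpha> / 2 * (V 0)\<^sup>2"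
    "mass u = (\<integral>x. (V x)\<^sup>2 \<partial>HL) + (\<integral>x. (W x)\<^sup>2 \<partial>HL)"
proof -
  have a: "(cmod (complex_of_real x))\<^sup>2 = x\<^sup>2" "cmod (complex_of_real x) ^ 6 = x ^ 6" for x by (simp_all add: power_even_abs)
  show "mass u = (\<integral>x. (V x)\<^sup>2 \<partial>HL) + (\<integral>x. (W x)\<^sup>2 \<partial>HL)" unfolding rep_mass[OF r] a ..
  show "energy \<alpha> u = - (V 0 * V' 0 + W 0 * W' 0) / 4 - \<alpha> / 2 * (V 0)\<^sup>2"
    unfolding rep_energy[OF r] a using soliton_energy[OF V] soliton_energy[OF W] by (simp add: field_simps)
qed

text \<open>A positive stationary state consists of two half-solitons with the same frequency, because both
  half-line equations carry the same Lagrange multiplier; testing with the state itself yields the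
  condition at the vertex.\<close>

lemma positive_stationary_angles:
  assumes ps: "positive_stationary_state \<alpha> \<tau> \<mu> u" and \<alpha>: "\<alpha> > 0" and \<tau>: "\<tau> > 0" and \<mu>: "\<mu> > 0"
  obtains x y k where "0 < x" "x < pi" "0 < y" "y < pi" "k > 0" "sin y = \<tau>\<^sup>2 * sin x" "k * (cos x + \<tau>\<^sup>2 * cos y) = \<alpha>"
    "x + y = kap * \<mu>" "energy \<alpha> u = - \<alpha> / 4 * (sqrt 3 * k * sin x)"
proof -
  have st: "stationary_state \<alpha> \<tau> \<mu> u" and pos: "\<And>x. x \<noteq> 0 \<Longrightarrow> Im (u x) = 0 \<and> 0 < Re (u x)"
    using ps by (auto simp: positive_stationary_state_def)
  have D: "u \<in> Dmass \<tau> \<mu>" using st by (simp add: stationary_state_def)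
  then have D': "u \<in> Dspace \<tau>" and m: "mass u = \<mu>" by (auto simp: Dmass_def)
  obtain V V' W W' where r: "rep u (\<lambda>x. complex_of_real (V x)) (\<lambda>x. complex_of_real (V' x)) (\<lambda>x. complex_of_real (W x)) (\<lambda>x. complex_of_real (W' x))"
    and Vp: "\<forall>x>0. V x > 0" and Wp: "\<forall>x>0. W x > 0" and jump: "W 0 = \<tau> * V 0"
    by (rule positive_rep[OF D' pos])
  let ?v = "\<lambda>x. complex_of_real (V x)" and ?v' = "\<lambda>x. complex_of_real (V' x)"
    and ?w = "\<lambda>x. complex_of_real (W x)" and ?w' = "\<lambda>x. complex_of_real (W' x)" and ?z = "\<lambda>x::real. complex_of_real 0"
  from stationary_multiplier[OF r D \<mu> st] obtain l where "\<forall>\<eta> p p' q q'. rep \<eta> p p' q q' \<longrightarrow> q 0 = of_real \<tau> * p 0 \<longrightarrow>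
    energy_diff \<alpha> ?v ?v' ?w ?w' p p' q q' = - l * ((\<integral>x. Re (?v x * cnj (p x)) \<partial>HL) + (\<integral>x. Re (?w x * cnj (q x)) \<partial>HL))" ..
  note l = this[rule_format]
  \<comment> \<open>Test functions living on one half-line: Q 0 = 0 makes the jump condition trivial
    and removes the trace term.\<close>
  have wW: "(\<integral>x. W' x * Q' x \<partial>HL) + (\<integral>x. (l * W x - W x ^ 5) * Q x \<partial>HL) = 0"
    if Q: "prim Q Q'" "sqi Q" "sqi Q'" "Q 0 = 0" for Q Q'
  proof (rule half_line_weak_equation[OF repD(2)[OF r] Q(2)])
    have "H1pair (\<lambda>x. complex_of_real (Q x)) (\<lambda>x. complex_of_real (Q' x))"
      unfolding H1pair_def sqi_of_real using Q prim_of_real by blast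
    then have "rep (\<lambda>x. if x < 0 then 0 else complex_of_real (Q x)) ?z ?z (\<lambda>x. complex_of_real (Q x)) (\<lambda>x. complex_of_real (Q' x))"
      using H1pair_0 by (simp add: rep_def)
    from l[OF this] show "half_diff ?w ?w' (\<lambda>x. complex_of_real (Q x)) (\<lambda>x. complex_of_real (Q' x))
      = - l * (\<integral>x. Re (?w x * cnj (complex_of_real (Q x))) \<partial>HL)"
      by (simp add: energy_diff_def half_diff_0[simplified] Q(4))
  qed
  have wV: "(\<integral>x. V' x * Q' x \<partial>HL) + (\<integral>x. (l * V x - V x ^ 5) * Q x \<partial>HL) = 0"
    if Q: "prim Q Q'" "sqi Q" "sqi Q'" "Q 0 = 0" for Q Q'
  proof (rule half_line_weak_equation[OF repD(1)[OF r] Q(2)])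
    have "H1pair (\<lambda>x. complex_of_real (Q x)) (\<lambda>x. complex_of_real (Q' x))"
      unfolding H1pair_def sqi_of_real using Q prim_of_real by blast
    then have "rep (\<lambda>x. if x < 0 then complex_of_real (Q (- x)) else 0) (\<lambda>x. complex_of_real (Q x)) (\<lambda>x. complex_of_real (Q' x)) ?z ?z"
      using H1pair_0 by (simp add: rep_def)
    from l[OF this] show "half_diff ?v ?v' (\<lambda>x. complex_of_real (Q x)) (\<lambda>x. complex_of_real (Q' x))
      = - l * (\<integral>x. Re (?v x * cnj (complex_of_real (Q x))) \<partial>HL)"
      by (simp add: energy_diff_def half_diff_0[simplified] Q(4))
  qed
  obtain Vd where Vs: "soliton (sqrt l) V Vd" and lp: "l > 0" and "AE x in lborel. x > 0 \<longrightarrow> V' x = Vd x"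
    by (rule weak_solution_is_soliton[OF repD(1)[OF r] Vp[rule_format] wV])
  obtain Wd where Ws: "soliton (sqrt l) W Wd" and "l > 0" and "AE x in lborel. x > 0 \<longrightarrow> W' x = Wd x"
    by (rule weak_solution_is_soliton[OF repD(2)[OF r] Wp[rule_format] wW])
  define k where "k = sqrt l"
  have k: "k > 0" "k\<^sup>2 = l" using lp by (auto simp: k_def)
  note Vs = Vs[folded k_def] and Ws = Ws[folded k_def]
  let ?vd = "\<lambda>x. complex_of_real (Vd x)" and ?wd = "\<lambda>x. complex_of_real (Wd x)"
  \<comment> \<open>The continuous derivatives \<open>Vd\<close> and \<open>Wd\<close> replace the
    given versions, which have no meaningful value at the vertex.\<close>
  have r2: "rep u ?v ?vd ?w ?wd" using r soliton_H1pair[OF Vs] soliton_H1pair[OF Ws] by (simp add: rep_def)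
  define x where "x = soliton_angle k V Vd 0"
  define y where "y = soliton_angle k W Wd 0"
  note ax = soliton_angle[OF Vs order_refl, folded x_def] and ay = soliton_angle[OF Ws order_refl, folded y_def]
  have V0: "V 0 > 0" "W 0 > 0" using solitonD(2)[OF Vs] solitonD(2)[OF Ws] by auto
  have Vd0: "Vd 0 = - k * cos x * V 0" and Wd0: "Wd 0 = - k * cos y * W 0"
    unfolding ax(3) ay(3) using k V0 by auto
  have V2: "(V 0)\<^sup>2 = sqrt 3 * k * sin x" unfolding ax(4) using k by simp
  have siny: "sin y = \<tau>\<^sup>2 * sin x" unfolding ax(4) ay(4) jump by (simp add: power_mult_distrib)
  have key: "k * (cos x + \<tau>\<^sup>2 * cos y) = \<alpha>"
  proof -
    let ?I = "(\<integral>x. Re (?v x * cnj (?v x)) \<partial>HL) + (\<integral>x. Re (?w x * cnj (?w x)) \<partial>HL)"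
    have "energy_diff \<alpha> ?v ?v' ?w ?w' ?v ?v' ?w ?w' = - l * ?I"
      by (rule l[OF r]) (simp add: jump)
    moreover have "energy_diff \<alpha> ?v ?v' ?w ?w' ?v ?v' ?w ?w' = - Vd 0 * V 0 - Wd 0 * W 0 - k\<^sup>2 * ?I - \<alpha> * (V 0)\<^sup>2"
      unfolding energy_diff_def half_diff_deriv_cong[OF repD(1)[OF r] repD(1)[OF r2] repD(1)[OF r]]
        half_diff_deriv_cong[OF repD(2)[OF r] repD(2)[OF r2] repD(2)[OF r]]
        half_diff_soliton[OF Vs repD(1)[OF r]] half_diff_soliton[OF Ws repD(2)[OF r]]
      by (simp add: algebra_simps power2_eq_square)
    ultimately have "- Vd 0 * V 0 - Wd 0 * W 0 = \<alpha> * (V 0)\<^sup>2" unfolding k(2) by simp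
    then have "(k * (cos x + \<tau>\<^sup>2 * cos y)) * (V 0)\<^sup>2 = \<alpha> * (V 0)\<^sup>2"
      unfolding Vd0 Wd0 jump by (simp add: algebra_simps power2_eq_square)
    then show ?thesis using V0 by simp
  qed
  have "(\<integral>x. (V x)\<^sup>2 \<partial>HL) + (\<integral>x. (W x)\<^sup>2 \<partial>HL) = \<mu>"
    using energy_soliton_pair(2)[OF r2 Vs Ws] m by linarith
  then have "kap * (\<integral>x. (V x)\<^sup>2 \<partial>HL) + kap * (\<integral>x. (W x)\<^sup>2 \<partial>HL) = kap * \<mu>"
    unfolding distrib_left[symmetric] by (rule arg_cong)
  then have "x + y = kap * \<mu>" unfolding soliton_mass(2)[OF Vs] soliton_mass(2)[OF Ws] x_def y_def .
  moreover have "energy \<alpha> u = - \<alpha> / 4 * (sqrt 3 * k * sin x)"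
  proof -
    have "energy \<alpha> u = (k * (cos x + \<tau>\<^sup>2 * cos y)) * (V 0)\<^sup>2 / 4 - \<alpha> / 2 * (V 0)\<^sup>2"
      unfolding energy_soliton_pair(1)[OF r2 Vs Ws] Vd0 Wd0 jump by (simp add: algebra_simps power2_eq_square)
    then show ?thesis unfolding key V2 by simp
  qed
  ultimately show thesis using ax(1,2) ay(1,2) k(1) siny key by (intro that)
qed

text \<open>The squared traces are sqrt 3 k sin x and sqrt 3 k sin y, so the sine relation is the
  jump condition. The cosines are left free, and the construction serves the ground states, the
  excited states and the pair at the critical mass alike.\<close>

lemma two_soliton_state:
  assumes k: "k > 0" and x: "0 < x" "x < pi" and y: "0 < y" "y < pi" and \<tau>: "\<tau> > 0" and s: "sin y = \<tau>\<^sup>2 * sin x"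
  obtains u V V' W W' where "rep u (\<lambda>x. complex_of_real (V x)) (\<lambda>x. complex_of_real (V' x)) (\<lambda>x. complex_of_real (W x)) (\<lambda>x. complex_of_real (W' x))"
    "soliton k V V'" "soliton k W W'" "u \<in> Dmass \<tau> ((x + y) / kap)" "W 0 = \<tau> * V 0"
    "(V 0)\<^sup>2 = sqrt 3 * k * sin x" "V' 0 = - k * cos x * V 0" "W' 0 = - k * cos y * W 0"
    "\<forall>z. Im (u z) = 0 \<and> 0 < Re (u z)"
proof -
  define V where "V = sech_profile k x"
  define V' where "V' = sech_profile_deriv k x"
  define W where "W = sech_profile k y"
  define W' where "W' = sech_profile_deriv k y"
  have Vs: "soliton k V V'" and Ws: "soliton k W W'"
    unfolding V_def V'_def W_def W'_def by (rule sech_profile_soliton[OF k])+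
  note v0 = sech_profile_0[OF k x, folded V_def V'_def] and w0 = sech_profile_0[OF k y, folded W_def W'_def]
  define u where "u = (\<lambda>z. complex_of_real (if z < 0 then V (- z) else W z))"
  have r: "rep u (\<lambda>x. complex_of_real (V x)) (\<lambda>x. complex_of_real (V' x)) (\<lambda>x. complex_of_real (W x)) (\<lambda>x. complex_of_real (W' x))"
    using soliton_H1pair[OF Vs] soliton_H1pair[OF Ws] by (simp add: rep_def u_def)
  have p: "V 0 > 0" "W 0 > 0" using solitonD(2)[OF Vs] solitonD(2)[OF Ws] by auto
  have "(W 0)\<^sup>2 = (\<tau> * V 0)\<^sup>2" unfolding power_mult_distrib v0(1) w0(1) s by simp
  then have j: "W 0 = \<tau> * V 0" using p \<tau> by (simp add: power2_eq_iff_nonneg)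
  have "kap * mass u = x + y"
    unfolding energy_soliton_pair(2)[OF r Vs Ws] distrib_left soliton_mass(2)[OF Vs] soliton_mass(2)[OF Ws] v0(3) w0(3) ..
  then have "mass u = (x + y) / kap" using kap_pos by (simp add: field_simps)
  moreover have "u \<in> Dspace \<tau>" unfolding rep_Dspace[OF r] j by simp
  ultimately have D: "u \<in> Dmass \<tau> ((x + y) / kap)" by (simp add: Dmass_def)
  have "Im (u z) = 0" "0 < Re (u z)" for z
    using solitonD(2)[OF Vs, of "- z"] solitonD(2)[OF Ws, of z] by (auto simp: u_def)
  then show thesis using r Vs Ws D j v0(1,2) w0(2) by (intro that allI conjI)
qed

section \<open>The angles\<close>

text \<open>The acute angle with tangent 1/t^2, in the right triangle with legs 1 and t^2.\<close>

definition crit_angle :: "real \<Rightarrow> real" where "crit_angle t = arcsin (1 / sqrt (1 + t ^ 4))"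

lemma crit_angle:
  assumes t: "t > 1"
  shows "0 < crit_angle t" "crit_angle t < pi / 4" "sin (crit_angle t) = 1 / sqrt (1 + t ^ 4)"
    "cos (crit_angle t) = t\<^sup>2 / sqrt (1 + t ^ 4)" "sin (2 * crit_angle t) = 2 * t\<^sup>2 / (1 + t ^ 4)"
proof -
  define s where "s = sqrt (1 + t ^ 4)"
  have t4: "t ^ 4 > 1" using t by (simp add: one_less_power)
  have s2: "s\<^sup>2 = 1 + t ^ 4" using t4 by (simp add: s_def)
  have s: "s > sqrt 2" unfolding s_def using t4 by simp
  have sp: "s > 0" by (rule less_trans[OF _ s]) simp
  have b: "0 < 1 / s" "1 / s < sqrt 2 / 2"
  proof -
    show "0 < 1 / s" using sp by simp
    have "1 / s < 1 / sqrt 2" using s sp by (intro divide_strict_left_mono) auto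
    also have "1 / sqrt 2 = sqrt 2 / 2" by (simp add: field_simps)
    finally show "1 / s < sqrt 2 / 2" .
  qed
  have h: "sqrt 2 / 2 \<le> (1::real)" using sin_le_one[of "pi / 4"] by (simp add: sin_45)
  have b3: "- 1 \<le> 1 / s" "1 / s \<le> 1" using b h by linarith+
  have e45: "arcsin (sqrt 2 / 2) = pi / 4"
    unfolding sin_45[symmetric] by (rule arcsin_sin) auto
  have "arcsin (1 / s) < arcsin (sqrt 2 / 2)" by (rule arcsin_less_arcsin[OF b3(1) b(2) h])
  then show "crit_angle t < pi / 4" unfolding e45 crit_angle_def s_def .
  have "arcsin 0 < arcsin (1 / s)" by (rule arcsin_less_arcsin) (use b(1) b3 in simp_all)
  then show "0 < crit_angle t" by (simp add: crit_angle_def s_def)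
  show sn: "sin (crit_angle t) = 1 / sqrt (1 + t ^ 4)"
    unfolding crit_angle_def s_def[symmetric] by (rule sin_arcsin[OF b3])
  have "cos (crit_angle t) = sqrt (1 - (1 / s)\<^sup>2)"
    unfolding crit_angle_def s_def[symmetric] by (rule cos_arcsin[OF b3])
  also have "1 - (1 / s)\<^sup>2 = (t\<^sup>2 / s)\<^sup>2"
  proof -
    have "(t\<^sup>2 / s)\<^sup>2 = t ^ 4 / (1 + t ^ 4)" unfolding power_divide s2 by (simp flip: power_mult)
    moreover have "1 - (1 / s)\<^sup>2 = t ^ 4 / (1 + t ^ 4)" unfolding power_divide s2 using t4 by (simp add: field_simps)
    ultimately show ?thesis by simp
  qed
  also have "sqrt ((t\<^sup>2 / s)\<^sup>2) = t\<^sup>2 / s" using sp by simp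
  finally show cs: "cos (crit_angle t) = t\<^sup>2 / sqrt (1 + t ^ 4)" by (simp add: s_def)
  have "sin (2 * crit_angle t) = 2 * t\<^sup>2 / s\<^sup>2" unfolding sin_double sn cs s_def[symmetric] by (simp add: power2_eq_square)
  then show "sin (2 * crit_angle t) = 2 * t\<^sup>2 / (1 + t ^ 4)" unfolding s2 .
qed

text \<open>The numerator of \<open>cot_bound\<close> vanishes at m = pi/2 + 2
  \<open>crit_angle t\<close>, since cos m = -sin(2 \<open>crit_angle t\<close>), and cos decreases
  on [0, pi]. On (pi, 2 pi) the reflection of M to 2 pi - M leads to the same comparison.\<close>

lemma cot_numerator_iff:
  assumes t: "t > 1"
  shows "0 < M \<Longrightarrow> M < pi \<Longrightarrow> 0 < (1 + t ^ 4) * cos M + 2 * t\<^sup>2 \<longleftrightarrow> M < pi / 2 + 2 * crit_angle t"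
    "pi < M \<Longrightarrow> M < 2 * pi \<Longrightarrow> (1 + t ^ 4) * cos M + 2 * t\<^sup>2 < 0 \<longleftrightarrow> M < 3 * pi / 2 - 2 * crit_angle t"
proof -
  note c = crit_angle[OF t]
  have p: "1 + t ^ 4 > 0" by (simp add: add_pos_nonneg)
  define m where "m = pi / 2 + 2 * crit_angle t"
  have m: "0 \<le> m" "m \<le> pi" using c(1,2) by (auto simp: m_def)
  have cm: "cos m = - (2 * t\<^sup>2 / (1 + t ^ 4))" unfolding m_def c(5)[symmetric] by (simp add: cos_add)
  have gt: "0 < (1 + t ^ 4) * z + 2 * t\<^sup>2 \<longleftrightarrow> cos m < z" and lt: "(1 + t ^ 4) * z + 2 * t\<^sup>2 < 0 \<longleftrightarrow> z < cos m" for z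
    unfolding cm using p by (auto simp: field_simps)
  show "0 < (1 + t ^ 4) * cos M + 2 * t\<^sup>2 \<longleftrightarrow> M < pi / 2 + 2 * crit_angle t" if "0 < M" "M < pi"
    unfolding gt m_def[symmetric] using cos_mono_less_eq[of m M] m that by simp
  show "(1 + t ^ 4) * cos M + 2 * t\<^sup>2 < 0 \<longleftrightarrow> M < 3 * pi / 2 - 2 * crit_angle t" if M: "pi < M" "M < 2 * pi"
  proof -
    have "cos M = cos (2 * pi - M)" by (simp add: cos_diff)
    then have "(1 + t ^ 4) * cos M + 2 * t\<^sup>2 < 0 \<longleftrightarrow> m < 2 * pi - M"
      unfolding lt using cos_mono_less_eq[of "2 * pi - M" m] m M by simp
    also have "\<dots> \<longleftrightarrow> M < 3 * pi / 2 - 2 * crit_angle t" unfolding m_def by (auto simp: field_simps)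
    finally show ?thesis .
  qed
qed

text \<open>Where sin(x + y) is not 0, this says that \<open>cot_bound t (x + y)\<close> is (cos x +
  t^2 cos y) / sin x: the sign required at the vertex becomes a condition on the total angle
  alone.\<close>

lemma angle_identity:
  fixes x y t :: real
  assumes "sin y = t\<^sup>2 * sin x"
  shows "sin x * ((1 + t ^ 4) * cos (x + y) + 2 * t\<^sup>2) = sin (x + y) * (cos x + t\<^sup>2 * cos y)"
proof -
  have cy: "(cos y)\<^sup>2 = 1 - t ^ 4 * (sin x)\<^sup>2"
    using sin_cos_squared_add[of y] unfolding assms by (simp add: power_mult_distrib)
  have cx: "(cos x)\<^sup>2 = 1 - (sin x)\<^sup>2" using sin_cos_squared_add[of x] by linarith
  have "sin (x + y) * (cos x + t\<^sup>2 * cos y) = sin x * ((1 + t ^ 4) * (cos x * cos y) + t\<^sup>2 * ((cos x)\<^sup>2 + (cos y)\<^sup>2))"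
    unfolding sin_add assms by (simp add: algebra_simps power2_eq_square power4_eq_xxxx)
  also have "\<dots> = sin x * ((1 + t ^ 4) * cos (x + y) + 2 * t\<^sup>2)"
    unfolding cx cy cos_add assms by (simp add: algebra_simps power2_eq_square power4_eq_xxxx)
  finally show ?thesis ..
qed

text \<open>The sign of sin(x + y) decides which sign the numerator of \<open>cot_bound\<close> must
  have. The value x + y = pi is impossible because then sin y = sin x, against t > 1.\<close>

lemma angles_range:
  assumes t: "t > 1" and x: "0 < x" "x < pi" and y: "0 < y" "y < pi" and s: "sin y = t\<^sup>2 * sin x"
    and c: "0 < cos x + t\<^sup>2 * cos y"
  shows "x + y < pi / 2 + 2 * crit_angle t \<or> pi < x + y \<and> x + y < 3 * pi / 2 - 2 * crit_angle t"
proof -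
  let ?N = "(1 + t ^ 4) * cos (x + y) + 2 * t\<^sup>2"
  have sx: "sin x > 0" using x by (rule sin_gt_zero)
  note id = angle_identity[OF s]
  consider "x + y < pi" | "x + y = pi" | "pi < x + y" by linarith
  then show ?thesis
  proof cases
    case 1
    have "sin (x + y) > 0" using x y 1 by (intro sin_gt_zero) auto
    then have "sin x * ?N > 0" unfolding id using c by simp
    then have "?N > 0" using sx by (simp add: zero_less_mult_iff)
    then show ?thesis using cot_numerator_iff(1)[OF t, of "x + y"] x y 1 by simp
  next
    case 2
    then have "y = pi - x" by simp
    then have "sin y = sin x" by simp
    then have "t\<^sup>2 = 1" using s sx by simp
    moreover have "t\<^sup>2 > 1" using t by (simp add: one_less_power)
    ultimately show ?thesis by simp
  next
    case 3
    have "sin (x + y) < 0" using x y 3 by (intro sin_lt_zero) auto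
    then have "sin x * ?N < 0" unfolding id using c by (rule mult_neg_pos)
    then have "?N < 0" using sx by (simp add: mult_less_0_iff)
    then show ?thesis using cot_numerator_iff(2)[OF t, of "x + y"] x y 3 by simp
  qed
qed

lemma angles_exist:
  assumes t: "t > 1" and M: "0 < M \<and> M < pi / 2 + 2 * crit_angle t \<or> pi < M \<and> M < 3 * pi / 2 - 2 * crit_angle t"
  obtains x y where "0 < x" "x < pi" "0 < y" "y < pi" "sin y = t\<^sup>2 * sin x" "0 < cos x + t\<^sup>2 * cos y" "x + y = M"
proof -
  note ca = crit_angle[OF t]
  have cases: "0 < M \<and> M < pi \<or> pi < M \<and> M < 2 * pi"
  proof (use M in \<open>elim disjE\<close>)
    assume "0 < M \<and> M < pi / 2 + 2 * crit_angle t"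
    then show ?thesis using ca(1,2) by linarith
  next
    assume "pi < M \<and> M < 3 * pi / 2 - 2 * crit_angle t"
    then show ?thesis using ca(1,2) pi_gt_zero by linarith
  qed
  have sM: "sin M \<noteq> 0"
    using cases sin_gt_zero[of M] sin_lt_zero[of M] by (elim disjE) auto
  \<comment> \<open>The cotangent of x, found by solving sin(M - x) = t^2 sin x; the shifted
    arctangent below inverts it with values in (0, pi).\<close>
  define a where "a = (t\<^sup>2 + cos M) / sin M"
  have aM: "a * sin M = t\<^sup>2 + cos M" using sM by (simp add: a_def)
  define x where "x = pi / 2 - arctan a"
  define y where "y = M - x"
  have x: "0 < x" "x < pi" using arctan_ubound[of a] arctan_lbound[of a] by (auto simp: x_def)
  have sx: "sin x > 0" using x by (rule sin_gt_zero)
  have cx: "cos x = a * sin x"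
    unfolding x_def by (simp add: cos_diff sin_diff cos_arctan sin_arctan)
  have sy: "sin y = t\<^sup>2 * sin x"
  proof -
    have "sin y = (a * sin M) * sin x - cos M * sin x" unfolding y_def sin_diff cx by simp
    then show ?thesis unfolding aM by (simp add: algebra_simps)
  qed
  have "t\<^sup>2 > 0" using t by simp
  then have syp: "sin y > 0" unfolding sy using sx by simp
  have xy: "x + y = M" by (simp add: y_def)
  let ?N = "(1 + t ^ 4) * cos (x + y) + 2 * t\<^sup>2"
  note id = angle_identity[OF sy]
  from cases have "0 < y \<and> y < pi \<and> 0 < cos x + t\<^sup>2 * cos y"
  proof
    assume A: "0 < M \<and> M < pi"
    \<comment> \<open>Since M and x lie in (0, pi), y lies in (-pi, pi), and sin y > 0 singles out
      the positive values.\<close>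
    have "0 < y"
    proof (rule ccontr)
      assume "\<not> 0 < y"
      then have "0 \<le> - y" "- y \<le> pi" using x A by (auto simp: y_def)
      then have "0 \<le> sin (- y)" by (rule sin_ge_zero)
      then show False using syp by simp
    qed
    moreover have "y < pi" using A x by (simp add: y_def)
    moreover have "M < pi / 2 + 2 * crit_angle t" using M A by auto
    then have "?N > 0" using cot_numerator_iff(1)[OF t, of M] A xy by simp
    then have "0 < sin (x + y) * (cos x + t\<^sup>2 * cos y)" unfolding id[symmetric] using sx by simp
    moreover have "sin (x + y) > 0" unfolding xy using A by (intro sin_gt_zero) auto
    ultimately show ?thesis by (simp add: zero_less_mult_iff)
  next
    assume A: "pi < M \<and> M < 2 * pi"
    have "y < pi"
    proof (rule ccontr)
      assume "\<not> y < pi"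
      then have "0 \<le> y - pi" "y - pi \<le> pi" using x A by (auto simp: y_def)
      then have "0 \<le> sin (y - pi)" by (rule sin_ge_zero)
      then show False using syp by simp
    qed
    moreover have "0 < y" using A x by (simp add: y_def)
    moreover have "M < 3 * pi / 2 - 2 * crit_angle t" using M A ca(1,2) by auto
    then have "?N < 0" using cot_numerator_iff(2)[OF t, of M] A xy by simp
    then have "sin (x + y) * (cos x + t\<^sup>2 * cos y) < 0" unfolding id[symmetric] using sx by (intro mult_pos_neg)
    moreover have "sin (x + y) < 0" unfolding xy using A by (intro sin_lt_zero) auto
    ultimately show ?thesis by (simp add: mult_less_0_iff)
  qed
  with x sy xy show thesis by (intro that) auto
qed

section \<open>Ground states and the critical mass\<close>

lemma kap_angles:
  "kap * mu_star \<tau> = pi / 2 + 2 * crit_angle \<tau>" "kap * mu_tilde \<tau> = 3 * pi / 2 - 2 * crit_angle \<tau>"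
  "kap * (sqrt 3 / 2 * pi) = pi"
proof -
  have "kap * (sqrt 3 / 2 * z) = z" for z by (simp add: kap_def)
  then show "kap * mu_star \<tau> = pi / 2 + 2 * crit_angle \<tau>" "kap * mu_tilde \<tau> = 3 * pi / 2 - 2 * crit_angle \<tau>"
    "kap * (sqrt 3 / 2 * pi) = pi" unfolding mu_star_def mu_tilde_def crit_angle_def by blast+
qed

definition ground_energy :: "real \<Rightarrow> real \<Rightarrow> real \<Rightarrow> real" where
  "ground_energy \<alpha> \<tau> \<mu> = - \<alpha>\<^sup>2 / (2 * kap * cot_bound \<tau> (kap * \<mu>))"

lemma cot_bound_pos:
  assumes "\<tau> > 1" "0 < M" "M < pi / 2 + 2 * crit_angle \<tau>"
  shows "M < pi" "0 < cot_bound \<tau> M"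
proof -
  show M: "M < pi" using assms(3) crit_angle(2)[OF assms(1)] by linarith
  have "sin M > 0" using assms(2) M by (rule sin_gt_zero)
  then show "0 < cot_bound \<tau> M"
    unfolding cot_bound_def using cot_numerator_iff(1)[OF assms(1,2) M] assms(3) by simp
qed

lemma ground_energy_le:
  assumes \<tau>: "\<tau> > 1" and \<mu>: "0 < \<mu>" "\<mu> < mu_star \<tau>" and D: "u \<in> Dmass \<tau> \<mu>"
  shows "ground_energy \<alpha> \<tau> \<mu> \<le> energy \<alpha> u"
proof -
  have D': "u \<in> Dspace \<tau>" and m: "mass u = \<mu>" using D by (auto simp: Dmass_def)
  obtain v v' w w' where r: "rep u v v' w w'" and j: "w 0 = of_real \<tau> * v 0" by (rule Dspace_rep[OF D'])
  have M: "0 < kap * \<mu>" "kap * \<mu> < pi / 2 + 2 * crit_angle \<tau>"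
    unfolding kap_angles(1)[symmetric] using \<mu> kap_pos by simp_all
  show ?thesis unfolding ground_energy_def
    by (rule energy_lower_bound[OF r j m \<mu>(1) cot_bound_pos[OF \<tau> M]])
qed

text \<open>The sine relation turns \<open>cot_bound\<close> into C / sin x with C = cos x +
  \<tau>^2 cos y, and \<alpha> = k C cancels the factor C: the lower bound is the energy of the
  soliton pair with these angles.\<close>

lemma ground_energy_angles:
  assumes x: "0 < x" "x < pi" and y: "0 < y" and xy: "x + y < pi" and s: "sin y = \<tau>\<^sup>2 * sin x"
    and c: "k * (cos x + \<tau>\<^sup>2 * cos y) = \<alpha>" and k: "k > 0" and \<alpha>: "\<alpha> > 0" and m: "x + y = kap * \<mu>"
  shows "ground_energy \<alpha> \<tau> \<mu> = - \<alpha> / 4 * (sqrt 3 * k * sin x)"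
proof -
  have sp: "sin x > 0" "sin (x + y) > 0" using x y xy by (auto intro!: sin_gt_zero)
  define C where "C = cos x + \<tau>\<^sup>2 * cos y"
  have C: "C > 0" using c k \<alpha> zero_less_mult_pos[of k C] by (simp add: C_def)
  have "cot_bound \<tau> (x + y) = C / sin x"
    unfolding cot_bound_def C_def using angle_identity[OF s] sp by (simp add: field_simps)
  then have "ground_energy \<alpha> \<tau> \<mu> = - \<alpha>\<^sup>2 * sin x / (2 * kap * C)"
    unfolding ground_energy_def m[symmetric] by simp
  also have "\<dots> = - \<alpha> * (k * C) * sin x / (2 * kap * C)"
    unfolding c[symmetric] C_def by (simp add: power2_eq_square)
  also have "\<dots> = - \<alpha> / 4 * (sqrt 3 * k * sin x)"
    using C by (simp add: kap_def field_simps)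
  finally show ?thesis .
qed

lemma ground_state_exists:
  assumes \<alpha>: "\<alpha> > 0" and \<tau>: "\<tau> > 1" and \<mu>: "0 < \<mu>" "\<mu> < mu_star \<tau>"
  obtains u where "ground_state \<alpha> \<tau> \<mu> u" "energy \<alpha> u = ground_energy \<alpha> \<tau> \<mu>"
proof -
  have M: "0 < kap * \<mu>" "kap * \<mu> < pi / 2 + 2 * crit_angle \<tau>"
    unfolding kap_angles(1)[symmetric] using \<mu> kap_pos by simp_all
  obtain x y where x: "0 < x" "x < pi" and y: "0 < y" "y < pi" and s: "sin y = \<tau>\<^sup>2 * sin x"
    and c: "0 < cos x + \<tau>\<^sup>2 * cos y" and xy: "x + y = kap * \<mu>"
    by (rule angles_exist[OF \<tau> disjI1[OF conjI[OF M]]])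
  \<comment> \<open>The frequency is dictated by the derivative condition at the vertex.\<close>
  define k where "k = \<alpha> / (cos x + \<tau>\<^sup>2 * cos y)"
  have k: "k > 0" "k * (cos x + \<tau>\<^sup>2 * cos y) = \<alpha>" using c \<alpha> by (auto simp: k_def)
  have \<tau>0: "\<tau> > 0" using \<tau> by simp
  obtain u V V' W W' where r: "rep u (\<lambda>x. complex_of_real (V x)) (\<lambda>x. complex_of_real (V' x)) (\<lambda>x. complex_of_real (W x)) (\<lambda>x. complex_of_real (W' x))"
    and Vs: "soliton k V V'" and Ws: "soliton k W W'" and D: "u \<in> Dmass \<tau> ((x + y) / kap)" and j: "W 0 = \<tau> * V 0"
    and V2: "(V 0)\<^sup>2 = sqrt 3 * k * sin x" and d: "V' 0 = - k * cos x * V 0" "W' 0 = - k * cos y * W 0"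
    and re: "\<forall>z. Im (u z) = 0 \<and> 0 < Re (u z)"
    by (rule two_soliton_state[OF k(1) x y \<tau>0 s])
  have D: "u \<in> Dmass \<tau> \<mu>" using D kap_pos unfolding xy by simp
  have "energy \<alpha> u = (k * (cos x + \<tau>\<^sup>2 * cos y)) * (V 0)\<^sup>2 / 4 - \<alpha> / 2 * (V 0)\<^sup>2"
    unfolding energy_soliton_pair(1)[OF r Vs Ws] d j by (simp add: algebra_simps power2_eq_square)
  also have "\<dots> = - \<alpha> / 4 * (sqrt 3 * k * sin x)" unfolding k(2) V2 by simp
  also have "\<dots> = ground_energy \<alpha> \<tau> \<mu>"
    by (rule ground_energy_angles[OF x y(1) _ s k(2,1) \<alpha> xy, symmetric]) (use cot_bound_pos(1)[OF \<tau> M] xy in simp)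
  finally have E: "energy \<alpha> u = ground_energy \<alpha> \<tau> \<mu>" .
  have "ground_state \<alpha> \<tau> \<mu> u"
    unfolding ground_state_def E using D re ground_energy_le[OF \<tau> \<mu>] by (simp add: less_imp_le)
  with E show thesis by (intro that)
qed

text \<open>At the critical mass the soliton pair has zero energy apart from the point interaction, which
  scales like $-k$; larger masses are reached by a multiplicative factor.\<close>

lemma energy_unbounded_below:
  assumes \<alpha>: "\<alpha> > 0" and \<tau>: "\<tau> > 1" and \<mu>: "mu_star \<tau> \<le> \<mu>"
  shows "\<exists>v\<in>Dmass \<tau> \<mu>. energy \<alpha> v < E"
proof -
  note ca = crit_angle[OF \<tau>]
  \<comment> \<open>The critical pair: sin y = cos x = \<tau>^2 sin x and cos y = -sin x, so that
    cos x + \<tau>^2 cos y = 0 and x + y is kap times the critical mass.\<close>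
  define x where "x = crit_angle \<tau>"
  define y where "y = pi / 2 + crit_angle \<tau>"
  have x: "0 < x" "x < pi" using ca(1,2) pi_gt_zero by (auto simp: x_def)
  have y: "0 < y" "y < pi" using ca(1,2) by (auto simp: y_def)
  have \<tau>0: "\<tau> > 0" using \<tau> by simp
  have sy: "sin y = cos x" and cy: "cos y = - sin x" by (auto simp: x_def y_def sin_add cos_add)
  have s: "sin y = \<tau>\<^sup>2 * sin x" unfolding sy unfolding x_def ca(3,4) by simp
  have c: "cos x + \<tau>\<^sup>2 * cos y = 0" unfolding cy using s sy by simp
  have sx: "sin x > 0" using x by (rule sin_gt_zero)
  have mp: "kap * mu_star \<tau> > 0" unfolding kap_angles(1) using ca(1) pi_gt_zero by linarith
  then have ms: "mu_star \<tau> > 0" using kap_pos zero_less_mult_pos by blast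
  \<comment> \<open>Solved from the requirement that the point interaction alone contributes -(|E| +
    1).\<close>
  define k where "k = (\<bar>E\<bar> + 1) / (\<alpha> / 2 * (sqrt 3 * sin x))"
  have k: "k > 0" using \<alpha> sx by (simp add: k_def add_nonneg_pos)
  have kE: "\<alpha> / 2 * (sqrt 3 * k * sin x) = \<bar>E\<bar> + 1" using \<alpha> sx by (simp add: k_def field_simps)
  obtain u V V' W W' where r: "rep u (\<lambda>x. complex_of_real (V x)) (\<lambda>x. complex_of_real (V' x)) (\<lambda>x. complex_of_real (W x)) (\<lambda>x. complex_of_real (W' x))"
    and Vs: "soliton k V V'" and Ws: "soliton k W W'" and D: "u \<in> Dmass \<tau> ((x + y) / kap)" and j: "W 0 = \<tau> * V 0"
    and V2: "(V 0)\<^sup>2 = sqrt 3 * k * sin x" and d: "V' 0 = - k * cos x * V 0" "W' 0 = - k * cos y * W 0"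
    and re: "\<forall>z. Im (u z) = 0 \<and> 0 < Re (u z)"
    by (rule two_soliton_state[OF k x y \<tau>0 s])
  have "x + y = kap * mu_star \<tau>" unfolding kap_angles(1) x_def y_def by simp
  then have mu: "mass u = mu_star \<tau>" "u \<in> Dspace \<tau>" using D kap_pos by (simp_all add: Dmass_def)
  define a where "a = sqrt (\<mu> / mu_star \<tau>)"
  have a2: "a\<^sup>2 = \<mu> / mu_star \<tau>" using \<mu> ms by (simp add: a_def)
  have a1: "a\<^sup>2 \<ge> 1" unfolding a2 using \<mu> ms by simp
  let ?u = "\<lambda>x. a *\<^sub>R u x"
  note ra = rep_scaleR[OF r, of a]
  have ca: "(cmod (a *\<^sub>R z))\<^sup>2 = a\<^sup>2 * (cmod z)\<^sup>2" "cmod (a *\<^sub>R z) ^ 6 = a ^ 6 * cmod z ^ 6" for z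
    by (simp_all add: power_mult_distrib power_even_abs)
  have "mass ?u = a\<^sup>2 * mass u" unfolding rep_mass[OF ra] rep_mass[OF r] ca by (simp add: distrib_left)
  then have Da: "?u \<in> Dmass \<tau> \<mu>" using mu Dspace_scaleR[OF mu(2)] a2 ms by (simp add: Dmass_def)
  define K where "K = (\<integral>x. (cmod (complex_of_real (V' x)))\<^sup>2 \<partial>HL) + (\<integral>x. (cmod (complex_of_real (W' x)))\<^sup>2 \<partial>HL)"
  define S where "S = (\<integral>x. cmod (complex_of_real (V x)) ^ 6 \<partial>HL) + (\<integral>x. cmod (complex_of_real (W x)) ^ 6 \<partial>HL)"
  define B where "B = (cmod (complex_of_real (V 0)))\<^sup>2"
  have B: "B = sqrt 3 * k * sin x" using V2 by (simp add: B_def)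
  have S0: "S \<ge> 0" unfolding S_def by (intro add_nonneg_nonneg Bochner_Integration.integral_nonneg) auto
  have Eu: "energy \<alpha> u = 1/2 * K - 1/6 * S - \<alpha> / 2 * B" unfolding rep_energy[OF r] K_def S_def B_def ..
  have "energy \<alpha> u = k * (cos x + \<tau>\<^sup>2 * cos y) * (V 0)\<^sup>2 / 4 - \<alpha> / 2 * (V 0)\<^sup>2"
    unfolding energy_soliton_pair(1)[OF r Vs Ws] d j by (simp add: algebra_simps power2_eq_square)
  then have "energy \<alpha> u = - \<alpha> / 2 * B" unfolding c V2 B by simp
  with Eu have KS: "1/2 * K = 1/6 * S" by simp
  have "energy \<alpha> ?u = 1/2 * (a\<^sup>2 * K) - 1/6 * (a ^ 6 * S) - \<alpha> / 2 * (a\<^sup>2 * B)"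
    unfolding rep_energy[OF ra] K_def S_def B_def ca by (simp add: distrib_left)
  also have "\<dots> \<le> - (\<alpha> / 2 * B)"
  proof -
    \<comment> \<open>The kinetic part scales with a^2 and the sextic part with a^6; they balance at
      a = 1, so for a >= 1 their difference is nonpositive.\<close>
    have "a ^ 6 = a\<^sup>2 * (a\<^sup>2)\<^sup>2" by (simp flip: power_add power_mult)
    moreover have "(a\<^sup>2)\<^sup>2 \<ge> 1" using a1 by (rule one_le_power)
    ultimately have "a\<^sup>2 * 1 \<le> a ^ 6" using mult_left_mono[of 1 "(a\<^sup>2)\<^sup>2" "a\<^sup>2"] by simp
    then have "a\<^sup>2 * S \<le> a ^ 6 * S" using S0 by (intro mult_right_mono) auto
    moreover have "1/2 * (a\<^sup>2 * K) = 1/6 * (a\<^sup>2 * S)" using KS by (metis mult.left_commute)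
    moreover have "\<alpha> / 2 * B \<ge> 0" unfolding B kE by simp
    then have "1 * (\<alpha> / 2 * B) \<le> a\<^sup>2 * (\<alpha> / 2 * B)" using a1 by (intro mult_right_mono)
    moreover have "a\<^sup>2 * (\<alpha> / 2 * B) = \<alpha> / 2 * (a\<^sup>2 * B)" by (rule mult.left_commute)
    ultimately show ?thesis by linarith
  qed
  also have "\<dots> < E" unfolding B kE by linarith
  finally show ?thesis using Da by blast
qed

text \<open>Along directions orthogonal to u the frequency terms cancel because both halves have the
  same k, and what remains at the vertex is (k (cos x + \<tau>^2 cos y) - \<alpha>) V(0) Re p(0),
  which the choice of k makes 0.\<close>

lemma two_soliton_stationary:
  assumes \<alpha>: "\<alpha> > 0" and \<tau>: "\<tau> > 1" and M: "pi < kap * \<mu>" "kap * \<mu> < 3 * pi / 2 - 2 * crit_angle \<tau>"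
  shows "\<exists>u. positive_stationary_state \<alpha> \<tau> \<mu> u"
proof -
  obtain x y where x: "0 < x" "x < pi" and y: "0 < y" "y < pi" and s: "sin y = \<tau>\<^sup>2 * sin x"
    and c: "0 < cos x + \<tau>\<^sup>2 * cos y" and xy: "x + y = kap * \<mu>"
    by (rule angles_exist[OF \<tau> disjI2[OF conjI[OF M]]])
  define k where "k = \<alpha> / (cos x + \<tau>\<^sup>2 * cos y)"
  have k: "k > 0" "k * (cos x + \<tau>\<^sup>2 * cos y) = \<alpha>" using c \<alpha> by (auto simp: k_def)
  have \<tau>0: "\<tau> > 0" using \<tau> by simp
  obtain u V V' W W' where r: "rep u (\<lambda>x. complex_of_real (V x)) (\<lambda>x. complex_of_real (V' x)) (\<lambda>x. complex_of_real (W x)) (\<lambda>x. complex_of_real (W' x))"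
    and Vs: "soliton k V V'" and Ws: "soliton k W W'" and D: "u \<in> Dmass \<tau> ((x + y) / kap)" and j: "W 0 = \<tau> * V 0"
    and V2: "(V 0)\<^sup>2 = sqrt 3 * k * sin x" and d: "V' 0 = - k * cos x * V 0" "W' 0 = - k * cos y * W 0"
    and re: "\<forall>z. Im (u z) = 0 \<and> 0 < Re (u z)"
    by (rule two_soliton_state[OF k(1) x y \<tau>0 s])
  have D: "u \<in> Dmass \<tau> \<mu>" using D kap_pos unfolding xy by simp
  have "stationary_state \<alpha> \<tau> \<mu> u"
  proof (rule stationary_state_iff[OF r D, THEN iffD2], intro allI impI)
    fix \<eta> p p' q q' assume h: "rep \<eta> p p' q q'" and jq: "q 0 = of_real \<tau> * p 0"
      and o: "(\<integral>x. Re (complex_of_real (V x) * cnj (p x)) \<partial>HL) + (\<integral>x. Re (complex_of_real (W x) * cnj (q x)) \<partial>HL) = 0"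
    let ?I = "\<integral>x. Re (complex_of_real (V x) * cnj (p x)) \<partial>HL"
    have o': "(\<integral>x. Re (complex_of_real (W x) * cnj (q x)) \<partial>HL) = - ?I" using o by linarith
    have q0: "Re (q 0) = \<tau> * Re (p 0)" unfolding jq by simp
    have p0: "Re (complex_of_real (V 0) * cnj (p 0)) = V 0 * Re (p 0)" by simp
    have "energy_diff \<alpha> (\<lambda>x. complex_of_real (V x)) (\<lambda>x. complex_of_real (V' x)) (\<lambda>x. complex_of_real (W x)) (\<lambda>x. complex_of_real (W' x)) p p' q q'
      = - V' 0 * Re (p 0) - W' 0 * (\<tau> * Re (p 0)) - \<alpha> * (V 0 * Re (p 0))"
      unfolding energy_diff_def half_diff_soliton[OF Vs repD(1)[OF h]] half_diff_soliton[OF Ws repD(2)[OF h]] o' q0 p0 by simp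
    also have "\<dots> = (k * (cos x + \<tau>\<^sup>2 * cos y)) * (V 0 * Re (p 0)) - \<alpha> * (V 0 * Re (p 0))"
      unfolding d j by (simp add: algebra_simps power2_eq_square)
    also have "\<dots> = 0" unfolding k(2) by simp
    finally show "energy_diff \<alpha> (\<lambda>x. complex_of_real (V x)) (\<lambda>x. complex_of_real (V' x)) (\<lambda>x. complex_of_real (W x)) (\<lambda>x. complex_of_real (W' x)) p p' q q' = 0" .
  qed
  then show ?thesis using re by (auto simp: positive_stationary_state_def)
qed

theorem theorem2p3:
  fixes \<alpha> \<tau> \<mu> :: real
  assumes "\<alpha> > 0" and "\<tau> > 1" and "\<mu> > 0"
  shows "(0 < \<mu> \<and> \<mu> < mu_star \<tau> \<longrightarrow> (\<exists>c::real. c > 0 \<and> energy_inf \<alpha> \<tau> \<mu> = ereal (- c)))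
       \<and> (mu_star \<tau> \<le> \<mu> \<longrightarrow> energy_inf \<alpha> \<tau> \<mu> = - \<infinity>)
       \<and> ((\<exists>u. ground_state \<alpha> \<tau> \<mu> u) \<longleftrightarrow> 0 < \<mu> \<and> \<mu> < mu_star \<tau>)
       \<and> ((\<exists>u. positive_stationary_state \<alpha> \<tau> \<mu> u \<and> \<not> ground_state \<alpha> \<tau> \<mu> u)
            \<longleftrightarrow> sqrt 3 / 2 * pi < \<mu> \<and> \<mu> < mu_tilde \<tau>)"
proof -
  note \<alpha> = assms(1) and \<tau> = assms(2) and \<mu> = assms(3)
  have \<tau>0: "\<tau> > 0" using \<tau> by simp
  have GE: "ground_energy \<alpha> \<tau> \<mu> < 0" if "\<mu> < mu_star \<tau>"
  proof -
    have "0 < kap * \<mu>" "kap * \<mu> < pi / 2 + 2 * crit_angle \<tau>"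
      unfolding kap_angles(1)[symmetric] using \<mu> that kap_pos by simp_all
    from cot_bound_pos(2)[OF \<tau> this] show ?thesis
      unfolding ground_energy_def using \<alpha> kap_pos by (simp add: divide_neg_pos)
  qed
  have below: "\<exists>c::real. c > 0 \<and> energy_inf \<alpha> \<tau> \<mu> = ereal (- c)" if m: "\<mu> < mu_star \<tau>"
  proof (intro exI[of _ "- ground_energy \<alpha> \<tau> \<mu>"] conjI)
    show "0 < - ground_energy \<alpha> \<tau> \<mu>" using GE[OF m] by simp
    obtain u where u: "ground_state \<alpha> \<tau> \<mu> u" "energy \<alpha> u = ground_energy \<alpha> \<tau> \<mu>"
      by (rule ground_state_exists[OF \<alpha> \<tau> \<mu> m])
    have uD: "u \<in> Dmass \<tau> \<mu>" using u(1) by (simp add: ground_state_def)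
    have "energy_inf \<alpha> \<tau> \<mu> = ereal (ground_energy \<alpha> \<tau> \<mu>)"
      unfolding energy_inf_def
    proof (rule antisym)
      show "(INF v\<in>Dmass \<tau> \<mu>. ereal (energy \<alpha> v)) \<le> ereal (ground_energy \<alpha> \<tau> \<mu>)"
        by (rule INF_lower2[OF uD]) (simp add: u(2))
      show "ereal (ground_energy \<alpha> \<tau> \<mu>) \<le> (INF v\<in>Dmass \<tau> \<mu>. ereal (energy \<alpha> v))"
        by (rule INF_greatest) (simp add: ground_energy_le[OF \<tau> \<mu> m])
    qed
    then show "energy_inf \<alpha> \<tau> \<mu> = ereal (- (- ground_energy \<alpha> \<tau> \<mu>))" by simp
  qed
  have above: "energy_inf \<alpha> \<tau> \<mu> = - \<infinity>" if m: "mu_star \<tau> \<le> \<mu>"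
  proof -
    have "energy_inf \<alpha> \<tau> \<mu> \<le> ereal E" for E
    proof -
      from energy_unbounded_below[OF \<alpha> \<tau> m] obtain v where v: "v \<in> Dmass \<tau> \<mu>" "energy \<alpha> v < E" ..
      show ?thesis unfolding energy_inf_def by (rule INF_lower2[OF v(1)]) (use v(2) in simp)
    qed
    then show ?thesis by (rule ereal_bot)
  qed
  \<comment> \<open>A minimizer would be undercut by taking its own energy as the threshold.\<close>
  have noGS: "\<not> ground_state \<alpha> \<tau> \<mu> u" if m: "mu_star \<tau> \<le> \<mu>" for u
  proof
    assume g: "ground_state \<alpha> \<tau> \<mu> u"
    from energy_unbounded_below[OF \<alpha> \<tau> m] obtain v where v: "v \<in> Dmass \<tau> \<mu>" "energy \<alpha> v < energy \<alpha> u" ..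
    have "energy \<alpha> u \<le> energy \<alpha> v" using g v(1) by (simp add: ground_state_def)
    then show False using v(2) by simp
  qed
  have gs: "(\<exists>u. ground_state \<alpha> \<tau> \<mu> u) \<longleftrightarrow> \<mu> < mu_star \<tau>"
  proof
    assume "\<exists>u. ground_state \<alpha> \<tau> \<mu> u"
    then show "\<mu> < mu_star \<tau>" using noGS not_le by blast
  next
    assume "\<mu> < mu_star \<tau>"
    then obtain u where "ground_state \<alpha> \<tau> \<mu> u" "energy \<alpha> u = ground_energy \<alpha> \<tau> \<mu>"
      by (rule ground_state_exists[OF \<alpha> \<tau> \<mu>])
    then show "\<exists>u. ground_state \<alpha> \<tau> \<mu> u" by blast
  qed
  have st: "(\<exists>u. positive_stationary_state \<alpha> \<tau> \<mu> u \<and> \<not> ground_state \<alpha> \<tau> \<mu> u)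
      \<longleftrightarrow> pi < kap * \<mu> \<and> kap * \<mu> < 3 * pi / 2 - 2 * crit_angle \<tau>"
  proof
    assume "\<exists>u. positive_stationary_state \<alpha> \<tau> \<mu> u \<and> \<not> ground_state \<alpha> \<tau> \<mu> u"
    then obtain u where ps: "positive_stationary_state \<alpha> \<tau> \<mu> u" and ng: "\<not> ground_state \<alpha> \<tau> \<mu> u" by blast
    obtain x y k where x: "0 < x" "x < pi" and y: "0 < y" "y < pi" and k: "k > 0" and s: "sin y = \<tau>\<^sup>2 * sin x"
      and c: "k * (cos x + \<tau>\<^sup>2 * cos y) = \<alpha>" and xy: "x + y = kap * \<mu>" and E: "energy \<alpha> u = - \<alpha> / 4 * (sqrt 3 * k * sin x)"
      by (rule positive_stationary_angles[OF ps \<alpha> \<tau>0 \<mu>])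
    have c0: "0 < cos x + \<tau>\<^sup>2 * cos y" using c \<alpha> k zero_less_mult_pos by blast
    \<comment> \<open>Below the critical mass the angles of a positive stationary state attain the
      lower bound, so the state is already a ground state.\<close>
    have "\<not> kap * \<mu> < pi / 2 + 2 * crit_angle \<tau>"
    proof
      assume M: "kap * \<mu> < pi / 2 + 2 * crit_angle \<tau>"
      then have m: "\<mu> < mu_star \<tau>" unfolding kap_angles(1)[symmetric] using kap_pos by simp
      have "0 < kap * \<mu>" using kap_pos \<mu> by simp
      then have "x + y < pi" unfolding xy using M by (rule cot_bound_pos(1)[OF \<tau>])
      then have "energy \<alpha> u = ground_energy \<alpha> \<tau> \<mu>"
        unfolding E by (rule ground_energy_angles[OF x y(1) _ s c k \<alpha> xy, symmetric])
      then have "ground_state \<alpha> \<tau> \<mu> u"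
        using ps ground_energy_le[OF \<tau> \<mu> m]
        by (simp add: ground_state_def positive_stationary_state_def stationary_state_def less_imp_le)
      then show False using ng by contradiction
    qed
    then show "pi < kap * \<mu> \<and> kap * \<mu> < 3 * pi / 2 - 2 * crit_angle \<tau>"
      using angles_range[OF \<tau> x y s c0] unfolding xy by blast
  next
    assume M: "pi < kap * \<mu> \<and> kap * \<mu> < 3 * pi / 2 - 2 * crit_angle \<tau>"
    \<comment> \<open>\<open>crit_angle \<tau>\<close> < pi/4 puts the critical mass below this
      interval, where no ground state exists; the stationary state constructed here is therefore a
      further one.\<close>
    have "kap * mu_star \<tau> < kap * \<mu>" unfolding kap_angles(1) using M crit_angle(2)[OF \<tau>] by linarith
    then have "mu_star \<tau> \<le> \<mu>" using kap_pos by simp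
    from noGS[OF this] show "\<exists>u. positive_stationary_state \<alpha> \<tau> \<mu> u \<and> \<not> ground_state \<alpha> \<tau> \<mu> u"
      using two_soliton_stationary[OF \<alpha> \<tau> conjunct1[OF M] conjunct2[OF M]] by blast
  qed
  have range: "pi < kap * \<mu> \<longleftrightarrow> sqrt 3 / 2 * pi < \<mu>" "kap * \<mu> < 3 * pi / 2 - 2 * crit_angle \<tau> \<longleftrightarrow> \<mu> < mu_tilde \<tau>"
    unfolding kap_angles(2)[symmetric] using mult_less_cancel_left_pos[OF kap_pos, of "sqrt 3 / 2 * pi" \<mu>]
      mult_less_cancel_left_pos[OF kap_pos, of \<mu> "mu_tilde \<tau>"] unfolding kap_angles(3) by simp_all
  show ?thesis using below above \<mu> unfolding gs st range by blast
qed

end
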